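(* Let $\Omega\subset\mathbb{R}^n$, $n\ge 2$, be a bounded domain and let $G(x,t)=\int_0^{|t|}g(x,s)\,ds$ be a generalized N-function such that: (G0) there are constants $1<g^-\le g^+<n$ with $g^-\le \frac{g(x,t)t}{G(x,t)}\le g^+$ for all $x\in\mathbb{R}^n$, $t>0$; (G1) there is $F\ge 1$ with $F^{-1}\le G(x,1)\le F$ for almost every $x\in\mathbb{R}^n$; (G3) there is $L_0>1$ such that for every $x_0\in\Omega$, for all sufficiently small $R>0$ and for all $t>1$, $$\sup_{x,y\in B_R(x_0)}|r(x,t)-r(y,t)|\le \frac{L_0}{|\ln(2R)|},\qquad r(x,t):=\frac{t\,g(x,t)}{G(x,t)}.$$ Let $M,\gamma,\gamma_1,\delta$ be positive constants with $\delta\le 2$. Then $$\mathcal{B}_{G(x,t)}(\Omega,M,\gamma,\gamma_1,\delta)\subset C^{0,\alpha}(\Omega),$$ where the Hölder exponent $\alpha\in(0,1]$ depends only on $n,g^-,g^+,F,L:=\exp(L_0),\gamma,\delta$ and is independent of $M$ and $\gamma_1$.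
   Context: Generalized N-function: a function $G(x,t)$ that for a.e. $x$ is even, continuous and convex in $t$ and strictly increasing in $t\ge 0$, is measurable in $x$ for each $t$, satisfies $G(x,0)=0$ and $G(x,t)>0$ for $t>0$, and, for a.e. $x$, $\lim_{t\to0}G(x,t)/t=0$ and $\lim_{t\to\infty}G(x,t)/t=\infty$. Here $g(x,t)$ is the right derivative of $G(x,\cdot)$ at $t\ge0$ (extended oddly in $t$). Musielak–Orlicz–Sobolev space: $L^{G(x,t)}(\Omega)$ is the set of measurable $u:\Omega\to\mathbb{R}$ with $\int_\Omega G(x,\lambda u)\,dx<\infty$ for some $\lambda>0$, with Luxemburg norm $\|u\|_{L^{G(x,t)}(\Omega)}=\inf\{\lambda>0:\int_\Omega G(x,u/\lambda)\,dx\le1\}$; $W^{1,G(x,t)}(\Omega)=\{u\in L^{G(x,t)}(\Omega):|Du|\in L^{G(x,t)}(\Omega)\}$. Conventions: $\max_E u$ means the essential supremum over $E$; $B_\rho$ is an open ball of radius $\rho$, and balls $B_\rho$, $B_{\rho'}$ appearing together are concentric; $|E|$ is Lebesgue measure. De Giorgi class: for positive constants $M,\gamma,\gamma_1,\delta$ with $\delta\le2$, a function $u\in W^{1,G(x,t)}(\Omega)$ with $\max_\Omega|u|\le M$ belongs to $\mathcal{B}_{G(x,t)}(\Omega,M,\gamma,\gamma_1,\delta)$ if both functions $w=\pm u$ satisfy $$\int_{A_{k,\rho-\sigma\rho}}G(x,|Dw|)\,dx\le\gamma\int_{A_{k,\rho}}G\left(x,\left|\frac{w(x)-k}{\sigma\rho}\right|\right)dx+\gamma_1|A_{k,\rho}|$$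 for every ball $B_\rho\subset\Omega$, every $\sigma\in(0,1)$ and every $k\ge\max_{B_\rho}w-\delta M$, where $A_{k,\rho}=\{x\in B_\rho:w(x)>k\}$. $C^{0,\alpha}(\overline{\Omega})$ is the set of Hölder continuous functions on $\overline\Omega$ with exponent $\alpha$; $C^{0,\alpha}(\Omega)$ is the set of $u$ with $u\in C^{0,\alpha}(\overline{\Omega'})$ for all $\Omega'\Subset\Omega$. *)

theory Defs
  imports "HOL-Analysis.Analysis" "HOL-Probability.Essential_Supremum"
begin

section \<open>Generalized N-functions\<close>

definition generalized_N_function :: "('a::euclidean_space \<Rightarrow> real \<Rightarrow> real) \<Rightarrow> bool" where
  "generalized_N_function G \<longleftrightarrow>
     (\<forall>t. (\<lambda>x. G x t) \<in> borel_measurable lebesgue) \<and>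
     (AE x in lebesgue.
        (\<forall>t. G x (- t) = G x t) \<and>
        continuous_on UNIV (G x) \<and>
        convex_on UNIV (G x) \<and>
        strict_mono_on {0..} (G x) \<and>
        G x 0 = 0 \<and>
        (\<forall>t>0. G x t > 0) \<and>
        ((\<lambda>t. G x t / t) \<longlongrightarrow> 0) (at 0) \<and>
        filterlim (\<lambda>t. G x t / t) at_top at_top)"

text \<open>The last conjunct follows from the convexity of \<open>G x\<close> and the first one; it
  records the representation of \<open>G\<close> as the primitive of \<open>g\<close>.\<close>

definition odd_right_derivative ::
    "('a::euclidean_space \<Rightarrow> real \<Rightarrow> real) \<Rightarrow> ('a \<Rightarrow> real \<Rightarrow> real) \<Rightarrow> bool" where
  "odd_right_derivative G g \<longleftrightarrow>
     (AE x in lebesgue.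
        (\<forall>t\<ge>0. (G x has_real_derivative g x t) (at_right t)) \<and>
        (\<forall>t. g x (- t) = - g x t) \<and>
        (\<forall>t. (g x has_integral G x t) {0..\<bar>t\<bar>}))"

definition growth_ratio ::
    "('a \<Rightarrow> real \<Rightarrow> real) \<Rightarrow> ('a \<Rightarrow> real \<Rightarrow> real) \<Rightarrow> 'a \<Rightarrow> real \<Rightarrow> real" where
  "growth_ratio G g x t = t * g x t / G x t"

definition growth_bounds ::
    "('a \<Rightarrow> real \<Rightarrow> real) \<Rightarrow> ('a \<Rightarrow> real \<Rightarrow> real) \<Rightarrow> real \<Rightarrow> real \<Rightarrow> bool" where
  "growth_bounds G g gm gp \<longleftrightarrow>
     (\<forall>x. \<forall>t>0. gm \<le> growth_ratio G g x t \<and> growth_ratio G g x t \<le> gp)"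

definition normalized_at_one :: "('a::euclidean_space \<Rightarrow> real \<Rightarrow> real) \<Rightarrow> real \<Rightarrow> bool" where
  "normalized_at_one G F \<longleftrightarrow> (AE x in lebesgue. 1 / F \<le> G x 1 \<and> G x 1 \<le> F)"

text \<open>Log-Hoelder continuity of the growth ratio. How small the radius \<open>R\<close> has to be is
  locally uniform in the centre: it may depend on a compact subset of \<open>\<Omega>\<close> containing the
  centre \<open>x0\<close>, hence may degenerate near the boundary, but on nothing else.\<close>

definition log_Hoelder_ratio ::
    "('a::euclidean_space) set \<Rightarrow> ('a \<Rightarrow> real \<Rightarrow> real) \<Rightarrow> ('a \<Rightarrow> real \<Rightarrow> real) \<Rightarrow> real \<Rightarrow> bool" where
  "log_Hoelder_ratio \<Omega> G g L0 \<longleftrightarrow>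
     (\<forall>K. compact K \<and> K \<subseteq> \<Omega> \<longrightarrow>
        (\<forall>\<^sub>F R in at_right 0. \<forall>x0\<in>K. \<forall>t>1. \<forall>x\<in>ball x0 R. \<forall>y\<in>ball x0 R.
           \<bar>growth_ratio G g x t - growth_ratio G g y t\<bar> \<le> L0 / \<bar>ln (2 * R)\<bar>))"


section \<open>Weak gradients\<close>

fun C_k :: "nat \<Rightarrow> ('a::euclidean_space \<Rightarrow> real) \<Rightarrow> bool" where
  "C_k 0 f \<longleftrightarrow> continuous_on UNIV f"
| "C_k (Suc k) f \<longleftrightarrow>
     (\<forall>x. f differentiable (at x)) \<and>
     (\<forall>i\<in>Basis. C_k k (\<lambda>x. frechet_derivative f (at x) i))"

definition test_functions :: "('a::euclidean_space) set \<Rightarrow> ('a \<Rightarrow> real) set" where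
  "test_functions \<Omega> =
     {\<phi>. (\<forall>k. C_k k \<phi>) \<and> compact (closure {x. \<phi> x \<noteq> 0}) \<and> closure {x. \<phi> x \<noteq> 0} \<subseteq> \<Omega>}"

definition locally_integrable_on ::
    "('a::euclidean_space \<Rightarrow> 'b::euclidean_space) \<Rightarrow> 'a set \<Rightarrow> bool" where
  "locally_integrable_on f \<Omega> \<longleftrightarrow> (\<forall>K. compact K \<and> K \<subseteq> \<Omega> \<longrightarrow> f absolutely_integrable_on K)"

definition has_weak_gradient ::
    "('a::euclidean_space) set \<Rightarrow> ('a \<Rightarrow> real) \<Rightarrow> ('a \<Rightarrow> 'a) \<Rightarrow> bool" where
  "has_weak_gradient \<Omega> u V \<longleftrightarrow>
     locally_integrable_on u \<Omega> \<and> locally_integrable_on V \<Omega> \<and>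
     (\<forall>\<phi>\<in>test_functions \<Omega>. \<forall>i\<in>Basis.
        (LINT x:\<Omega>|lebesgue. u x * frechet_derivative \<phi> (at x) i) =
        - (LINT x:\<Omega>|lebesgue. (V x \<bullet> i) * \<phi> x))"

text \<open>Weak gradients are determined up to a null set, which is all that matters below.\<close>

definition weak_gradient :: "('a::euclidean_space) set \<Rightarrow> ('a \<Rightarrow> real) \<Rightarrow> 'a \<Rightarrow> 'a" where
  "weak_gradient \<Omega> u = (SOME V. has_weak_gradient \<Omega> u V)"


section \<open>Musielak--Orlicz--Sobolev spaces and De Giorgi classes\<close>

text \<open>Functions are defined on the whole space; only their values on \<open>\<Omega>\<close> matter. The spaces
  consist of functions and not of classes modulo null sets.\<close>

definition musielak_orlicz ::
    "('a::euclidean_space \<Rightarrow> real \<Rightarrow> real) \<Rightarrow> 'a set \<Rightarrow> ('a \<Rightarrow> real) set" where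
  "musielak_orlicz G \<Omega> =
     {u \<in> borel_measurable (lebesgue_on \<Omega>).
        \<exists>c>0. (\<integral>\<^sup>+x\<in>\<Omega>. ennreal (G x (c * u x)) \<partial>lebesgue) < \<infinity>}"

definition musielak_orlicz_sobolev ::
    "('a::euclidean_space \<Rightarrow> real \<Rightarrow> real) \<Rightarrow> 'a set \<Rightarrow> ('a \<Rightarrow> real) set" where
  "musielak_orlicz_sobolev G \<Omega> =
     {u \<in> musielak_orlicz G \<Omega>.
        (\<exists>V. has_weak_gradient \<Omega> u V) \<and>
        (\<lambda>x. norm (weak_gradient \<Omega> u x)) \<in> musielak_orlicz G \<Omega>}"

definition ess_max :: "('a::euclidean_space) set \<Rightarrow> ('a \<Rightarrow> real) \<Rightarrow> ereal" where
  "ess_max E u = esssup (lebesgue_on E) (\<lambda>x. ereal (u x))"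

definition superlevel ::
    "('a::euclidean_space \<Rightarrow> real) \<Rightarrow> real \<Rightarrow> 'a \<Rightarrow> real \<Rightarrow> 'a set" where
  "superlevel w k z \<rho> = {x \<in> ball z \<rho>. w x > k}"

definition de_giorgi_class ::
    "('a::euclidean_space \<Rightarrow> real \<Rightarrow> real) \<Rightarrow> 'a set \<Rightarrow> real \<Rightarrow> real \<Rightarrow> real \<Rightarrow> real \<Rightarrow> ('a \<Rightarrow> real) set"
where
  "de_giorgi_class G \<Omega> M \<gamma> \<gamma>1 \<delta> =
     {u \<in> musielak_orlicz_sobolev G \<Omega>.
        ess_max \<Omega> (\<lambda>x. \<bar>u x\<bar>) \<le> ereal M \<and>
        (\<forall>w\<in>{u, \<lambda>x. - u x}. \<forall>z \<rho> \<sigma> k.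
           0 < \<rho> \<and> ball z \<rho> \<subseteq> \<Omega> \<and> 0 < \<sigma> \<and> \<sigma> < 1 \<and>
           ereal k \<ge> ess_max (ball z \<rho>) w - ereal (\<delta> * M) \<longrightarrow>
           (\<integral>\<^sup>+x\<in>superlevel w k z (\<rho> - \<sigma> * \<rho>).
               ennreal (G x (norm (weak_gradient \<Omega> w x))) \<partial>lebesgue)
           \<le> ennreal \<gamma> *
               (\<integral>\<^sup>+x\<in>superlevel w k z \<rho>. ennreal (G x \<bar>(w x - k) / (\<sigma> * \<rho>)\<bar>) \<partial>lebesgue)
             + ennreal \<gamma>1 * emeasure lebesgue (superlevel w k z \<rho>))}"


section \<open>Hoelder spaces\<close>

definition Hoelder_on :: "'a::metric_space set \<Rightarrow> real \<Rightarrow> ('a \<Rightarrow> real) set" where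
  "Hoelder_on S \<alpha> = {u. \<exists>C. \<forall>x\<in>S. \<forall>y\<in>S. \<bar>u x - u y\<bar> \<le> C * dist x y powr \<alpha>}"

definition Hoelder_loc :: "'a::metric_space set \<Rightarrow> real \<Rightarrow> ('a \<Rightarrow> real) set" where
  "Hoelder_loc \<Omega> \<alpha> =
     {u. \<forall>\<Omega>'. open \<Omega>' \<and> compact (closure \<Omega>') \<and> closure \<Omega>' \<subseteq> \<Omega> \<longrightarrow>
            u \<in> Hoelder_on (closure \<Omega>') \<alpha>}"

end

theory Submission
  imports Defs "HOL-Computational_Algebra.Polynomial"
begin

text \<open>
  The proof follows De Giorgi's scheme and rests on two ingredients.

  \<^item> The fact about Sobolev functions that carries the proof is the inequality called
    \<open>isoperimetric\<close> below: if around every point \<open>x\<close> of a ball \<open>B\<^sub>r\<close> a fixed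
    amount \<open>m\<close> of the ball of radius \<open>\<eta>\<close> about \<open>x\<close> lies in \<open>{w \<le> k}\<close>, then
    \<open>(l - k) m |B\<^sub>r \<inter> {w \<ge> l}|\<close> is at most \<open>\<eta> |B\<^sub>\<eta>|\<close> times the integral of \<open>|Dw|\<close> over
    \<open>B\<^bsub>r + \<eta>\<^esub> \<inter> {k < w < l}\<close>. It holds because on almost every segment of length less than \<open>\<eta>\<close> the
    function \<open>w\<close> is the primitive of its weak directional derivative, and a primitive that
    falls from \<open>l\<close> to \<open>k\<close> has to pay for it between these levels. Choosing \<open>\<eta>\<close> small
    compared with \<open>r\<close> yields a gain in the measure of the level set, as Sobolev's embedding
    would; choosing \<open>\<eta> = 2 r\<close> yields De Giorgi's inequality between two levels.

  \<^item> The nonstandard growth is removed at once. On a ball of radius \<open>R\<close> the log-Hoelder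
    condition makes \<open>G(x, T)\<close> and \<open>G(y, T)\<close> comparable for \<open>1 \<le> T \<le> (2 R)\<^sup>-\<^sup>3\<close>, up to the factor
    \<open>F\<^sup>2 L\<^sup>3\<close>. A bounded function rises above a level by at most \<open>2 M\<close>, so the slopes
    \<open>T\<close> that occur are of order \<open>M / R\<close> and lie in this range once \<open>R\<close> is small. Dividing the
    Caccioppoli inequality by the common value of \<open>G\<close> at \<open>T\<close> leaves an estimate of the integral of
    \<open>|Dw|\<close> itself (\<open>gradient_L1_estimate\<close>), in which neither \<open>G\<close> nor \<open>M\<close> nor
    \<open>\<gamma>1\<close> occurs any more. In it the part of the gradient above the slope \<open>a T\<close> carries the
    factor \<open>a\<close> to the power \<open>1 - gm\<close>, which is small for large \<open>a\<close> because \<open>gm > 1\<close>.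

  The two ingredients together form the predicate \<open>level_decay\<close>, an inequality between measures of
  level sets. From it alone follow De Giorgi's two lemmas: a function that exceeds a high level only
  on a small part of a ball is below a slightly higher level on half the ball
  (\<open>level_decay_imp_bound\<close>), and a function that is below its mean level on half of a ball
  exceeds a sufficiently high level only on a small part of it (\<open>level_decay_imp_density\<close>). One of
  \<open>u\<close> and \<open>-u\<close> satisfies the hypothesis of the second lemma, so the oscillation of \<open>u\<close>
  shrinks by a fixed factor when the radius is divided by 16. The constants \<open>M\<close> and \<open>\<gamma>1\<close> only
  influence the oscillation and the radius with which this starts; so they affect the Hoelder constant
  and not the exponent.
\<close>

section \<open>Growth of N-functions\<close>

text \<open>Adding \<open>e * (t - a)\<close> makes the right derivative positive, and then the last point at which the
  perturbed function is at least its initial value cannot lie before \<open>b\<close>. One-sided derivatives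
  matter here: \<open>G x\<close> is only known to have \<open>g x\<close> as its right derivative.\<close>

lemma right_derivative_nonneg_imp_le:
  fixes f :: "real \<Rightarrow> real"
  assumes "a \<le> b" and cont: "continuous_on {a..b} f"
    and der: "\<And>t. a \<le> t \<Longrightarrow> t < b \<Longrightarrow> (f has_real_derivative D t) (at_right t)"
    and nonneg: "\<And>t. a \<le> t \<Longrightarrow> t < b \<Longrightarrow> 0 \<le> D t"
  shows "f a \<le> f b"
proof (cases "a = b")
  case False
  have main: "f a \<le> f b + e * (b - a)" if "e > 0" for e
  proof (rule ccontr)
    define h where "h = (\<lambda>t. f t + e * (t - a))"
    define S where "S = {t \<in> {a..b}. h a \<le> h t}"
    assume "\<not> ?thesis"
    hence hb: "h b < h a" by (simp add: h_def)
    have hcont: "continuous_on {a..b} h"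
      unfolding h_def by (intro continuous_intros cont)
    have "closed S"
    proof -
      have "S = {a..b} \<inter> h -` {h a..}" by (auto simp: S_def)
      thus ?thesis using continuous_closed_preimage[OF hcont closed_atLeastAtMost closed_atLeast] by simp
    qed
    moreover have "a \<in> S" using \<open>a \<le> b\<close> by (simp add: S_def)
    moreover have bdd: "bdd_above S" by (rule bdd_aboveI[of _ b]) (simp add: S_def)
    ultimately have c: "Sup S \<in> S" by (intro closed_contains_Sup) auto
    define c where "c = Sup S"
    have "a \<le> c" "c \<le> b" "h a \<le> h c" using c by (auto simp: S_def c_def)
    with hb have "c < b" by (cases "c = b") auto
    have "(h has_real_derivative D c + e * 1) (at_right c)"
      unfolding h_def by (auto intro!: derivative_eq_intros der \<open>a \<le> c\<close> \<open>c < b\<close>)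
    moreover have "D c + e * 1 > 0" using nonneg[of c] \<open>a \<le> c\<close> \<open>c < b\<close> that by simp
    ultimately obtain d where d: "d > 0" "\<And>s. s > 0 \<Longrightarrow> c + s \<in> {c<..} \<Longrightarrow> s < d \<Longrightarrow> h c < h (c + s)"
      using has_real_derivative_pos_inc_right by blast
    define s where "s = min (d / 2) (b - c)"
    have s: "s > 0" "s < d" "c + s \<le> b" using d(1) \<open>c < b\<close> by (auto simp: s_def)
    hence "h c < h (c + s)" using d(2)[of s] by simp
    hence "c + s \<in> S" using \<open>h a \<le> h c\<close> \<open>a \<le> c\<close> s by (simp add: S_def)
    hence "c + s \<le> c" unfolding c_def using bdd by (rule cSup_upper)
    thus False using s by simp
  qed
  have "f a \<le> f b + e" if "e > 0" for e
  proof -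
    have "e / (b - a) > 0" using that False \<open>a \<le> b\<close> by simp
    from main[OF this] show ?thesis using False by simp
  qed
  thus ?thesis by (rule field_le_epsilon)
qed simp

text \<open>The quotient \<open>h / f\<close> increases where the logarithmic derivative of \<open>h\<close> dominates. All growth
  estimates for \<open>G\<close> are instances, since \<open>growth_ratio\<close> is \<open>t\<close> times the logarithmic
  derivative of \<open>G x\<close>.\<close>

lemma log_derivative_comparison:
  fixes f h :: "real \<Rightarrow> real"
  assumes "a \<le> b" and "continuous_on {a..b} f" "continuous_on {a..b} h"
    and pos: "\<And>t. a \<le> t \<Longrightarrow> t \<le> b \<Longrightarrow> 0 < f t" "\<And>t. a \<le> t \<Longrightarrow> t \<le> b \<Longrightarrow> 0 < h t"
    and f': "\<And>t. a \<le> t \<Longrightarrow> t < b \<Longrightarrow> (f has_real_derivative f' t) (at_right t)"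
    and h': "\<And>t. a \<le> t \<Longrightarrow> t < b \<Longrightarrow> (h has_real_derivative h' t) (at_right t)"
    and le: "\<And>t. a \<le> t \<Longrightarrow> t < b \<Longrightarrow> f' t / f t \<le> h' t / h t"
  shows "f b * h a \<le> f a * h b"
proof -
  have "ln (h a) - ln (f a) \<le> ln (h b) - ln (f b)"
  proof (rule right_derivative_nonneg_imp_le[where f = "\<lambda>t. ln (h t) - ln (f t)" and
        D = "\<lambda>t. h' t / h t - f' t / f t"])
    show "continuous_on {a..b} (\<lambda>t. ln (h t) - ln (f t))"
      using pos by (intro continuous_intros assms) (auto simp: less_le)
    fix t assume t: "a \<le> t" "t < b"
    show "((\<lambda>t. ln (h t) - ln (f t)) has_real_derivative h' t / h t - f' t / f t) (at_right t)"
      using t pos[of t] by (auto intro!: derivative_eq_intros f' h' simp: divide_simps)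
    show "0 \<le> h' t / h t - f' t / f t" using le[OF t] by simp
  qed fact
  hence "ln (f b * h a) \<le> ln (f a * h b)"
    using pos[of a] pos[of b] \<open>a \<le> b\<close> by (simp add: ln_mult)
  thus ?thesis using pos[of a] pos[of b] \<open>a \<le> b\<close> by (simp add: ln_le_cancel_iff)
qed

text \<open>What is known about \<open>\<Phi> = G x\<close> and \<open>\<phi> = g x\<close> at almost every single point \<open>x\<close>.\<close>

definition N_function_at :: "(real \<Rightarrow> real) \<Rightarrow> (real \<Rightarrow> real) \<Rightarrow> real \<Rightarrow> real \<Rightarrow> bool" where
  "N_function_at \<Phi> \<phi> gm gp \<longleftrightarrow> continuous_on UNIV \<Phi> \<and> strict_mono_on {0..} \<Phi> \<and> \<Phi> 0 = 0 \<and> (\<forall>t>0. \<Phi> t > 0) \<and>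
     (\<forall>t\<ge>0. (\<Phi> has_real_derivative \<phi> t) (at_right t)) \<and>
     (\<forall>t>0. gm \<le> t * \<phi> t / \<Phi> t \<and> t * \<phi> t / \<Phi> t \<le> gp)"

lemma N_function_at_mono: "N_function_at \<Phi> \<phi> gm gp \<Longrightarrow> 0 \<le> s \<Longrightarrow> s \<le> t \<Longrightarrow> \<Phi> s \<le> \<Phi> t"
  unfolding N_function_at_def by (cases "s = t") (auto dest: strict_mono_onD[of _ _ s t])

text \<open>The power \<open>t powr gm\<close> has logarithmic derivative \<open>gm / t\<close>, the lower bound for that of
  \<open>\<Phi>\<close>; the upper bound is treated in the same way.\<close>

lemma N_function_at_lower_growth:
  assumes "N_function_at \<Phi> \<phi> gm gp" and "0 < s" "s \<le> t"
  shows "(t / s) powr gm * \<Phi> s \<le> \<Phi> t"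
proof -
  have "t powr gm * \<Phi> s \<le> s powr gm * \<Phi> t"
  proof (rule log_derivative_comparison[where f' = "\<lambda>t. gm * t powr (gm - 1)" and h' = \<phi>])
    show "continuous_on {s..t} \<Phi>"
      using assms unfolding N_function_at_def by (blast intro: continuous_on_subset)
    show "continuous_on {s..t} (\<lambda>t. t powr gm)" using assms by (intro continuous_intros) auto
    fix \<tau> assume \<tau>: "s \<le> \<tau>" "\<tau> < t"
    show "((\<lambda>t. t powr gm) has_real_derivative gm * \<tau> powr (gm - 1)) (at_right \<tau>)"
      using \<tau> assms by (auto intro!: derivative_eq_intros simp: powr_diff)
    have "gm * \<tau> powr (gm - 1) / \<tau> powr gm = gm / \<tau>" using \<tau> assms by (simp add: powr_diff)
    moreover have "gm \<le> \<tau> * \<phi> \<tau> / \<Phi> \<tau>" using assms \<tau> unfolding N_function_at_def by auto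
    ultimately show "gm * \<tau> powr (gm - 1) / \<tau> powr gm \<le> \<phi> \<tau> / \<Phi> \<tau>"
      using \<tau> assms(2) by (simp add: pos_divide_le_eq mult.commute)
  qed (use assms in \<open>auto simp: N_function_at_def\<close>)
  thus ?thesis using assms by (simp add: powr_divide field_simps)
qed

lemma N_function_at_upper_growth:
  assumes "N_function_at \<Phi> \<phi> gm gp" and "0 < s" "s \<le> t"
  shows "\<Phi> t \<le> (t / s) powr gp * \<Phi> s"
proof -
  have "\<Phi> t * s powr gp \<le> \<Phi> s * t powr gp"
  proof (rule log_derivative_comparison[where h' = "\<lambda>t. gp * t powr (gp - 1)" and f' = \<phi>])
    show "continuous_on {s..t} \<Phi>"
      using assms unfolding N_function_at_def by (blast intro: continuous_on_subset)
    show "continuous_on {s..t} (\<lambda>t. t powr gp)" using assms by (intro continuous_intros) auto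
    fix \<tau> assume \<tau>: "s \<le> \<tau>" "\<tau> < t"
    show "((\<lambda>t. t powr gp) has_real_derivative gp * \<tau> powr (gp - 1)) (at_right \<tau>)"
      using \<tau> assms by (auto intro!: derivative_eq_intros simp: powr_diff)
    have "gp * \<tau> powr (gp - 1) / \<tau> powr gp = gp / \<tau>" using \<tau> assms by (simp add: powr_diff)
    moreover have "\<tau> * \<phi> \<tau> / \<Phi> \<tau> \<le> gp" using assms \<tau> unfolding N_function_at_def by auto
    ultimately show "\<phi> \<tau> / \<Phi> \<tau> \<le> gp * \<tau> powr (gp - 1) / \<tau> powr gp"
      using \<tau> assms(2) by (simp add: pos_le_divide_eq mult.commute)
  qed (use assms in \<open>auto simp: N_function_at_def\<close>)
  thus ?thesis using assms by (simp add: powr_divide field_simps)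
qed

text \<open>The form in which log-Hoelder continuity enters: if the growth ratios of two N-functions differ by at
  most \<open>c\<close>, the functions themselves drift apart at most like \<open>t powr c\<close>. As nothing is known about the
  ratios at 1 itself, the comparison starts at \<open>s > 1\<close>, and \<open>s\<close> tends to 1.\<close>

lemma N_function_at_comparison:
  assumes 1: "N_function_at \<Phi> \<phi> gm gp" and 2: "N_function_at \<Psi> \<psi> gm gp"
    and le: "\<And>s. s > 1 \<Longrightarrow> s * \<phi> s / \<Phi> s - s * \<psi> s / \<Psi> s \<le> c" and "1 \<le> t"
  shows "\<Phi> t * \<Psi> 1 \<le> \<Phi> 1 * t powr c * \<Psi> t"
proof -
  have *: "\<Phi> t * (s powr c * \<Psi> s) \<le> \<Phi> s * (t powr c * \<Psi> t)" if "1 < s" "s \<le> t" for s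
  proof (rule log_derivative_comparison[where f' = \<phi> and
        h' = "\<lambda>t. c * t powr (c - 1) * \<Psi> t + t powr c * \<psi> t"])
    show "continuous_on {s..t} \<Phi>"
      using 1 unfolding N_function_at_def by (blast intro: continuous_on_subset)
    have "continuous_on {s..t} \<Psi>"
      using 2 unfolding N_function_at_def by (blast intro: continuous_on_subset)
    thus "continuous_on {s..t} (\<lambda>t. t powr c * \<Psi> t)"
      using that by (intro continuous_intros) auto
    fix \<tau> assume \<tau>: "s \<le> \<tau>" "\<tau> < t"
    have d: "(\<Psi> has_real_derivative \<psi> \<tau>) (at_right \<tau>)" and pos: "\<Psi> \<tau> > 0" "\<Phi> \<tau> > 0"
      using 1 2 \<tau> that unfolding N_function_at_def by auto
    show "((\<lambda>t. t powr c * \<Psi> t) has_real_derivative c * \<tau> powr (c - 1) * \<Psi> \<tau> + \<tau> powr c * \<psi> \<tau>)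
            (at_right \<tau>)"
      using \<tau> that by (auto intro!: derivative_eq_intros d simp: powr_diff)
    have "(c * \<tau> powr (c - 1) * \<Psi> \<tau> + \<tau> powr c * \<psi> \<tau>) / (\<tau> powr c * \<Psi> \<tau>) = c / \<tau> + \<psi> \<tau> / \<Psi> \<tau>"
      using \<tau> that pos by (simp add: powr_diff field_simps)
    moreover have "\<tau> * (\<phi> \<tau> / \<Phi> \<tau>) \<le> \<tau> * (c / \<tau> + \<psi> \<tau> / \<Psi> \<tau>)"
      using le[of \<tau>] \<tau> that by (simp add: algebra_simps)
    ultimately show "\<phi> \<tau> / \<Phi> \<tau> \<le> (c * \<tau> powr (c - 1) * \<Psi> \<tau> + \<tau> powr c * \<psi> \<tau>) / (\<tau> powr c * \<Psi> \<tau>)"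
      using mult_le_cancel_left_pos[of \<tau>] \<tau> that by (simp del: times_divide_eq_right)
  qed (use 1 2 that in \<open>auto simp: N_function_at_def\<close>)
  show ?thesis
  proof (cases "t = 1")
    case True thus ?thesis using 1 2 by (simp add: N_function_at_def)
  next
    case False
    hence "t > 1" using \<open>1 \<le> t\<close> by simp
    have cont: "continuous (at_right 1) \<Phi>" "continuous (at_right 1) \<Psi>"
      using 1 2 unfolding N_function_at_def
      by (auto simp: continuous_on_eq_continuous_at intro: continuous_at_imp_continuous_at_within)
    have "((\<lambda>s. \<Phi> t * (s powr c * \<Psi> s)) \<longlongrightarrow> \<Phi> t * (1 powr c * \<Psi> 1)) (at_right 1)"
      using cont by (intro tendsto_intros) (auto simp: continuous_within)
    moreover have "((\<lambda>s. \<Phi> s * (t powr c * \<Psi> t)) \<longlongrightarrow> \<Phi> 1 * (t powr c * \<Psi> t)) (at_right 1)"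
      using cont by (intro tendsto_intros) (auto simp: continuous_within)
    moreover have "\<forall>\<^sub>F s in at_right 1. \<Phi> t * (s powr c * \<Psi> s) \<le> \<Phi> s * (t powr c * \<Psi> t)"
      using eventually_at_right_less[of "1::real"] eventually_at_right[of 1 t "\<lambda>s. s < t"] \<open>t > 1\<close>
      by (auto elim!: eventually_mono[OF eventually_conj] intro!: * simp: eventually_at_right_field)
    ultimately have "\<Phi> t * (1 powr c * \<Psi> 1) \<le> \<Phi> 1 * (t powr c * \<Psi> t)"
      by (intro tendsto_le[rotated]) auto
    thus ?thesis by (simp add: mult_ac)
  qed
qed

section \<open>Smooth bump functions\<close>

text \<open>Test functions have continuous derivatives of all orders, so the closure properties of \<open>C_k\<close>
  needed to build one are proved by induction on the order.\<close>

lemma C_k_Suc_imp: "C_k (Suc k) f \<Longrightarrow> C_k k f"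
proof (induction k arbitrary: f)
  case 0
  thus ?case by (auto simp: continuous_on_eq_continuous_at intro: differentiable_imp_continuous_within)
next
  case (Suc k)
  from Suc.prems have d: "\<forall>x. f differentiable (at x)"
    and p: "\<forall>i\<in>Basis. C_k (Suc k) (\<lambda>x. frechet_derivative f (at x) i)"
    by (subst (asm) C_k.simps(2), blast)+
  have "\<forall>i\<in>Basis. C_k k (\<lambda>x. frechet_derivative f (at x) i)" using p Suc.IH by blast
  with d show ?case by simp
qed

lemma C_k_imp_continuous: "C_k k f \<Longrightarrow> continuous_on UNIV f"
  by (induction k) (auto dest: C_k_Suc_imp simp del: C_k.simps(2))

lemma frechet_derivative_eqI: "(f has_derivative f') (at x) \<Longrightarrow> frechet_derivative f (at x) = f'"
  by (metis frechet_derivative_at)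

lemma C_k_SucI:
  assumes "\<And>x. (f has_derivative f' x) (at x)" and "\<And>i. i \<in> Basis \<Longrightarrow> C_k k (\<lambda>x. f' x i)"
  shows "C_k (Suc k) f"
  using assms by (auto simp: frechet_derivative_eqI[OF assms(1)] differentiable_def)

lemma C_k_SucD:
  assumes "C_k (Suc k) f"
  shows "(f has_derivative frechet_derivative f (at x)) (at x)"
    and "i \<in> Basis \<Longrightarrow> C_k k (\<lambda>x. frechet_derivative f (at x) i)"
  using assms by (auto simp: frechet_derivative_works[symmetric])

lemma C_k_const: "C_k k (\<lambda>x. c)"
proof (induction k arbitrary: c)
  case (Suc k)
  show ?case by (rule C_k_SucI[where f' = "\<lambda>x h. 0"]) (auto intro: Suc)
qed simp

lemma C_k_add: "C_k k f \<Longrightarrow> C_k k g \<Longrightarrow> C_k k (\<lambda>x. f x + g x)"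
proof (induction k arbitrary: f g)
  case 0 thus ?case by (auto intro: continuous_intros)
next
  case (Suc k)
  note f = C_k_SucD[OF Suc.prems(1)] and g = C_k_SucD[OF Suc.prems(2)]
  show ?case
    by (rule C_k_SucI[OF has_derivative_add[OF f(1) g(1)]]) (intro Suc.IH f g)
qed

lemma C_k_mult: "C_k k f \<Longrightarrow> C_k k g \<Longrightarrow> C_k k (\<lambda>x. f x * g x)"
proof (induction k arbitrary: f g)
  case 0 thus ?case by (auto intro: continuous_intros)
next
  case (Suc k)
  note f = C_k_SucD[OF Suc.prems(1)] and g = C_k_SucD[OF Suc.prems(2)]
  show ?case
    by (rule C_k_SucI[OF has_derivative_mult[OF f(1) g(1)]])
       (intro C_k_add Suc.IH f g C_k_Suc_imp[OF Suc.prems(1)] C_k_Suc_imp[OF Suc.prems(2)])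
qed

lemma C_k_prod: "(\<And>i. i \<in> I \<Longrightarrow> C_k k (f i)) \<Longrightarrow> C_k k (\<lambda>x. \<Prod>i\<in>I. f i x)"
  by (induction I rule: infinite_finite_induct) (auto intro: C_k_const C_k_mult)

lemma C_k_translate: "C_k k f \<Longrightarrow> C_k k (\<lambda>x. f (x - h))"
proof (induction k arbitrary: f)
  case 0 
  thus ?case by (auto intro!: continuous_on_compose2[of UNIV f] continuous_intros)
next
  case (Suc k)
  note f = C_k_SucD[OF Suc.prems(1)]
  have "((\<lambda>x. f (x - h)) has_derivative frechet_derivative f (at (x - h))) (at x)" for x
    by (rule has_derivative_compose[of "\<lambda>x. x - h" "\<lambda>y. y", OF _ f(1)])
       (auto intro!: derivative_eq_intros)
  thus ?case by (rule C_k_SucI) (intro Suc.IH f)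
qed

text \<open>Here \<open>H\<close> lists a function of one variable and its successive derivatives. The statement about all
  \<open>H j\<close> at once is what makes the induction on the order go through.\<close>

lemma C_k_comp_affine:
  fixes H :: "nat \<Rightarrow> real \<Rightarrow> real" and b :: "'a::euclidean_space"
  assumes "\<And>j t. (H j has_real_derivative H (Suc j) t) (at t)"
  shows "C_k k (\<lambda>x::'a. H j (c * (x \<bullet> b) + d))"
proof (induction k arbitrary: j)
  case 0
  have "continuous_on UNIV (H j)"
    using assms by (meson DERIV_continuous_on has_field_derivative_at_within)
  thus ?case by (auto intro!: continuous_on_compose2[of UNIV "H j"] continuous_intros)
next
  case (Suc k)
  show ?case
  proof (rule C_k_SucI)
    fix x :: 'a
    have "(H j has_derivative (\<lambda>s. H (Suc j) (c * (x \<bullet> b) + d) * s)) (at (c * (x \<bullet> b) + d))"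
      using assms has_field_derivative_def by blast
    thus "((\<lambda>x. H j (c * (x \<bullet> b) + d)) has_derivative 
        (\<lambda>h. H (Suc j) (c * (x \<bullet> b) + d) * (c * (h \<bullet> b)))) (at x)"
      by (rule has_derivative_compose[rotated]) (auto intro!: derivative_eq_intros)
  next
    fix i :: 'a
    show "C_k k (\<lambda>x. H (Suc j) (c * (x \<bullet> b) + d) * (c * (i \<bullet> b)))"
      by (intro C_k_mult C_k_const Suc.IH)
  qed
qed

text \<open>The functions \<open>p(1/t) exp (-1/t)\<close>, extended by zero to \<open>t \<le> 0\<close>, are closed under
  differentiation; \<open>p = 1\<close> is the standard smooth function that is flat at 0.\<close>

definition flat_exp :: "real poly \<Rightarrow> real \<Rightarrow> real" where
  "flat_exp p t = (if t > 0 then poly p (1 / t) * exp (- (1 / t)) else 0)"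

lemma poly_times_exp_neg_tendsto_0: "((\<lambda>t. poly p t * exp (- t)) \<longlongrightarrow> (0::real)) at_top"
proof -
  have "((\<lambda>t. \<Sum>i\<le>degree p. coeff p i * (t ^ i / exp t)) \<longlongrightarrow> (\<Sum>i\<le>degree p. coeff p i * 0)) at_top"
    by (intro tendsto_intros tendsto_power_div_exp_0)
  moreover have "poly p t * exp (- t) = (\<Sum>i\<le>degree p. coeff p i * (t ^ i / exp t))" for t
    by (simp add: poly_altdef exp_minus divide_inverse sum_distrib_right sum_distrib_left mult_ac)
  ultimately show ?thesis by simp
qed

lemma has_real_derivative_flat_exp:
  "(flat_exp p has_real_derivative flat_exp ([:0, 0, 1:] * (p - pderiv p)) t) (at t)"
proof (cases t "0::real" rule: linorder_cases)
  case less
  have "((\<lambda>t. 0) has_real_derivative 0) (at t)" by simp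
  moreover have "\<forall>\<^sub>F s in nhds t. flat_exp p s = 0"
    using eventually_nhds_in_open[of "{..<0}" t] less
    by (auto elim!: eventually_mono simp: flat_exp_def)
  ultimately show ?thesis using less
    by (subst DERIV_cong_ev[OF refl _ refl, where g = "\<lambda>_. 0"]) (auto simp: flat_exp_def)
next
  case greater
  have "((\<lambda>t. poly p (1 / t) * exp (- (1 / t))) has_real_derivative 
      flat_exp ([:0, 0, 1:] * (p - pderiv p)) t) (at t)"
    using greater by (auto intro!: derivative_eq_intros poly_DERIV[THEN DERIV_chain2]
        simp: flat_exp_def field_simps power2_eq_square)
  moreover have "\<forall>\<^sub>F s in nhds t. flat_exp p s = poly p (1 / s) * exp (- (1 / s))"
    using eventually_nhds_in_open[of "{0<..}" t] greater
    by (auto elim!: eventually_mono simp: flat_exp_def)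
  ultimately show ?thesis by (subst DERIV_cong_ev[OF refl _ refl]) auto
next
  case equal
  have "((\<lambda>h. poly (pCons 0 p) (inverse h) * exp (- inverse h)) \<longlongrightarrow> 0) (at_right 0)"
    by (rule filterlim_compose[OF poly_times_exp_neg_tendsto_0 filterlim_inverse_at_top_right])
  moreover have "\<forall>\<^sub>F h in at_right 0. poly (pCons 0 p) (inverse h) * exp (- inverse h) = 
      (flat_exp p (0 + h) - flat_exp p 0) / h"
    using eventually_at_right_less[of "0::real"]
    by eventually_elim (simp add: flat_exp_def divide_inverse)
  ultimately have r: "((\<lambda>h. (flat_exp p (0 + h) - flat_exp p 0) / h) \<longlongrightarrow> 0) (at_right 0)"
    by (rule Lim_transform_eventually)
  have "\<forall>\<^sub>F h in at_left 0. 0 = (flat_exp p (0 + h) - flat_exp p 0) / h"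
    by (auto simp: eventually_at_filter flat_exp_def)
  hence l: "((\<lambda>h. (flat_exp p (0 + h) - flat_exp p 0) / h) \<longlongrightarrow> 0) (at_left 0)"
    by (rule Lim_transform_eventually[OF tendsto_const])
  show ?thesis using filterlim_split_at[OF l r] equal 
    by (simp add: DERIV_def) (simp add: flat_exp_def)
qed

text \<open>As \<open>exp (-1/(j t))\<close> tends to 1 for every \<open>t > 0\<close>, these
  bumps, which vanish outside the box, converge to its indicator function.\<close>

definition box_bump :: "'a::euclidean_space \<Rightarrow> 'a \<Rightarrow> nat \<Rightarrow> 'a \<Rightarrow> real" where
  "box_bump a b j x = (\<Prod>i\<in>Basis. flat_exp 1 (j * (x \<bullet> i - a \<bullet> i)) * flat_exp 1 (j * (b \<bullet> i - x \<bullet> i)))"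

lemma flat_exp_1_bounds: "0 \<le> flat_exp 1 t" "flat_exp 1 t \<le> 1"
  by (auto simp: flat_exp_def)

lemma C_k_box_bump: "C_k k (box_bump a b j)"
proof -
  define P where "P = (\<lambda>j. ((\<lambda>p. [:0, 0, 1:] * (p - pderiv p)) ^^ j) (1::real poly))"
  have 1: "C_k k (\<lambda>x. flat_exp (P 0) (c * (x \<bullet> i) + d))" for c d and i :: 'a
    by (rule C_k_comp_affine[where H = "\<lambda>j. flat_exp (P j)"])
       (use has_real_derivative_flat_exp in \<open>simp add: P_def\<close>)
  have "C_k k (\<lambda>x. flat_exp 1 (j * (x \<bullet> i - a \<bullet> i)))" for i
    using 1[of j i "- (j * (a \<bullet> i))"] by (simp add: P_def algebra_simps)
  moreover have "C_k k (\<lambda>x. flat_exp 1 (j * (b \<bullet> i - x \<bullet> i)))" for i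
    using 1[of "- real j" i "j * (b \<bullet> i)"] by (simp add: P_def algebra_simps)
  ultimately show ?thesis
    unfolding box_bump_def[abs_def] by (intro C_k_prod C_k_mult)
qed

lemma box_bump_eq_0:
  assumes "x \<notin> box a b"
  shows "box_bump a b j x = 0"
proof -
  obtain i where "i \<in> Basis" "x \<bullet> i \<le> a \<bullet> i \<or> b \<bullet> i \<le> x \<bullet> i"
    using assms by (auto simp: mem_box not_less)
  thus ?thesis
    unfolding box_bump_def by (intro prod_zero bexI[of _ i]) (auto simp: flat_exp_def zero_less_mult_iff)
qed

lemma box_bump_bounds: "0 \<le> box_bump a b j x" "box_bump a b j x \<le> 1"
  unfolding box_bump_def 
  by (intro prod_nonneg ballI mult_nonneg_nonneg flat_exp_1_bounds,
      intro prod_le_1 conjI mult_nonneg_nonneg mult_le_one flat_exp_1_bounds)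

lemma box_bump_tendsto: "(\<lambda>j. box_bump a b j x) \<longlonglongrightarrow> indicator (box a b) x"
proof (cases "x \<in> box a b")
  case True
  have *: "(\<lambda>j. flat_exp 1 (real j * t)) \<longlonglongrightarrow> 1" if "t > 0" for t
  proof -
    have "(\<lambda>j. exp (- (inverse (real j) * (1 / t)))) \<longlonglongrightarrow> exp (- (0 * (1 / t)))"
      by (intro tendsto_intros lim_inverse_n)
    moreover have "\<forall>\<^sub>F j in sequentially. exp (- (inverse (real j) * (1 / t))) = flat_exp 1 (real j * t)"
      using eventually_gt_at_top[of 0]
      by eventually_elim (use that in \<open>simp add: flat_exp_def divide_inverse\<close>)
    ultimately show ?thesis using Lim_transform_eventually by force
  qed
  have "(\<lambda>j. box_bump a b j x) \<longlonglongrightarrow> (\<Prod>i\<in>(Basis::'a set). 1 * 1)"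
    unfolding box_bump_def using True by (intro tendsto_intros *) (auto simp: mem_box)
  thus ?thesis using True by simp
qed (simp add: box_bump_eq_0)

lemma box_bump_test_function:
  assumes "cbox a b \<subseteq> \<Omega>"
  shows "box_bump a b j \<in> test_functions \<Omega>"
proof -
  have "closure {x. box_bump a b j x \<noteq> 0} \<subseteq> cbox a b"
    using box_bump_eq_0[of _ a b j] box_subset_cbox[of a b]
    by (intro closure_minimal closed_cbox) auto
  moreover from this have "compact (closure {x. box_bump a b j x \<noteq> 0})"
    by (meson bounded_cbox bounded_subset closed_closure compact_eq_bounded_closed)
  ultimately show ?thesis using assms by (auto simp: test_functions_def C_k_box_bump)
qed

lemma test_functions_mono: "S \<subseteq> T \<Longrightarrow> \<psi> \<in> test_functions S \<Longrightarrow> \<psi> \<in> test_functions T"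
  by (auto simp: test_functions_def)

lemma test_function_translate:
  assumes "\<psi> \<in> test_functions S" and "(\<lambda>x. x + h) ` S \<subseteq> T"
  shows "(\<lambda>x. \<psi> (x - h)) \<in> test_functions T"
proof -
  have "{x. \<psi> (x - h) \<noteq> 0} = (+) h ` {x. \<psi> x \<noteq> 0}"
    by (auto simp: image_iff intro!: exI[of _ "_ - h"])
  hence "closure {x. \<psi> (x - h) \<noteq> 0} = (+) h ` closure {x. \<psi> x \<noteq> 0}"
    by (simp add: closure_translation)
  moreover have "(+) h ` closure {x. \<psi> x \<noteq> 0} \<subseteq> T"
    using assms by (auto simp: test_functions_def add.commute)
  ultimately show ?thesis
    using assms(1) compact_translation[of "closure {x. \<psi> x \<noteq> 0}" h]
    by (simp add: test_functions_def C_k_translate del: compact_closure)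
qed

lemma test_function_has_derivative:
  assumes "\<psi> \<in> test_functions S"
  shows "(\<psi> has_derivative frechet_derivative \<psi> (at x)) (at x)"
  using assms C_k_SucD(1)[of 0 \<psi>] by (simp add: test_functions_def del: C_k.simps)

lemma test_function_continuous: "\<psi> \<in> test_functions S \<Longrightarrow> continuous_on UNIV \<psi>"
  using C_k_imp_continuous by (auto simp: test_functions_def)

lemma test_function_eq_0: "\<psi> \<in> test_functions S \<Longrightarrow> x \<notin> S \<Longrightarrow> \<psi> x = 0"
  using closure_subset[of "{x. \<psi> x \<noteq> 0}"] by (auto simp: test_functions_def)

lemma test_function_frechet_eq_sum:
  assumes "\<psi> \<in> test_functions S"
  shows "frechet_derivative \<psi> (at x) h = (\<Sum>i\<in>Basis. (h \<bullet> i) * frechet_derivative \<psi> (at x) i)"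
proof -
  interpret linear "frechet_derivative \<psi> (at x)"
    using test_function_has_derivative[OF assms] has_derivative_linear by blast
  have "frechet_derivative \<psi> (at x) (\<Sum>i\<in>Basis. (h \<bullet> i) *\<^sub>R i) = (\<Sum>i\<in>Basis. (h \<bullet> i) * frechet_derivative \<psi> (at x) i)"
    unfolding sum scale by simp
  thus ?thesis by (simp add: euclidean_representation)
qed

lemma test_function_frechet_continuous:
  assumes "\<psi> \<in> test_functions S"
  shows "continuous_on UNIV (\<lambda>x. frechet_derivative \<psi> (at x) h)"
  unfolding test_function_frechet_eq_sum[OF assms, of _ h]
proof (intro continuous_intros)
  fix i :: 'a assume "i \<in> Basis"
  thus "continuous_on UNIV (\<lambda>x. frechet_derivative \<psi> (at x) i)"
    using assms C_k_SucD(2)[of 0 \<psi> i] by (auto simp: test_functions_def)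
qed

lemma test_function_frechet_eq_0:
  assumes "\<psi> \<in> test_functions S" "x \<notin> S"
  shows "frechet_derivative \<psi> (at x) h = 0"
proof -
  let ?K = "closure {x. \<psi> x \<noteq> 0}"
  have "open (- ?K)" "x \<in> - ?K" using assms by (auto simp: test_functions_def)
  hence "(\<psi> has_derivative (\<lambda>_. 0)) (at x)"
    using closure_subset[of "{x. \<psi> x \<noteq> 0}"]
    by (intro has_derivative_transform_within_open[OF has_derivative_const[of 0], where s = "- ?K"]) auto
  thus ?thesis by (simp add: frechet_derivative_eqI)
qed

lemma continuous_vanishing_bounded:
  fixes f :: "'a::euclidean_space \<Rightarrow> real"
  assumes "continuous_on UNIV f" "bounded S" "\<And>x. x \<notin> S \<Longrightarrow> f x = 0"
  shows "\<exists>B. \<forall>x. \<bar>f x\<bar> \<le> B"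
proof -
  have "compact (f ` closure S)" using assms
    by (intro compact_continuous_image) (auto intro: continuous_on_subset)
  then obtain B where B: "\<And>y. y \<in> f ` closure S \<Longrightarrow> norm y \<le> B"
    using compact_imp_bounded bounded_iff by metis
  have "\<bar>f x\<bar> \<le> max B 0" for x
    using B[of "f x"] assms(3)[of x] closure_subset[of S] by (cases "x \<in> S") auto
  thus ?thesis by blast
qed

section \<open>The fundamental lemma of the calculus of variations\<close>

text \<open>By Lindeloef's theorem countably many of the neighbourhoods suffice.\<close>

lemma AE_on_set_if_locally:
  fixes S :: "'a::second_countable_topology set"
  assumes "\<And>x. x \<in> S \<Longrightarrow> \<exists>U. open U \<and> x \<in> U \<and> (AE y in M. y \<in> U \<longrightarrow> P y)"
  shows "AE y in M. y \<in> S \<longrightarrow> P y"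
proof -
  define B where "B = {U. open U \<and> (AE y in M. y \<in> U \<longrightarrow> P y)}"
  have "\<And>X. X \<in> B \<Longrightarrow> open X" by (auto simp: B_def)
  then obtain B' where B': "B' \<subseteq> B" "countable B'" "\<Union>B' = \<Union>B" by (rule Lindelof)
  have "AE y in M. \<forall>U\<in>B'. y \<in> U \<longrightarrow> P y"
    using B' by (subst AE_ball_countable) (auto simp: B_def)
  moreover have "S \<subseteq> \<Union>B'" using assms unfolding B' by (force simp: B_def)
  ultimately show ?thesis by (auto elim!: eventually_mono)
qed

lemma integral_bump_limit:
  fixes f :: "'a::euclidean_space \<Rightarrow> real"
  assumes f: "integrable lborel f" and z: "\<And>j. (LINT x|lborel. f x * box_bump a b j x) = 0"
  shows "(LINT x|lborel. f x * indicator (box a b) x) = 0"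
proof -
  have [measurable]: "box_bump a b j \<in> borel_measurable borel" for j
    using C_k_imp_continuous[OF C_k_box_bump[of 0]] by (intro borel_measurable_continuous_onI)
  note [measurable] = borel_measurable_integrable[OF f]
  have "(\<lambda>j. LINT x|lborel. f x * box_bump a b j x) \<longlonglongrightarrow> (LINT x|lborel. f x * indicator (box a b) x)"
  proof (rule integral_dominated_convergence[where w = "\<lambda>x. \<bar>f x\<bar>"])
    show "AE x in lborel. (\<lambda>j. f x * box_bump a b j x) \<longlonglongrightarrow> f x * indicator (box a b) x"
      by (intro AE_I2 tendsto_intros box_bump_tendsto)
    show "AE x in lborel. norm (f x * box_bump a b j x) \<le> \<bar>f x\<bar>" for j
      using box_bump_bounds[of a b j] by (intro AE_I2) (simp add: abs_mult mult_left_le)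
  qed (use f in simp_all)
  thus ?thesis using z by (simp add: LIMSEQ_const_iff)
qed

text \<open>The positive and the negative part of \<open>f\<close> are densities of two measures that agree on boxes, hence
  everywhere.\<close>

lemma integral_zero_on_boxes_imp_AE_zero:
  fixes f :: "'a::euclidean_space \<Rightarrow> real"
  assumes f: "integrable lborel f" and z: "\<And>a b. (LINT x|lborel. f x * indicator (box a b) x) = 0"
  shows "AE x in lborel. f x = 0"
proof -
  note [measurable] = borel_measurable_integrable[OF f]
  define P where "P = density lborel (\<lambda>x. ennreal (f x))"
  define N where "N = density lborel (\<lambda>x. ennreal (- f x))"
  let ?E = "range (\<lambda>(a, b). box a b :: 'a set)"
  have eq: "emeasure P (box a b) = emeasure N (box a b)" 
    and fin: "emeasure P (box a b) \<noteq> \<infinity>" for a b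
  proof -
    have i: "integrable lborel (\<lambda>x. f x * indicator (box a b) x)"
      using integrable_mult_indicator[of "box a b" lborel f] f by (simp add: mult.commute)
    have *: "emeasure (density lborel (\<lambda>x. ennreal (g x))) (box a b) = 
        ennreal (LINT x|lborel. max 0 (g x * indicator (box a b) x))"
      if "integrable lborel (\<lambda>x. g x * indicator (box a b) x)" "g \<in> borel_measurable lborel" for g
    proof -
      note [measurable] = that(2)
      have "emeasure (density lborel (\<lambda>x. ennreal (g x))) (box a b) = 
          (\<integral>\<^sup>+x. ennreal (max 0 (g x * indicator (box a b) x)) \<partial>lborel)"
        by (subst emeasure_density)
           (auto intro!: nn_integral_cong split: split_indicator simp: max_def ennreal_neg)
      also have "\<dots> = ennreal (LINT x|lborel. max 0 (g x * indicator (box a b) x))"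
        using that by (intro nn_integral_eq_integral integrable_max) auto
      finally show ?thesis .
    qed
    have "max 0 y - max 0 (- y) = y" for y :: real by (simp add: max_def)
    hence "0 = (LINT x|lborel. max 0 (f x * indicator (box a b) x) - max 0 (- f x * indicator (box a b) x))"
      using z[of a b] by simp
    also have "(LINT x|lborel. max 0 (f x * indicator (box a b) x) - max 0 (- f x * indicator (box a b) x)) =
        (LINT x|lborel. max 0 (f x * indicator (box a b) x)) - 
        (LINT x|lborel. max 0 (- f x * indicator (box a b) x))"
      using i by (intro Bochner_Integration.integral_diff integrable_max) auto
    finally show "emeasure P (box a b) = emeasure N (box a b)"
      unfolding P_def N_def using i by (subst (1 2) *) auto
    show "emeasure P (box a b) \<noteq> \<infinity>" unfolding P_def using i by (subst *) auto
  qed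
  have "P = N"
  proof (rule measure_eqI_generator_eq)
    show "Int_stable ?E" by (auto simp: Int_stable_def box_Int_box)
    show "?E \<subseteq> Pow UNIV" "sets P = sigma_sets UNIV ?E" "sets N = sigma_sets UNIV ?E"
      by (simp_all add: P_def N_def borel_eq_box)
    let ?A = "\<lambda>n::nat. box (- (real n *\<^sub>R One)) (real n *\<^sub>R One) :: 'a set"
    show "range ?A \<subseteq> ?E" "(\<Union>i. ?A i) = UNIV"
      unfolding UN_box_eq_UNIV by auto
  qed (use eq fin in auto)
  moreover have "(\<integral>\<^sup>+x. ennreal (f x) \<partial>lborel) \<noteq> \<infinity>"
    using f by (metis infinity_ennreal_def integrableD(2) real_integrable_def)
  ultimately have "AE x in lborel. ennreal (f x) = ennreal (- f x)"
    unfolding P_def N_def by (subst (asm) finite_density_unique) auto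
  thus ?thesis
    by eventually_elim (metis add.inverse_inverse ennreal_eq_0_iff ennreal_neg linorder_le_cases
        neg_le_0_iff_le order_antisym)
qed

text \<open>Bumps that approximate the indicator of a box reduce the claim to integrals over boxes. A box with closure
  in \<open>S\<close> is fixed first and \<open>f\<close> is cut off outside it, so that every box is admissible.\<close>

lemma test_functions_zero_imp_AE_zero:
  fixes f :: "'a::euclidean_space \<Rightarrow> real"
  assumes f: "integrable lborel f" and S: "open S"
    and z: "\<And>\<psi>. \<psi> \<in> test_functions S \<Longrightarrow> (LINT x|lborel. f x * \<psi> x) = 0"
  shows "AE x in lborel. x \<in> S \<longrightarrow> f x = 0"
proof -
  have *: "AE x in lborel. x \<in> box c d \<longrightarrow> f x = 0" if cd: "cbox c d \<subseteq> S" for c d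
  proof -
    have "AE x in lborel. f x * indicator (box c d) x = 0"
    proof (rule integral_zero_on_boxes_imp_AE_zero)
      show "integrable lborel (\<lambda>x. f x * indicator (box c d) x)"
        using integrable_mult_indicator[of "box c d" lborel f] f by (simp add: mult.commute)
      fix a b :: 'a
      (* The corners of the intersection of the two boxes. *)
      define a' where "a' = (\<Sum>i\<in>Basis. max (c \<bullet> i) (a \<bullet> i) *\<^sub>R i)"
      define b' where "b' = (\<Sum>i\<in>Basis. min (d \<bullet> i) (b \<bullet> i) *\<^sub>R i)"
      have "cbox a' b' \<subseteq> cbox c d" by (auto simp: a'_def b'_def mem_box)
      hence "(LINT x|lborel. f x * indicator (box a' b') x) = 0"
        using cd by (intro integral_bump_limit f z box_bump_test_function) auto
      moreover have "box c d \<inter> box a b = box a' b'" by (simp add: box_Int_box a'_def b'_def)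
      ultimately show "(LINT x|lborel. f x * indicator (box c d) x * indicator (box a b) x) = 0"
        by (simp add: mult.assoc flip: indicator_inter_arith)
    qed
    thus ?thesis by eventually_elim (auto simp: indicator_def)
  qed
  show ?thesis
  proof (rule AE_on_set_if_locally)
    fix x assume "x \<in> S"
    then obtain a b where "cbox a b \<subseteq> S" "x \<in> box a b"
      using open_contains_cbox[of S x] S by metis
    thus "\<exists>U. open U \<and> x \<in> U \<and> (AE y in lborel. y \<in> U \<longrightarrow> f y = 0)"
      using * by (intro exI[of _ "box a b"]) auto
  qed
qed

section \<open>Weakly differentiable functions on segments\<close>

lemma lborel_integrable_translate:
  fixes f :: "'a::euclidean_space \<Rightarrow> 'b::{banach, second_countable_topology}"
  shows "integrable lborel f \<Longrightarrow> integrable lborel (\<lambda>x. f (x + h))"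
  using integrable_distr_eq[of "(+) h" lborel borel f] lborel_distr_plus[of h]
  by (simp add: add.commute borel_measurable_integrable)

lemma lborel_integral_translate:
  fixes f :: "'a::euclidean_space \<Rightarrow> 'b::{banach, second_countable_topology}"
  assumes "f \<in> borel_measurable borel"
  shows "(LINT x|lborel. f (x + h)) = (LINT x|lborel. f x)"
  using integral_distr[of "(+) h" lborel borel f] lborel_distr_plus[of h] assms
  by (simp add: add.commute)

lemma lborel_nn_integral_translate:
  fixes f :: "'a::euclidean_space \<Rightarrow> ennreal"
  assumes "f \<in> borel_measurable borel"
  shows "(\<integral>\<^sup>+x. f (x + h) \<partial>lborel) = (\<integral>\<^sup>+x. f x \<partial>lborel)"
  using nn_integral_distr[of "(+) h" lborel borel f] lborel_distr_plus[of h] assms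
  by (simp add: add.commute)

lemma integrable_mult_bounded:
  fixes f g :: "'a \<Rightarrow> real"
  assumes "integrable M f" "g \<in> borel_measurable M" "\<And>x. \<bar>g x\<bar> \<le> C"
  shows "integrable M (\<lambda>x. f x * g x)"
proof (rule Bochner_Integration.integrable_bound[where f = "\<lambda>x. C * f x"])
  show "AE x in M. norm (f x * g x) \<le> norm (C * f x)"
  proof (intro AE_I2)
    fix x show "norm (f x * g x) \<le> norm (C * f x)"
      using assms(3)[of x] mult_right_mono[of "\<bar>g x\<bar>" "\<bar>C\<bar>" "\<bar>f x\<bar>"]
      by (simp add: abs_mult mult.commute)
  qed
qed (use assms in auto)

lemma integrable_along_segments:
  fixes f :: "'a::euclidean_space \<Rightarrow> real"
  assumes f: "integrable lborel f"
  shows "integrable (lborel \<Otimes>\<^sub>M lborel) (\<lambda>(x, t). indicator {0..s} t * f (x + t *\<^sub>R h))"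
proof -
  note [measurable] = borel_measurable_integrable[OF f]
  have "integrable (lborel \<Otimes>\<^sub>M lborel) (\<lambda>(t, x). indicator {0..s} t * f (x + t *\<^sub>R h))"
  proof (rule lborel_pair.Fubini_integrable)
    have "(LINT x|lborel. norm (case (t, x) of (t, x) \<Rightarrow> indicator {0..s} t * f (x + t *\<^sub>R h))) =
        indicator {0..s} t * (LINT x|lborel. \<bar>f x\<bar>)" for t
      using lborel_integral_translate[of "\<lambda>x. \<bar>f x\<bar>" "t *\<^sub>R h"] by (simp add: abs_mult)
    moreover have "integrable lborel (\<lambda>t. indicator {0..s} t * (LINT x|lborel. \<bar>f x\<bar>))"
      by (intro integrable_mult_left integrable_real_indicator) (auto simp: emeasure_lborel_Icc_eq)
    ultimately show "integrable lborel (\<lambda>t. LINT x|lborel. 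
        norm (case (t, x) of (t, x) \<Rightarrow> indicator {0..s} t * f (x + t *\<^sub>R h)))" by simp
    show "AE t in lborel. integrable lborel (\<lambda>x. case (t, x) of (t, x) \<Rightarrow> indicator {0..s} t * f (x + t *\<^sub>R h))"
      using lborel_integrable_translate[OF f] by (intro AE_I2) simp
  qed measurable
  from lborel_pair.integrable_product_swap[OF this] show ?thesis by (simp add: case_prod_beta')
qed

text \<open>A weak gradient on \<open>B\<close> of a function that is integrable over the whole space. Integrability is with
  respect to \<open>lborel\<close> and makes \<open>w\<close> and \<open>V\<close> Borel measurable, so that
  \<open>w (x + t *\<^sub>R h)\<close> is jointly measurable in \<open>x\<close> and \<open>t\<close>. This fails for functions that are
  merely Lebesgue measurable, which are therefore replaced by Borel versions later.\<close>

definition integrable_weak_gradient ::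
    "'a::euclidean_space set \<Rightarrow> ('a \<Rightarrow> real) \<Rightarrow> ('a \<Rightarrow> 'a) \<Rightarrow> bool" where
  "integrable_weak_gradient B w V \<longleftrightarrow> integrable lborel w \<and> integrable lborel V \<and>
     (\<forall>\<psi>\<in>test_functions B. \<forall>i\<in>Basis.
        (LINT x|lborel. w x * frechet_derivative \<psi> (at x) i) = - (LINT x|lborel. (V x \<bullet> i) * \<psi> x))"

lemma test_function_bounded:
  assumes "\<psi> \<in> test_functions B" "bounded B"
  obtains C where "\<And>x. \<bar>\<psi> x\<bar> \<le> C"
  using continuous_vanishing_bounded[OF test_function_continuous[OF assms(1)] assms(2) 
      test_function_eq_0[OF assms(1)]] by blast

lemma test_function_frechet_bounded:
  assumes "\<psi> \<in> test_functions B" "bounded B"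
  obtains C where "\<And>x. \<bar>frechet_derivative \<psi> (at x) h\<bar> \<le> C"
  using continuous_vanishing_bounded[OF test_function_frechet_continuous[OF assms(1)] assms(2) 
      test_function_frechet_eq_0[OF assms(1)]] by blast

lemma integrable_weak_gradient_directional:
  assumes wV: "integrable_weak_gradient B w V" and B: "bounded B" and \<psi>: "\<psi> \<in> test_functions B"
  shows "(LINT x|lborel. w x * frechet_derivative \<psi> (at x) h) = - (LINT x|lborel. (V x \<bullet> h) * \<psi> x)"
proof -
  have w: "integrable lborel w" and V: "integrable lborel V" 
    using wV by (auto simp: integrable_weak_gradient_def)
  obtain C where C: "\<And>x. \<bar>\<psi> x\<bar> \<le> C" using test_function_bounded[OF \<psi> B] by blast
  have 1: "integrable lborel (\<lambda>x. w x * frechet_derivative \<psi> (at x) i)" for i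
  proof -
    obtain D where "\<And>x. \<bar>frechet_derivative \<psi> (at x) i\<bar> \<le> D"
      using test_function_frechet_bounded[OF \<psi> B, of i] by blast
    thus ?thesis
      using borel_measurable_continuous_onI[OF test_function_frechet_continuous[OF \<psi>]]
      by (intro integrable_mult_bounded[OF w]) auto
  qed
  have 2: "integrable lborel (\<lambda>x. (V x \<bullet> i) * \<psi> x)" for i
    using C by (intro integrable_mult_bounded[OF integrable_inner_left] V)
       (use borel_measurable_continuous_onI[OF test_function_continuous[OF \<psi>]] in auto)
  have "(LINT x|lborel. w x * frechet_derivative \<psi> (at x) h) =
     (LINT x|lborel. (\<Sum>i\<in>Basis. (h \<bullet> i) * (w x * frechet_derivative \<psi> (at x) i)))"
    by (subst test_function_frechet_eq_sum[OF \<psi>]) (simp add: sum_distrib_left mult_ac)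
  also have "\<dots> = (\<Sum>i\<in>Basis. (h \<bullet> i) * (LINT x|lborel. w x * frechet_derivative \<psi> (at x) i))"
    using 1 by (subst Bochner_Integration.integral_sum) auto
  also have "\<dots> = - (\<Sum>i\<in>Basis. (h \<bullet> i) * (LINT x|lborel. (V x \<bullet> i) * \<psi> x))"
    using wV \<psi> by (simp add: integrable_weak_gradient_def sum_negf)
  also have "(\<Sum>i\<in>Basis. (h \<bullet> i) * (LINT x|lborel. (V x \<bullet> i) * \<psi> x)) =
      (LINT x|lborel. (\<Sum>i\<in>Basis. (h \<bullet> i) * ((V x \<bullet> i) * \<psi> x)))"
    using 2 by (subst Bochner_Integration.integral_sum) auto
  also have "\<dots> = (LINT x|lborel. (V x \<bullet> h) * \<psi> x)"
    by (subst (3) euclidean_inner) (simp add: sum_distrib_right sum_distrib_left mult_ac)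
  finally show ?thesis .
qed

text \<open>Fundamental theorem of calculus for weakly differentiable functions. Tested against \<open>\<psi>\<close>, the
  translation in the increment of \<open>w\<close> moves over to \<open>\<psi>\<close>, where the classical theorem applies; the weak
  identity moves the derivative back, and the fundamental lemma removes \<open>\<psi>\<close>.\<close>

lemma weak_gradient_difference:
  fixes w :: "'a::euclidean_space \<Rightarrow> real"
  assumes wV: "integrable_weak_gradient B w V" and B: "bounded B" and S: "open S" "S \<subseteq> B" and "0 \<le> s"
    and sub: "\<And>t. 0 \<le> t \<Longrightarrow> t \<le> s \<Longrightarrow> (\<lambda>x. x + t *\<^sub>R h) ` S \<subseteq> B"
  shows "AE x in lborel. x \<in> S \<longrightarrow>
    w (x + s *\<^sub>R h) = w x + (LINT t|lborel. indicator {0..s} t * (V (x + t *\<^sub>R h) \<bullet> h))"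
proof -
  have w: "integrable lborel w" and V: "integrable lborel V" 
    using wV by (auto simp: integrable_weak_gradient_def)
  have Vh: "integrable lborel (\<lambda>x. V x \<bullet> h)" using V by (rule integrable_inner_left)
  note [measurable] = borel_measurable_integrable[OF w] borel_measurable_integrable[OF V]
  define I where "I = (\<lambda>x. LINT t|lborel. indicator {0..s} t * (V (x + t *\<^sub>R h) \<bullet> h))"
  have I: "integrable lborel I"
    using lborel_pair.integrable_fst'[OF integrable_along_segments[OF Vh, of s h]] by (simp add: I_def)
  note [measurable] = borel_measurable_integrable[OF I]
  note w_sh = lborel_integrable_translate[OF w, of "s *\<^sub>R h"]
  have "AE x in lborel. x \<in> S \<longrightarrow> w (x + s *\<^sub>R h) - w x - I x = 0"
  proof (rule test_functions_zero_imp_AE_zero[OF _ S(1)])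
    show "integrable lborel (\<lambda>x. w (x + s *\<^sub>R h) - w x - I x)"
      using w_sh w I by auto
    fix \<psi> assume \<psi>: "\<psi> \<in> test_functions S"
    have bS: "bounded S" using B S(2) bounded_subset by blast
    define d where "d = (\<lambda>x. frechet_derivative \<psi> (at x) h)"
    obtain C where C: "\<And>x. \<bar>\<psi> x\<bar> \<le> C" using test_function_bounded[OF \<psi> bS] by blast
    obtain D where D: "\<And>x. \<bar>d x\<bar> \<le> D" 
      using test_function_frechet_bounded[OF \<psi> bS, of h] by (auto simp: d_def)
    have d_cont: "continuous_on UNIV d"
      using test_function_frechet_continuous[OF \<psi>] by (simp add: d_def)
    have [measurable]: "\<psi> \<in> borel_measurable borel" "d \<in> borel_measurable borel"
      using test_function_continuous[OF \<psi>] d_cont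
      by (auto intro: borel_measurable_continuous_onI)
    have ftc: "\<psi> (y - s *\<^sub>R h) - \<psi> y = - (LINT t|lborel. indicator {0..s} t * d (y - t *\<^sub>R h))" for y
    proof -
      have "(LINT t|lborel. indicator {0..s} t *\<^sub>R - d (y - t *\<^sub>R h)) = \<psi> (y - s *\<^sub>R h) - \<psi> (y - 0 *\<^sub>R h)"
      proof (rule integral_FTC_Icc[where F = "\<lambda>t. \<psi> (y - t *\<^sub>R h)"])
        fix t
        have "((\<lambda>t. \<psi> (y - t *\<^sub>R h)) has_derivative (\<lambda>u. frechet_derivative \<psi> (at (y - t *\<^sub>R h)) (- u *\<^sub>R h))) (at t)"
          by (rule has_derivative_compose[OF _ test_function_has_derivative[OF \<psi>]])
             (auto intro!: derivative_eq_intros)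
        moreover have "frechet_derivative \<psi> (at (y - t *\<^sub>R h)) (- u *\<^sub>R h) = u *\<^sub>R - d (y - t *\<^sub>R h)" for u
          using linear_scale[OF has_derivative_linear[OF test_function_has_derivative[OF \<psi>]], of _ "-u" h]
          by (simp add: d_def)
        ultimately show "((\<lambda>t. \<psi> (y - t *\<^sub>R h)) has_vector_derivative - d (y - t *\<^sub>R h)) (at t within {0..s})"
          unfolding has_vector_derivative_def by (simp add: has_derivative_at_withinI)
      next
        show "continuous_on {0..s} (\<lambda>t. - d (y - t *\<^sub>R h))"
          by (intro continuous_intros continuous_on_compose2[OF d_cont]) auto
      qed (fact \<open>0 \<le> s\<close>)
      thus ?thesis by simp
    qed
    (* The translation moves to psi, then the derivative moves to w. *)
    have "(LINT x|lborel. (w (x + s *\<^sub>R h) - w x) * \<psi> x) = 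
        (LINT x|lborel. w (x + s *\<^sub>R h) * \<psi> x) - (LINT x|lborel. w x * \<psi> x)"
      using integrable_mult_bounded[OF w_sh _ C] integrable_mult_bounded[OF w _ C]
      by (simp add: left_diff_distrib)
    also have "(LINT x|lborel. w (x + s *\<^sub>R h) * \<psi> x) = (LINT x|lborel. w x * \<psi> (x - s *\<^sub>R h))"
      using lborel_integral_translate[of "\<lambda>x. w x * \<psi> (x - s *\<^sub>R h)" "s *\<^sub>R h"] by simp
    also have "(LINT x|lborel. w x * \<psi> (x - s *\<^sub>R h)) - (LINT x|lborel. w x * \<psi> x) =
        (LINT x|lborel. w x * (\<psi> (x - s *\<^sub>R h) - \<psi> x))"
      using integrable_mult_bounded[OF w, of "\<lambda>x. \<psi> (x - s *\<^sub>R h)" C] 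
        integrable_mult_bounded[OF w _ C] C by (simp add: right_diff_distrib)
    also have "\<dots> = - (LINT x|lborel. (LINT t|lborel. indicator {0..s} t * w x * d (x - t *\<^sub>R h)))"
      by (simp add: ftc mult_ac)
    also have "(LINT x|lborel. (LINT t|lborel. indicator {0..s} t * w x * d (x - t *\<^sub>R h))) =
        (LINT t|lborel. (LINT x|lborel. indicator {0..s} t * w x * d (x - t *\<^sub>R h)))"
    proof (rule lborel_pair.Fubini_integral[symmetric])
      have "integrable (lborel \<Otimes>\<^sub>M lborel) (\<lambda>p. (case p of (x, t) \<Rightarrow> indicator {0..s} t * w (x + t *\<^sub>R 0)) * 
          d (fst p - snd p *\<^sub>R h))"
        using D by (intro integrable_mult_bounded[OF integrable_along_segments[OF w]]) measurable
      thus "integrable (lborel \<Otimes>\<^sub>M lborel) (\<lambda>(x, t). indicator {0..s} t * w x * d (x - t *\<^sub>R h))"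
        by (simp add: case_prod_beta')
    qed
    also have "\<dots> = (LINT t|lborel. - (LINT x|lborel. indicator {0..s} t * (V (x + t *\<^sub>R h) \<bullet> h) * \<psi> x))"
    proof (intro Bochner_Integration.integral_cong refl)
      fix t
      show "(LINT x|lborel. indicator {0..s} t * w x * d (x - t *\<^sub>R h)) = 
          - (LINT x|lborel. indicator {0..s} t * (V (x + t *\<^sub>R h) \<bullet> h) * \<psi> x)"
      proof (cases "t \<in> {0..s}")
        case True
        have "(\<lambda>x. \<psi> (x - t *\<^sub>R h)) \<in> test_functions B"
          using test_function_translate[OF \<psi> sub] True by auto
        moreover have "frechet_derivative (\<lambda>x. \<psi> (x - t *\<^sub>R h)) (at y) h = d (y - t *\<^sub>R h)" for y
        proof -
          have "((\<lambda>x. \<psi> (x - t *\<^sub>R h)) has_derivative frechet_derivative \<psi> (at (y - t *\<^sub>R h))) (at y)"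
            by (rule has_derivative_compose[of "\<lambda>x. x - t *\<^sub>R h" "\<lambda>y. y", OF _ test_function_has_derivative[OF \<psi>]])
               (auto intro!: derivative_eq_intros)
          thus ?thesis by (simp add: frechet_derivative_eqI d_def)
        qed
        ultimately have "(LINT x|lborel. w x * d (x - t *\<^sub>R h)) = 
            - (LINT x|lborel. (V x \<bullet> h) * \<psi> (x - t *\<^sub>R h))"
          using integrable_weak_gradient_directional[OF wV B, of "\<lambda>x. \<psi> (x - t *\<^sub>R h)" h] by simp
        also have "(LINT x|lborel. (V x \<bullet> h) * \<psi> (x - t *\<^sub>R h)) = (LINT x|lborel. (V (x + t *\<^sub>R h) \<bullet> h) * \<psi> x)"
          using lborel_integral_translate[of "\<lambda>x. (V x \<bullet> h) * \<psi> (x - t *\<^sub>R h)" "t *\<^sub>R h"] by simp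
        finally show ?thesis using True by simp
      qed simp
    qed
    also have "\<dots> = - (LINT t|lborel. (LINT x|lborel. indicator {0..s} t * (V (x + t *\<^sub>R h) \<bullet> h) * \<psi> x))"
      by simp
    also have "(LINT t|lborel. (LINT x|lborel. indicator {0..s} t * (V (x + t *\<^sub>R h) \<bullet> h) * \<psi> x)) =
        (LINT x|lborel. (LINT t|lborel. indicator {0..s} t * (V (x + t *\<^sub>R h) \<bullet> h) * \<psi> x))"
    proof (rule lborel_pair.Fubini_integral)
      have "integrable (lborel \<Otimes>\<^sub>M lborel) (\<lambda>p. (case p of (x, t) \<Rightarrow> indicator {0..s} t * (V (x + t *\<^sub>R h) \<bullet> h)) * 
          \<psi> (fst p))"
        using C by (intro integrable_mult_bounded[OF integrable_along_segments[OF Vh]]) measurable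
      thus "integrable (lborel \<Otimes>\<^sub>M lborel) (\<lambda>(x, t). indicator {0..s} t * (V (x + t *\<^sub>R h) \<bullet> h) * \<psi> x)"
        by (simp add: case_prod_beta')
    qed
    also have "\<dots> = (LINT x|lborel. I x * \<psi> x)" by (simp add: I_def)
    finally have "(LINT x|lborel. (w (x + s *\<^sub>R h) - w x) * \<psi> x) = (LINT x|lborel. I x * \<psi> x)" by simp
    moreover have "(LINT x|lborel. (w (x + s *\<^sub>R h) - w x - I x) * \<psi> x) = 
        (LINT x|lborel. (w (x + s *\<^sub>R h) - w x) * \<psi> x) - (LINT x|lborel. I x * \<psi> x)"
      unfolding left_diff_distrib[of "_ - _" "I _"]
      using w w_sh I C by (intro Bochner_Integration.integral_diff integrable_mult_bounded[where C = C]) auto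
    ultimately show "(LINT x|lborel. (w (x + s *\<^sub>R h) - w x - I x) * \<psi> x) = 0" by simp
  qed
  thus ?thesis by eventually_elim (auto simp: I_def)
qed

section \<open>A local isoperimetric inequality\<close>

text \<open>A primitive that goes from above \<open>l\<close> to below \<open>k\<close> crosses the strip between the levels on an
  interval: from the last time it is at least \<open>l\<close> to the first later time it is at most \<open>k\<close>.
  The drop from \<open>l\<close> to \<open>k\<close> is the integral of the derivative over this interval, so only
  points with values in the strip contribute.\<close>

lemma level_crossing:
  fixes p q :: "real \<Rightarrow> real"
  assumes q: "set_integrable lborel {0..1} q"
    and p: "\<And>s. 0 \<le> s \<Longrightarrow> s \<le> 1 \<Longrightarrow> p s = c + (LINT t|lborel. indicator {0..s} t * q t)"
    and "k < l" "l \<le> p 0" "p 1 \<le> k"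
  obtains a b where "0 \<le> a" "a \<le> b" "b \<le> 1" "\<And>t. a < t \<Longrightarrow> t < b \<Longrightarrow> k < p t \<and> p t < l"
    "l - k \<le> (LINT t|lborel. indicator {a..b} t * \<bar>q t\<bar>)"
proof -
  have qs: "set_integrable lborel {x..y} q" if "0 \<le> x" "y \<le> 1" for x y
    using q by (rule set_integrable_subset) (use that in auto)
  have pe: "p s = c + integral {0..s} q" if "0 \<le> s" "s \<le> 1" for s
    using p[OF that] set_borel_integral_eq_integral(2)[OF qs[of 0 s]] that
    by (simp add: set_lebesgue_integral_def)
  have "continuous_on {0..1} (\<lambda>s. c + integral {0..s} q)"
    using set_borel_integral_eq_integral(1)[OF q]
    by (intro continuous_intros indefinite_integral_continuous_1)
  hence cont: "continuous_on {0..1} p"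
    by (subst continuous_on_cong[OF refl pe]) auto
  define A where "A = {s \<in> {0..1}. l \<le> p s}"
  have "closed A"
  proof -
    have "A = {0..1} \<inter> p -` {l..}" by (auto simp: A_def)
    thus ?thesis using continuous_closed_preimage[OF cont closed_atLeastAtMost closed_atLeast] by simp
  qed
  moreover have "0 \<in> A" using \<open>l \<le> p 0\<close> by (simp add: A_def)
  moreover have bA: "bdd_above A" by (rule bdd_aboveI[of _ 1]) (simp add: A_def)
  ultimately have "Sup A \<in> A" by (intro closed_contains_Sup) auto
  define a where "a = Sup A"
  have a: "0 \<le> a" "a \<le> 1" "l \<le> p a" using \<open>Sup A \<in> A\<close> by (auto simp: A_def a_def)
  have a_max: "p s < l" if "a < s" "s \<le> 1" for s
    using cSup_upper[OF _ bA, of s] that a by (force simp: A_def a_def not_less)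
  define B where "B = {s \<in> {a..1}. p s \<le> k}"
  have cont': "continuous_on {a..1} p" using cont a by (rule_tac continuous_on_subset) auto
  have "closed B"
  proof -
    have "B = {a..1} \<inter> p -` {..k}" by (auto simp: B_def)
    thus ?thesis using continuous_closed_preimage[OF cont' closed_atLeastAtMost closed_atMost] by simp
  qed
  moreover have "1 \<in> B" using \<open>p 1 \<le> k\<close> a by (simp add: B_def)
  moreover have bB: "bdd_below B" by (rule bdd_belowI[of _ a]) (simp add: B_def)
  ultimately have "Inf B \<in> B" by (intro closed_contains_Inf) auto
  define b where "b = Inf B"
  have b: "a \<le> b" "b \<le> 1" "p b \<le> k" using \<open>Inf B \<in> B\<close> by (auto simp: B_def b_def)
  have b_min: "k < p s" if "a \<le> s" "s < b" for s
    using cInf_lower[OF _ bB, of s] that b by (force simp: B_def b_def not_less)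
  show ?thesis
  proof (rule that[of a b])
    have i: "q integrable_on {0..b}" using set_borel_integral_eq_integral(1)[OF qs[of 0 b]] b by simp
    have "l - k \<le> p a - p b" using a b by simp
    also have "\<dots> = - integral {a..b} q"
      using pe[of a] pe[of b] Henstock_Kurzweil_Integration.integral_combine[OF a(1) b(1) i] a b by simp
    also have "\<dots> = - (LINT t|lborel. indicator {a..b} t * q t)"
      using set_borel_integral_eq_integral(2)[OF qs[of a b]] a b by (simp add: set_lebesgue_integral_def)
    also have "\<dots> = (LINT t|lborel. - (indicator {a..b} t * q t))" by simp
    also have "\<dots> \<le> (LINT t|lborel. indicator {a..b} t * \<bar>q t\<bar>)"
      using qs[of a b] set_integrable_abs[OF qs[of a b]] a b
      by (intro integral_mono) (auto simp: set_integrable_def split: split_indicator)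
    finally show "l - k \<le> (LINT t|lborel. indicator {a..b} t * \<bar>q t\<bar>)" .
  qed (use a b a_max b_min in auto)
qed

text \<open>For almost every \<open>x\<close> the function \<open>w\<close> agrees at almost every point of the segment from \<open>x\<close> to
  \<open>x + h\<close> with a continuous primitive (by Fubini's theorem), and it also agrees at both end points.\<close>

lemma weak_gradient_crossing:
  fixes w :: "'a::euclidean_space \<Rightarrow> real"
  assumes wV: "integrable_weak_gradient B w V" and B: "bounded B" and S: "open S" "S \<subseteq> B" 
    and sub: "\<And>t. 0 \<le> t \<Longrightarrow> t \<le> 1 \<Longrightarrow> (\<lambda>x. x + t *\<^sub>R h) ` S \<subseteq> B" and "k < l"
  shows "AE x in lborel. x \<in> S \<and> l \<le> w x \<and> w (x + h) \<le> k \<longrightarrow>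
    ennreal (l - k) \<le> (\<integral>\<^sup>+t. indicator {0..1} t * 
       (indicator {y. k < w y \<and> w y < l} (x + t *\<^sub>R h) * ennreal (norm h * norm (V (x + t *\<^sub>R h)))) \<partial>lborel)"
proof -
  have w: "integrable lborel w" and V: "integrable lborel V" 
    using wV by (auto simp: integrable_weak_gradient_def)
  have Vh: "integrable lborel (\<lambda>x. V x \<bullet> h)" using V by (rule integrable_inner_left)
  note [measurable] = borel_measurable_integrable[OF w] borel_measurable_integrable[OF V]
  define I where "I = (\<lambda>s x. LINT t|lborel. indicator {0..s} t * (V (x + t *\<^sub>R h) \<bullet> h))"
  have I_alt: "I s x = (LINT t|lborel. (if 0 \<le> t \<and> t \<le> s then V (x + t *\<^sub>R h) \<bullet> h else 0))" for s x
    unfolding I_def by (intro Bochner_Integration.integral_cong) auto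
  have d: "AE x in lborel. x \<in> S \<longrightarrow> w (x + s *\<^sub>R h) = w x + I s x" if "0 \<le> s" "s \<le> 1" for s
    unfolding I_def using that sub by (intro weak_gradient_difference[OF wV B S]) auto
  have "AE s in lborel. AE x in lborel. 0 \<le> s \<and> s \<le> 1 \<longrightarrow> x \<in> S \<longrightarrow> w (x + s *\<^sub>R h) = w x + I s x"
  proof (rule AE_I2)
    fix s :: real
    show "AE x in lborel. 0 \<le> s \<and> s \<le> 1 \<longrightarrow> x \<in> S \<longrightarrow> w (x + s *\<^sub>R h) = w x + I s x"
      using d[of s] by (cases "0 \<le> s \<and> s \<le> 1") auto
  qed
  hence ae1: "AE x in lborel. AE s in lborel. 0 \<le> s \<and> s \<le> 1 \<longrightarrow> x \<in> S \<longrightarrow> w (x + s *\<^sub>R h) = w x + I s x"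
  proof (subst (asm) lborel_pair.AE_commute)
    have [measurable]: "S \<in> sets borel" using S by simp
    show "{p \<in> space (lborel \<Otimes>\<^sub>M lborel). 0 \<le> fst p \<and> fst p \<le> 1 \<longrightarrow> snd p \<in> S \<longrightarrow> 
        w (snd p + fst p *\<^sub>R h) = w (snd p) + I (fst p) (snd p)} \<in> sets (lborel \<Otimes>\<^sub>M lborel)"
      unfolding I_alt by measurable
  qed
  have ae2: "AE x in lborel. integrable lborel (\<lambda>t. indicator {0..1} t * (V (x + t *\<^sub>R h) \<bullet> h))"
    using lborel_pair.AE_integrable_fst'[OF integrable_along_segments[OF Vh, of 1 h]] by simp
  from ae1 ae2 d[of 1, simplified] show ?thesis
  proof eventually_elim
    case (elim x)
    show ?case
    proof safe
      assume x: "x \<in> S" "l \<le> w x" "w (x + h) \<le> k"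
      define q where "q = (\<lambda>t. V (x + t *\<^sub>R h) \<bullet> h)"
      define p where "p = (\<lambda>s. w x + I s x)"
      have q: "set_integrable lborel {0..1} q"
        using elim(2) by (simp add: set_integrable_def q_def)
      have "AE t in lborel. indicator {0..0} t * (V (x + t *\<^sub>R h) \<bullet> h) = 0"
        using AE_lborel_singleton[of "0::real"] by eventually_elim auto
      hence "I 0 x = 0"
        unfolding I_def by (rule integral_eq_zero_AE)
      hence "l \<le> p 0" "p 1 \<le> k" using x elim(3) by (simp_all add: p_def)
      then obtain a b where ab: "0 \<le> a" "a \<le> b" "b \<le> 1" 
          "\<And>t. a < t \<Longrightarrow> t < b \<Longrightarrow> k < p t \<and> p t < l"
          "l - k \<le> (LINT t|lborel. indicator {a..b} t * \<bar>q t\<bar>)"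
        using level_crossing[OF q, of p "w x" k l] \<open>k < l\<close> by (auto simp: p_def I_def q_def)
      have "integrable lborel (\<lambda>t. indicator {a..b} t * \<bar>q t\<bar>)"
        using set_integrable_abs[OF set_integrable_subset[OF q, of "{a..b}"]] ab
        by (simp add: set_integrable_def)
      hence "ennreal (LINT t|lborel. indicator {a..b} t * \<bar>q t\<bar>) = 
          (\<integral>\<^sup>+t. ennreal (indicator {a..b} t * \<bar>q t\<bar>) \<partial>lborel)"
        by (intro nn_integral_eq_integral[symmetric]) auto
      also have "\<dots> \<le> (\<integral>\<^sup>+t. indicator {0..1} t * 
       (indicator {y. k < w y \<and> w y < l} (x + t *\<^sub>R h) * ennreal (norm h * norm (V (x + t *\<^sub>R h)))) \<partial>lborel)"
      proof (rule nn_integral_mono_AE)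
        show "AE t in lborel. ennreal (indicator {a..b} t * \<bar>q t\<bar>) \<le> indicator {0..1} t * 
           (indicator {y. k < w y \<and> w y < l} (x + t *\<^sub>R h) * ennreal (norm h * norm (V (x + t *\<^sub>R h))))"
          using elim(1) AE_lborel_singleton[of a] AE_lborel_singleton[of b]
        proof eventually_elim
          case (elim t)
          show ?case
          proof (cases "a \<le> t \<and> t \<le> b")
            case True
            with elim ab x have "k < w (x + t *\<^sub>R h)" "w (x + t *\<^sub>R h) < l" "0 \<le> t" "t \<le> 1"
              using ab(4)[of t] by (auto simp: p_def)
            moreover have "\<bar>q t\<bar> \<le> norm h * norm (V (x + t *\<^sub>R h))"
              unfolding q_def using Cauchy_Schwarz_ineq2[of "V (x + t *\<^sub>R h)" h] by (simp add: mult.commute)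
            ultimately show ?thesis using True by (simp add: ennreal_leI)
          qed simp
        qed
      qed
      finally show "ennreal (l - k) \<le> (\<integral>\<^sup>+t. indicator {0..1} t * 
       (indicator {y. k < w y \<and> w y < l} (x + t *\<^sub>R h) * ennreal (norm h * norm (V (x + t *\<^sub>R h)))) \<partial>lborel)"
        using ennreal_leI[OF ab(5)] order_trans by blast
    qed
  qed
qed

text \<open>The crossing estimate is integrated over \<open>x\<close> in the ball \<open>ball z r\<close>, where a translation by
  \<open>t *\<^sub>R h\<close> does not lead out of \<open>ball z (r + \<eta>)\<close>, and then over \<open>h\<close> in \<open>ball 0 \<eta>\<close>. On the
  left the integral over \<open>h\<close> produces at least \<open>m\<close>, on the right the volume of \<open>ball 0 \<eta>\<close>.\<close>

lemma isoperimetric_borel: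
  fixes w :: "'a::euclidean_space \<Rightarrow> real"
  assumes wV: "integrable_weak_gradient (ball z (r + \<eta>)) w V" and "0 < r" "0 < \<eta>" "k < l"
    and m: "\<And>x. x \<in> ball z r \<Longrightarrow> m \<le> emeasure lborel {y \<in> ball x \<eta>. w y \<le> k}"
  shows "ennreal (l - k) * m * emeasure lborel {x \<in> ball z r. l \<le> w x} \<le>
    ennreal \<eta> * emeasure lborel (ball (0::'a) \<eta>) * 
    (\<integral>\<^sup>+x\<in>{x \<in> ball z (r + \<eta>). k < w x \<and> w x < l}. norm (V x) \<partial>lborel)"
proof -
  define B where "B = ball z (r + \<eta>)"
  define E where "E = {y. k < w y \<and> w y < l}"
  define \<Phi> where "\<Phi> = (\<lambda>y. indicator B y * (indicator E y * ennreal (\<eta> * norm (V y))))"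
  have w: "integrable lborel w" and V: "integrable lborel V" 
    using wV by (auto simp: integrable_weak_gradient_def)
  note [measurable] = borel_measurable_integrable[OF w] borel_measurable_integrable[OF V]
  have [measurable]: "E \<in> sets borel" unfolding E_def by measurable
  have [measurable]: "B \<in> sets borel" unfolding B_def by simp
  have [measurable]: "\<Phi> \<in> borel_measurable borel" unfolding \<Phi>_def by measurable
  have [measurable]: "ball (0::'a) \<eta> \<in> sets borel" "ball z r \<in> sets borel" by simp_all
  have \<Phi>_int: "(\<integral>\<^sup>+x. \<Phi> x \<partial>lborel) = ennreal \<eta> * 
     (\<integral>\<^sup>+x\<in>{x \<in> ball z (r + \<eta>). k < w x \<and> w x < l}. norm (V x) \<partial>lborel)"
    unfolding \<Phi>_def using \<open>0 < \<eta>\<close>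
    by (subst nn_integral_cmult[symmetric])
       (auto intro!: nn_integral_cong simp: B_def E_def ennreal_mult split: split_indicator)
  have one: "(\<integral>\<^sup>+x. ennreal (l - k) * indicator {x \<in> ball z r. l \<le> w x} x * indicator {x. w x \<le> k} (x + h) \<partial>lborel)
      \<le> (\<integral>\<^sup>+x. \<Phi> x \<partial>lborel)" if h: "norm h < \<eta>" for h
  proof -
    have in_B: "x + t *\<^sub>R h \<in> B" if "x \<in> ball z r" "0 \<le> t" "t \<le> 1" for x t
    proof -
      have "norm (t *\<^sub>R h) \<le> 1 * norm h" unfolding norm_scaleR using that by (intro mult_right_mono) auto
      hence "dist z (x + t *\<^sub>R h) < r + \<eta>"
        using that h norm_triangle_ineq4[of "z - x" "t *\<^sub>R h"] by (simp add: dist_norm diff_diff_eq)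
      thus ?thesis by (simp add: B_def)
    qed
    have "AE x in lborel. x \<in> ball z r \<and> l \<le> w x \<and> w (x + h) \<le> k \<longrightarrow>
      ennreal (l - k) \<le> (\<integral>\<^sup>+t. indicator {0..1} t * 
       (indicator {y. k < w y \<and> w y < l} (x + t *\<^sub>R h) * ennreal (norm h * norm (V (x + t *\<^sub>R h)))) \<partial>lborel)"
    proof (rule weak_gradient_crossing[of B])
      show "integrable_weak_gradient B w V" using wV by (simp add: B_def)
      show "ball z r \<subseteq> B" using \<open>0 < \<eta>\<close> by (auto simp: B_def)
      show "(\<lambda>x. x + t *\<^sub>R h) ` ball z r \<subseteq> B" if "0 \<le> t" "t \<le> 1" for t using in_B that by auto
    qed (use \<open>k < l\<close> in \<open>auto simp: B_def\<close>)
    hence "AE x in lborel. ennreal (l - k) * indicator {x \<in> ball z r. l \<le> w x} x * indicator {x. w x \<le> k} (x + h)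
        \<le> (\<integral>\<^sup>+t. indicator {0..1} t * \<Phi> (x + t *\<^sub>R h) \<partial>lborel)"
    proof eventually_elim
      case (elim x)
      show ?case
      proof (cases "x \<in> ball z r \<and> l \<le> w x \<and> w (x + h) \<le> k")
        case True
        with elim have "ennreal (l - k) \<le> (\<integral>\<^sup>+t. indicator {0..1} t * 
         (indicator {y. k < w y \<and> w y < l} (x + t *\<^sub>R h) * ennreal (norm h * norm (V (x + t *\<^sub>R h)))) \<partial>lborel)"
          by blast
        also have "\<dots> \<le> (\<integral>\<^sup>+t. indicator {0..1} t * \<Phi> (x + t *\<^sub>R h) \<partial>lborel)"
          using True h in_B[of x]
          by (intro nn_integral_mono)
             (auto simp: \<Phi>_def E_def split: split_indicator intro!: ennreal_leI mult_right_mono)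
        finally show ?thesis using True by simp
      qed auto
    qed
    hence "(\<integral>\<^sup>+x. ennreal (l - k) * indicator {x \<in> ball z r. l \<le> w x} x * indicator {x. w x \<le> k} (x + h) \<partial>lborel)
      \<le> (\<integral>\<^sup>+x. (\<integral>\<^sup>+t. indicator {0..1} t * \<Phi> (x + t *\<^sub>R h) \<partial>lborel) \<partial>lborel)"
      by (rule nn_integral_mono_AE)
    also have "\<dots> = (\<integral>\<^sup>+t. (\<integral>\<^sup>+x. indicator {0..1} t * \<Phi> (x + t *\<^sub>R h) \<partial>lborel) \<partial>lborel)"
      by (rule lborel_pair.Fubini') measurable
    also have "\<dots> = (\<integral>\<^sup>+t. indicator {0..1::real} t * (\<integral>\<^sup>+x. \<Phi> x \<partial>lborel) \<partial>lborel)"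
      by (subst nn_integral_cmult) (auto simp: lborel_nn_integral_translate)
    also have "\<dots> = (\<integral>\<^sup>+x. \<Phi> x \<partial>lborel)"
      by (subst nn_integral_multc) auto
    finally show ?thesis .
  qed
  have shift: "emeasure lborel {y \<in> ball x \<eta>. w y \<le> k} = 
      (\<integral>\<^sup>+h. indicator (ball 0 \<eta>) h * indicator {x. w x \<le> k} (x + h) \<partial>lborel)" for x
  proof -
    have "emeasure lborel {y \<in> ball x \<eta>. w y \<le> k} = (\<integral>\<^sup>+y. indicator {y \<in> ball x \<eta>. w y \<le> k} y \<partial>lborel)"
      by simp
    also have "\<dots> = (\<integral>\<^sup>+y. indicator (ball x \<eta>) y * indicator {x. w x \<le> k} y \<partial>lborel)"
      by (intro nn_integral_cong) (auto split: split_indicator)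
    also have "\<dots> = (\<integral>\<^sup>+h. indicator (ball x \<eta>) (h + x) * indicator {x. w x \<le> k} (h + x) \<partial>lborel)"
      by (rule lborel_nn_integral_translate[symmetric])
         (intro borel_measurable_times_ennreal borel_measurable_indicator; simp)
    finally show ?thesis by (simp add: indicator_def dist_norm add.commute)
  qed
  have "ennreal (l - k) * m * emeasure lborel {x \<in> ball z r. l \<le> w x} = 
      (\<integral>\<^sup>+x. ennreal (l - k) * m * indicator {x \<in> ball z r. l \<le> w x} x \<partial>lborel)"
    by (subst nn_integral_cmult) auto
  also have "\<dots> \<le> (\<integral>\<^sup>+x. ennreal (l - k) * indicator {x \<in> ball z r. l \<le> w x} x * 
      (\<integral>\<^sup>+h. indicator (ball 0 \<eta>) h * indicator {x. w x \<le> k} (x + h) \<partial>lborel) \<partial>lborel)"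
    using m[unfolded shift] 
    by (intro nn_integral_mono) (auto split: split_indicator intro!: mult_left_mono)
  also have "\<dots> = (\<integral>\<^sup>+x. (\<integral>\<^sup>+h. indicator (ball 0 \<eta>) h * (ennreal (l - k) * 
      indicator {x \<in> ball z r. l \<le> w x} x * indicator {x. w x \<le> k} (x + h)) \<partial>lborel) \<partial>lborel)"
    by (subst nn_integral_cmult[symmetric]; (measurable)?) (auto simp: mult_ac)
  also have "\<dots> = (\<integral>\<^sup>+h. (\<integral>\<^sup>+x. indicator (ball 0 \<eta>) h * (ennreal (l - k) * 
      indicator {x \<in> ball z r. l \<le> w x} x * indicator {x. w x \<le> k} (x + h)) \<partial>lborel) \<partial>lborel)"
    by (rule lborel_pair.Fubini') measurable
  also have "\<dots> \<le> (\<integral>\<^sup>+h. indicator (ball (0::'a) \<eta>) h * (\<integral>\<^sup>+x. \<Phi> x \<partial>lborel) \<partial>lborel)"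
    using one by (intro nn_integral_mono) (auto split: split_indicator simp: nn_integral_cmult)
  also have "\<dots> = emeasure lborel (ball (0::'a) \<eta>) * (\<integral>\<^sup>+x. \<Phi> x \<partial>lborel)"
    by (subst nn_integral_multc) auto
  finally show ?thesis unfolding \<Phi>_int by (simp add: mult_ac)
qed

lemma lebesgue_measurable_ex_borel:
  fixes f :: "'a::euclidean_space \<Rightarrow> 'b::euclidean_space"
  assumes "f \<in> borel_measurable lebesgue"
  obtains f' where "f' \<in> borel_measurable borel" "AE x in lborel. f x = f' x"
proof -
  have "\<forall>i\<in>(Basis::'b set). \<exists>g. g \<in> borel_measurable lborel \<and> (AE x in lborel. f x \<bullet> i = g x)"
  proof
    fix i :: 'b
    have "(\<lambda>x. f x \<bullet> i) \<in> borel_measurable lebesgue" using assms by measurable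
    thus "\<exists>g. g \<in> borel_measurable lborel \<and> (AE x in lborel. f x \<bullet> i = g x)"
      using completion_ex_borel_measurable_real by blast
  qed
  then obtain g where g: "\<And>i. i \<in> Basis \<Longrightarrow> g i \<in> borel_measurable lborel"
    "\<And>i. i \<in> Basis \<Longrightarrow> AE x in lborel. f x \<bullet> i = g i x"
    by metis
  have "AE x in lborel. \<forall>i\<in>Basis. f x \<bullet> i = g i x"
    using g(2) by (subst AE_finite_all) auto
  hence "AE x in lborel. f x = (\<Sum>i\<in>Basis. g i x *\<^sub>R i)"
    by eventually_elim (metis (no_types, lifting) euclidean_representation sum.cong)
  moreover have "(\<lambda>x. \<Sum>i\<in>Basis. g i x *\<^sub>R i) \<in> borel_measurable borel"
    using g(1) by (intro borel_measurable_sum borel_measurable_scaleR) auto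
  ultimately show ?thesis using that by blast
qed

lemma locally_integrable_on_cball_measurable:
  assumes "locally_integrable_on f \<Omega>" "cball z \<rho> \<subseteq> \<Omega>"
  shows "integrable lebesgue (\<lambda>x. indicator (cball z \<rho>) x *\<^sub>R f x)"
  using assms by (auto simp: locally_integrable_on_def set_integrable_def)

lemma level_sets_measurable:
  fixes w :: "'a::euclidean_space \<Rightarrow> real"
  assumes "(\<lambda>x. indicator B x *\<^sub>R w x) \<in> borel_measurable lebesgue" "S \<subseteq> B" "S \<in> sets lebesgue"
  shows "{x \<in> S. w x \<le> k} \<in> sets lebesgue" "{x \<in> S. k \<le> w x} \<in> sets lebesgue"
    "{x \<in> S. k < w x} \<in> sets lebesgue" "{x \<in> S. k < w x \<and> w x < l} \<in> sets lebesgue"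
proof -
  note [measurable] = assms(1,3)
  have *: "{x \<in> S. w x \<le> k} = S \<inter> {x \<in> space lebesgue. indicator B x *\<^sub>R w x \<le> k}"
    using assms(2) by (auto simp: indicator_def)
  show "{x \<in> S. w x \<le> k} \<in> sets lebesgue" unfolding * by measurable
  have *: "{x \<in> S. k \<le> w x} = S \<inter> {x \<in> space lebesgue. k \<le> indicator B x *\<^sub>R w x}"
    using assms(2) by (auto simp: indicator_def)
  show "{x \<in> S. k \<le> w x} \<in> sets lebesgue" unfolding * by measurable
  have *: "{x \<in> S. k < w x} = S \<inter> {x \<in> space lebesgue. k < indicator B x *\<^sub>R w x}"
    using assms(2) by (auto simp: indicator_def)
  show "{x \<in> S. k < w x} \<in> sets lebesgue" unfolding * by measurable
  have *: "{x \<in> S. k < w x \<and> w x < l} = S \<inter> {x \<in> space lebesgue. k < indicator B x *\<^sub>R w x \<and> indicator B x *\<^sub>R w x < l}"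
    using assms(2) by (auto simp: indicator_def)
  show "{x \<in> S. k < w x \<and> w x < l} \<in> sets lebesgue" unfolding * by measurable
qed

text \<open>The same for weak gradients in the sense of \<open>has_weak_gradient\<close>: \<open>w\<close> and \<open>V\<close> are cut off outside a
  closed ball, where they are integrable, and replaced by Borel functions.\<close>

lemma isoperimetric:
  fixes w :: "'a::euclidean_space \<Rightarrow> real"
  assumes wV: "has_weak_gradient \<Omega> w V" and sub: "cball z (r + \<eta>) \<subseteq> \<Omega>"
    and "0 < r" "0 < \<eta>" "k < l"
    and m: "\<And>x. x \<in> ball z r \<Longrightarrow> m \<le> emeasure lebesgue {y \<in> ball x \<eta>. w y \<le> k}"
  shows "ennreal (l - k) * m * emeasure lebesgue {x \<in> ball z r. l \<le> w x} \<le>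
    ennreal \<eta> * emeasure lebesgue (ball (0::'a) \<eta>) * 
    (\<integral>\<^sup>+x\<in>{x \<in> ball z (r + \<eta>). k < w x \<and> w x < l}. norm (V x) \<partial>lebesgue)"
proof -
  define K where "K = cball z (r + \<eta>)"
  define B where "B = ball z (r + \<eta>)"
  have BK: "B \<subseteq> K" by (auto simp: B_def K_def)
  have iw: "integrable lebesgue (\<lambda>x. indicator K x *\<^sub>R w x)" and iV: "integrable lebesgue (\<lambda>x. indicator K x *\<^sub>R V x)"
    using wV sub unfolding has_weak_gradient_def K_def by (blast intro: locally_integrable_on_cball_measurable)+
  note [measurable] = borel_measurable_integrable[OF iw] borel_measurable_integrable[OF iV]
  obtain w' where w'[measurable]: "w' \<in> borel_measurable borel" 
      and "AE x in lborel. indicator K x *\<^sub>R w x = w' x"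
    by (rule lebesgue_measurable_ex_borel[OF borel_measurable_integrable[OF iw]])
  hence ae_w: "AE x in lebesgue. indicator K x *\<^sub>R w x = w' x" by (intro AE_completion)
  obtain V' where V'[measurable]: "V' \<in> borel_measurable borel" 
      and "AE x in lborel. indicator K x *\<^sub>R V x = V' x"
    by (rule lebesgue_measurable_ex_borel[OF borel_measurable_integrable[OF iV]])
  hence ae_V: "AE x in lebesgue. indicator K x *\<^sub>R V x = V' x" by (intro AE_completion)
  have borel_lebesgue: "f \<in> borel_measurable lebesgue" if "f \<in> borel_measurable borel" 
    for f :: "'a \<Rightarrow> 'c::topological_space"
    using that by (simp add: measurable_completion)
  have iwV: "integrable_weak_gradient B w' V'"
    unfolding integrable_weak_gradient_def
  proof (intro conjI ballI)
    have "integrable lebesgue w'"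
      using iw by (subst integrable_cong_AE[OF _ _ ae_w, symmetric]) (auto intro: borel_lebesgue)
    thus "integrable lborel w'" by (simp add: integrable_completion)
    have "integrable lebesgue V'"
      using iV by (subst integrable_cong_AE[OF _ _ ae_V, symmetric]) (auto intro: borel_lebesgue)
    thus "integrable lborel V'" by (simp add: integrable_completion)
    fix \<psi> i assume \<psi>: "\<psi> \<in> test_functions B" and i: "i \<in> (Basis::'a set)"
    let ?d = "\<lambda>x. frechet_derivative \<psi> (at x) i"
    have d[measurable]: "?d \<in> borel_measurable borel"
      by (intro borel_measurable_continuous_onI test_function_frechet_continuous[OF \<psi>])
    have p[measurable]: "\<psi> \<in> borel_measurable borel"
      by (intro borel_measurable_continuous_onI test_function_continuous[OF \<psi>])
    note [measurable] = borel_lebesgue[OF d] borel_lebesgue[OF p] borel_lebesgue[OF w'] borel_lebesgue[OF V']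
    have KO: "K \<subseteq> \<Omega>" using sub by (simp add: K_def)
    have "(LINT x|lborel. w' x * ?d x) = (LINT x|lebesgue. w' x * ?d x)"
      by (subst integral_completion) auto
    also have "\<dots> = (LINT x|lebesgue. (indicator K x *\<^sub>R w x) * ?d x)"
      by (rule integral_cong_AE; (measurable)?) (use ae_w in \<open>auto elim!: eventually_mono\<close>)
    also have "\<dots> = (LINT x:\<Omega>|lebesgue. w x * ?d x)"
      unfolding set_lebesgue_integral_def
    proof (intro Bochner_Integration.integral_cong refl)
      fix x show "(indicator K x *\<^sub>R w x) * ?d x = indicator \<Omega> x *\<^sub>R (w x * ?d x)"
        using test_function_frechet_eq_0[OF \<psi>, of x i] BK KO by (cases "x \<in> B") (auto simp: indicator_def)
    qed
    also have "\<dots> = - (LINT x:\<Omega>|lebesgue. (V x \<bullet> i) * \<psi> x)"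
      using wV test_functions_mono[OF _ \<psi>, of \<Omega>] BK KO i by (auto simp: has_weak_gradient_def)
    also have "(LINT x:\<Omega>|lebesgue. (V x \<bullet> i) * \<psi> x) = (LINT x|lebesgue. ((indicator K x *\<^sub>R V x) \<bullet> i) * \<psi> x)"
      unfolding set_lebesgue_integral_def
    proof (intro Bochner_Integration.integral_cong refl)
      fix x show "indicator \<Omega> x *\<^sub>R ((V x \<bullet> i) * \<psi> x) = ((indicator K x *\<^sub>R V x) \<bullet> i) * \<psi> x"
        using test_function_eq_0[OF \<psi>, of x] BK KO by (cases "x \<in> B") (auto simp: indicator_def)
    qed
    also have "\<dots> = (LINT x|lebesgue. (V' x \<bullet> i) * \<psi> x)"
    proof (rule integral_cong_AE)
      show "(\<lambda>x. ((indicator K x *\<^sub>R V x) \<bullet> i) * \<psi> x) \<in> borel_measurable lebesgue"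
        using borel_measurable_integrable[OF iV] borel_lebesgue[OF p]
        by (intro borel_measurable_times borel_measurable_inner) auto
      show "(\<lambda>x. (V' x \<bullet> i) * \<psi> x) \<in> borel_measurable lebesgue"
        using borel_lebesgue[OF V'] borel_lebesgue[OF p]
        by (intro borel_measurable_times borel_measurable_inner) auto
      show "AE x in lebesgue. ((indicator K x *\<^sub>R V x) \<bullet> i) * \<psi> x = (V' x \<bullet> i) * \<psi> x"
        using ae_V by eventually_elim (simp only:)
    qed
    also have "\<dots> = (LINT x|lborel. (V' x \<bullet> i) * \<psi> x)"
      by (subst integral_completion) auto
    finally show "(LINT x|lborel. w' x * ?d x) = - (LINT x|lborel. (V' x \<bullet> i) * \<psi> x)" .
  qed
  have ae: "AE x in lebesgue. x \<in> K \<longrightarrow> w x = w' x \<and> V x = V' x"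
    using ae_w ae_V by eventually_elim auto
  have meas: "{x \<in> S. w' x \<le> c} \<in> sets lborel" "{x \<in> S. c \<le> w' x} \<in> sets lborel" if "open S" for S c
    using that by measurable
  have m': "m \<le> emeasure lborel {y \<in> ball x \<eta>. w' y \<le> k}" if x: "x \<in> ball z r" for x
  proof -
    have bK: "ball x \<eta> \<subseteq> K" using x unfolding K_def
      by (intro subset_trans[OF _ ball_subset_cball] ball_subset_ball_iff[THEN iffD2]) (auto simp: dist_commute)
    have "emeasure lebesgue {y \<in> ball x \<eta>. w y \<le> k} = emeasure lebesgue {y \<in> ball x \<eta>. w' y \<le> k}"
    proof (rule emeasure_eq_AE)
      show "AE y in lebesgue. (y \<in> {y \<in> ball x \<eta>. w y \<le> k}) = (y \<in> {y \<in> ball x \<eta>. w' y \<le> k})"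
        using ae by eventually_elim (use bK in auto)
      show "{y \<in> ball x \<eta>. w y \<le> k} \<in> sets lebesgue"
        by (rule level_sets_measurable[OF borel_measurable_integrable[OF iw] bK]) auto
      show "{y \<in> ball x \<eta>. w' y \<le> k} \<in> sets lebesgue" using meas(1)[of "ball x \<eta>" k] by auto
    qed
    also have "\<dots> = emeasure lborel {y \<in> ball x \<eta>. w' y \<le> k}" using meas(1)[of "ball x \<eta>" k] by simp
    finally show ?thesis using m[OF x] by simp
  qed
  have "ennreal (l - k) * m * emeasure lborel {x \<in> ball z r. l \<le> w' x} \<le>
    ennreal \<eta> * emeasure lborel (ball (0::'a) \<eta>) * 
    (\<integral>\<^sup>+x\<in>{x \<in> ball z (r + \<eta>). k < w' x \<and> w' x < l}. norm (V' x) \<partial>lborel)"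
    using iwV m' assms(3-5) by (intro isoperimetric_borel) (auto simp: B_def)
  also have "(\<integral>\<^sup>+x\<in>{x \<in> ball z (r + \<eta>). k < w' x \<and> w' x < l}. norm (V' x) \<partial>lborel) =
      (\<integral>\<^sup>+x\<in>{x \<in> ball z (r + \<eta>). k < w' x \<and> w' x < l}. norm (V' x) \<partial>lebesgue)"
    by (simp add: nn_integral_completion)
  also have "\<dots> = (\<integral>\<^sup>+x\<in>{x \<in> ball z (r + \<eta>). k < w x \<and> w x < l}. norm (V x) \<partial>lebesgue)"
  proof (rule nn_integral_cong_AE)
    show "AE x in lebesgue. ennreal (norm (V' x)) * indicator {x \<in> ball z (r + \<eta>). k < w' x \<and> w' x < l} x =
        ennreal (norm (V x)) * indicator {x \<in> ball z (r + \<eta>). k < w x \<and> w x < l} x"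
      using ae by eventually_elim (auto simp: K_def indicator_def)
  qed
  also have "emeasure lborel {x \<in> ball z r. l \<le> w' x} = emeasure lebesgue {x \<in> ball z r. l \<le> w' x}"
    using meas(2)[of "ball z r" l] by simp
  also have "\<dots> = emeasure lebesgue {x \<in> ball z r. l \<le> w x}"
  proof (rule emeasure_eq_AE)
    have bK: "ball z r \<subseteq> K" using \<open>0 < \<eta>\<close> by (auto simp: K_def)
    show "AE y in lebesgue. (y \<in> {y \<in> ball z r. l \<le> w' y}) = (y \<in> {y \<in> ball z r. l \<le> w y})"
      using ae by eventually_elim (use bK in auto)
    show "{y \<in> ball z r. l \<le> w y} \<in> sets lebesgue"
      by (rule level_sets_measurable[OF borel_measurable_integrable[OF iw] bK]) auto
    show "{y \<in> ball z r. l \<le> w' y} \<in> sets lebesgue" using meas(2)[of "ball z r" l] by auto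
  qed
  finally show ?thesis by simp
qed

section \<open>An \<open>L\<^sup>1\<close> estimate for the gradient\<close>

text \<open>Above the slope \<open>a * T\<close> the function \<open>\<Phi>\<close> grows at least like the power \<open>gm\<close>, hence \<open>v\<close> is there
  at most \<open>T * a powr (1 - gm) * \<Phi> v / \<Phi> T\<close>.\<close>

lemma growth_pointwise:
  assumes N: "N_function_at \<Phi> \<phi> gm gp" and "1 \<le> gm" "0 < T" "1 \<le> a" "0 < P" "P \<le> C0 * \<Phi> T" "0 \<le> v"
  shows "v - a * T \<le> C0 * T * a powr (1 - gm) / P * \<Phi> v"
proof (cases "v \<le> a * T")
  case True
  have "0 \<le> \<Phi> T" using N \<open>0 < T\<close> by (auto simp: N_function_at_def less_imp_le)
  have "0 < C0 * \<Phi> T" using assms by linarith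
  hence "0 \<le> C0" using \<open>0 \<le> \<Phi> T\<close> by (simp add: zero_less_mult_iff)
  moreover have "0 \<le> \<Phi> v"
    using N \<open>0 \<le> v\<close> by (cases "v = 0") (auto simp: N_function_at_def less_imp_le)
  ultimately have "0 \<le> C0 * T * a powr (1 - gm) / P * \<Phi> v" using assms by simp
  thus ?thesis using True by linarith
next
  case False
  have "1 * T \<le> a * T" using assms by (intro mult_right_mono) auto
  hence "T < v" using False by simp
  hence vT: "T < v" "a < v / T" "0 < v" using False assms by (auto simp: field_simps)
  have pos: "0 < \<Phi> T" using N assms by (auto simp: N_function_at_def)
  have "0 < C0 * \<Phi> T" using assms by linarith
  hence C0: "0 < C0" using pos by (simp add: zero_less_mult_iff)
  have "v = T * ((v / T) powr gm * (v / T) powr (1 - gm))"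
    using vT assms by (simp add: powr_add[symmetric])
  also have "\<dots> \<le> T * ((v / T) powr gm * a powr (1 - gm))"
    using vT assms by (intro mult_left_mono powr_mono2') auto
  also have "\<dots> = T * a powr (1 - gm) * (v / T) powr gm" by (simp add: mult_ac)
  also have "\<dots> \<le> T * a powr (1 - gm) * (\<Phi> v / \<Phi> T)"
    using N_function_at_lower_growth[OF N, of T v] vT assms pos
    by (intro mult_left_mono) (auto simp: field_simps)
  also have "\<dots> \<le> T * a powr (1 - gm) * (C0 * \<Phi> v / P)"
  proof (intro mult_left_mono)
    have "0 \<le> \<Phi> v" using N vT by (auto simp: N_function_at_def less_imp_le)
    have "P * \<Phi> v \<le> C0 * \<Phi> T * \<Phi> v" using \<open>0 \<le> \<Phi> v\<close> assms by (intro mult_right_mono) auto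
    thus "\<Phi> v / \<Phi> T \<le> C0 * \<Phi> v / P" using pos assms by (simp add: field_simps)
  qed (use assms in auto)
  finally have "v \<le> C0 * T * a powr (1 - gm) / P * \<Phi> v" by (simp add: mult_ac)
  moreover have "0 \<le> a * T" using assms by simp
  ultimately show ?thesis by linarith
qed

lemma superlevel_measurable:
  fixes w :: "'a::euclidean_space \<Rightarrow> real"
  assumes "(\<lambda>x. indicator B x *\<^sub>R w x) \<in> borel_measurable lebesgue" "ball z \<rho> \<subseteq> B"
  shows "superlevel w k z \<rho> \<in> sets lebesgue"
  unfolding superlevel_def by (rule level_sets_measurable[OF assms]) auto

text \<open>The number \<open>P\<close> stands for the common size of all \<open>G x T\<close>. The right side of the Caccioppoli inequality is
  at most a multiple of \<open>P\<close> times the measure of the superlevel set, because \<open>w - k\<close> is at most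
  \<open>T * \<rho>\<close> there; on the left the previous lemma bounds the excess of the gradient over
  \<open>a * T\<close> by a multiple of \<open>G / P\<close>. So \<open>P\<close> cancels. As \<open>G\<close> is measurable in \<open>x\<close> only for
  fixed \<open>t\<close>, the integrand \<open>G x (norm (V x))\<close> is used by monotonicity only and never split.\<close>

lemma gradient_L1_estimate:
  fixes w :: "'a::euclidean_space \<Rightarrow> real" and V :: "'a \<Rightarrow> 'a"
  assumes w: "(\<lambda>x. indicator B x *\<^sub>R w x) \<in> borel_measurable lebesgue"
    and V: "(\<lambda>x. indicator B x *\<^sub>R V x) \<in> borel_measurable lebesgue"
    and B: "ball z \<rho> \<subseteq> B" and \<rho>: "0 < \<rho>" and \<sigma>: "0 < \<sigma>" "\<sigma> < 1"
    and cacc: "(\<integral>\<^sup>+x\<in>superlevel w k z (\<rho> - \<sigma> * \<rho>). ennreal (G x (norm (V x))) \<partial>lebesgue)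
           \<le> ennreal \<gamma> * (\<integral>\<^sup>+x\<in>superlevel w k z \<rho>. ennreal (G x \<bar>(w x - k) / (\<sigma> * \<rho>)\<bar>) \<partial>lebesgue)
             + ennreal \<gamma>1 * emeasure lebesgue (superlevel w k z \<rho>)"
    and bd: "AE x in lebesgue. x \<in> ball z \<rho> \<longrightarrow> w x \<le> \<mu>"
    and G: "AE x in lebesgue. x \<in> ball z \<rho> \<longrightarrow> 
      N_function_at (G x) (g x) gm gp \<and> P \<le> C0 * G x T \<and> G x T \<le> C0 * P"
    and gm: "1 \<le> gm" and p: "gp \<le> real p" and pos: "0 < T" "0 < P" "0 < C0" "0 < \<gamma>" "0 \<le> \<gamma>1" "\<gamma>1 \<le> P"
    and k: "\<mu> - k \<le> T * \<rho>" and a: "1 \<le> a"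
    and E: "E \<subseteq> superlevel w k z (\<rho> - \<sigma> * \<rho>)" "E \<in> sets lebesgue"
  shows "(\<integral>\<^sup>+x\<in>E. ennreal (norm (V x)) \<partial>lebesgue) \<le> ennreal (a * T) * emeasure lebesgue E +
     ennreal (C0 * (\<gamma> * C0 + 1) * (1 / \<sigma>) ^ p * T * a powr (1 - gm)) * emeasure lebesgue (superlevel w k z \<rho>)"
proof -
  let ?A = "superlevel w k z \<rho>" and ?A' = "superlevel w k z (\<rho> - \<sigma> * \<rho>)"
  have [measurable]: "?A \<in> sets lebesgue" using w B by (rule superlevel_measurable)
  have "\<rho> - \<sigma> * \<rho> \<le> \<rho>" using \<rho> \<sigma> by simp
  hence A'A: "?A' \<subseteq> ?A" by (auto simp: superlevel_def)
  have AB: "?A \<subseteq> ball z \<rho>" by (auto simp: superlevel_def)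
  have EB: "E \<subseteq> B" "E \<subseteq> ball z \<rho>" using E A'A AB B by auto
  have [measurable]: "E \<in> sets lebesgue" by fact
  define Q where "Q = (1 / \<sigma>) ^ p * C0 * P"
  have Q: "Q \<ge> 0" using \<sigma> pos by (simp add: Q_def)
  have "(\<integral>\<^sup>+x\<in>?A. ennreal (G x \<bar>(w x - k) / (\<sigma> * \<rho>)\<bar>) \<partial>lebesgue) \<le> (\<integral>\<^sup>+x. ennreal Q * indicator ?A x \<partial>lebesgue)"
  proof (rule nn_integral_mono_AE)
    show "AE x in lebesgue. ennreal (G x \<bar>(w x - k) / (\<sigma> * \<rho>)\<bar>) * indicator ?A x \<le> ennreal Q * indicator ?A x"
      using bd G
    proof eventually_elim
      case (elim x)
      show ?case
      proof (cases "x \<in> ?A")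
        case True
        hence x: "x \<in> ball z \<rho>" "k < w x" by (auto simp: superlevel_def)
        have N: "N_function_at (G x) (g x) gm gp" and GT: "G x T \<le> C0 * P" using elim x by auto
        have "(w x - k) / (\<sigma> * \<rho>) \<le> T * \<rho> / (\<sigma> * \<rho>)"
          using elim x k \<sigma> \<rho> by (intro divide_right_mono) auto
        also have "\<dots> = T / \<sigma>" using \<rho> by simp
        finally have "G x \<bar>(w x - k) / (\<sigma> * \<rho>)\<bar> \<le> G x (T / \<sigma>)"
          using x \<sigma> \<rho> by (intro N_function_at_mono[OF N]) auto
        also have "\<dots> \<le> (1 / \<sigma>) powr gp * G x T"
          using N_function_at_upper_growth[OF N, of T "T / \<sigma>"] pos \<sigma> by (simp add: field_simps)
        also have "\<dots> \<le> (1 / \<sigma>) powr real p * G x T"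
          using N pos p \<sigma> by (intro mult_right_mono powr_mono) (auto simp: N_function_at_def less_imp_le)
        also have "\<dots> \<le> (1 / \<sigma>) ^ p * (C0 * P)"
          using \<sigma> GT by (subst powr_realpow) (auto intro!: mult_left_mono)
        finally show ?thesis by (simp add: Q_def True mult.assoc ennreal_leI)
      qed simp
    qed
  qed
  also have "\<dots> = ennreal Q * emeasure lebesgue ?A" by (subst nn_integral_cmult_indicator) auto
  finally have "(\<integral>\<^sup>+x\<in>?A'. ennreal (G x (norm (V x))) \<partial>lebesgue) \<le> 
      ennreal \<gamma> * (ennreal Q * emeasure lebesgue ?A) + ennreal \<gamma>1 * emeasure lebesgue ?A"
    using cacc by (meson add_mono mult_left_mono order_refl order_trans zero_le)
  also have "\<dots> = ennreal (\<gamma> * Q + \<gamma>1) * emeasure lebesgue ?A"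
    using pos Q by (simp add: ennreal_mult ennreal_plus distrib_right mult.assoc)
  also have "\<dots> \<le> ennreal ((\<gamma> * C0 + 1) * (1 / \<sigma>) ^ p * P) * emeasure lebesgue ?A"
  proof (intro mult_right_mono ennreal_leI)
    have "P * 1 \<le> P * (1 / \<sigma>) ^ p" using pos \<sigma> by (intro mult_left_mono one_le_power) auto
    hence "\<gamma>1 \<le> P * (1 / \<sigma>) ^ p" using pos by linarith
    thus "\<gamma> * Q + \<gamma>1 \<le> (\<gamma> * C0 + 1) * (1 / \<sigma>) ^ p * P"
      using pos by (simp add: Q_def algebra_simps)
  qed simp
  finally have step1: "(\<integral>\<^sup>+x\<in>?A'. ennreal (G x (norm (V x))) \<partial>lebesgue) \<le> 
      ennreal ((\<gamma> * C0 + 1) * (1 / \<sigma>) ^ p * P) * emeasure lebesgue ?A" .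
  define K where "K = C0 * T * a powr (1 - gm) / P"
  have K: "K > 0" using pos a by (simp add: K_def)
  define f where "f = (\<lambda>x. norm (indicator B x *\<^sub>R V x))"
  have [measurable]: "f \<in> borel_measurable lebesgue" unfolding f_def using V by measurable
  have fV: "f x = norm (V x)" if "x \<in> E" for x using that EB by (auto simp: f_def)
  have "(\<integral>\<^sup>+x\<in>E. ennreal (norm (V x)) \<partial>lebesgue) = (\<integral>\<^sup>+x. ennreal (f x) * indicator E x \<partial>lebesgue)"
    by (intro nn_integral_cong) (auto simp: fV split: split_indicator)
  also have "\<dots> \<le> (\<integral>\<^sup>+x. ennreal (a * T) * indicator E x + ennreal K * (ennreal ((f x - a * T) / K) * indicator E x) \<partial>lebesgue)"
  proof (rule nn_integral_mono)
    fix x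
    have "ennreal (f x) \<le> ennreal (a * T) + ennreal (f x - a * T)"
      using a pos by (cases "f x - a * T \<ge> 0") (auto simp flip: ennreal_plus simp: ennreal_leI intro: add_increasing2)
    also have "ennreal (f x - a * T) = ennreal K * ennreal ((f x - a * T) / K)"
      using K by (simp flip: ennreal_mult')
    finally show "ennreal (f x) * indicator E x \<le> ennreal (a * T) * indicator E x + ennreal K * (ennreal ((f x - a * T) / K) * indicator E x)"
      by (auto split: split_indicator)
  qed
  also have "\<dots> = ennreal (a * T) * emeasure lebesgue E + ennreal K * (\<integral>\<^sup>+x. ennreal ((f x - a * T) / K) * indicator E x \<partial>lebesgue)"
    by (subst nn_integral_add; (measurable)?) (auto simp: nn_integral_cmult_indicator nn_integral_cmult)
  also have "(\<integral>\<^sup>+x. ennreal ((f x - a * T) / K) * indicator E x \<partial>lebesgue) \<le> 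
      (\<integral>\<^sup>+x\<in>?A'. ennreal (G x (norm (V x))) \<partial>lebesgue)"
  proof (rule nn_integral_mono_AE)
    show "AE x in lebesgue. ennreal ((f x - a * T) / K) * indicator E x \<le> ennreal (G x (norm (V x))) * indicator ?A' x"
      using G
    proof eventually_elim
      case (elim x)
      show ?case
      proof (cases "x \<in> E")
        case True
        hence x: "x \<in> ball z \<rho>" "x \<in> ?A'" using EB E by auto
        have "f x - a * T \<le> K * G x (f x)"
          unfolding K_def using elim x gm pos a by (intro growth_pointwise) (auto simp: f_def)
        hence "(f x - a * T) / K \<le> G x (norm (V x))" using K True by (simp add: fV field_simps)
        thus ?thesis using True x by (simp add: ennreal_leI)
      qed simp
    qed
  qed
  also note step1
  also have "ennreal K * (ennreal ((\<gamma> * C0 + 1) * (1 / \<sigma>) ^ p * P) * emeasure lebesgue ?A) =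
      ennreal (K * ((\<gamma> * C0 + 1) * (1 / \<sigma>) ^ p * P)) * emeasure lebesgue ?A"
    using K pos \<sigma> by (simp add: ennreal_mult mult.assoc)
  also have "K * ((\<gamma> * C0 + 1) * (1 / \<sigma>) ^ p * P) = C0 * (\<gamma> * C0 + 1) * (1 / \<sigma>) ^ p * T * a powr (1 - gm)"
    using pos by (simp add: K_def)
  finally show ?thesis by (simp add: add_left_mono mult_left_mono)
qed

section \<open>De Giorgi's lemmas for level sets\<close>

(* Volumes are written with the measure lebesgue throughout; without this declaration the simplifier
   turns them into content for some sets only. *)
declare measure_completion [simp del]

lemma measure_lebesgue_ball:
  assumes "0 \<le> r"
  shows "measure lebesgue (ball (c::'a::euclidean_space) r) = measure lebesgue (ball (0::'a) 1) * r ^ DIM('a)"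
  using content_ball_conv_unit_ball[OF assms, of c] by (simp add: measure_completion mult.commute)

lemma measure_lebesgue_unit_ball_pos: "0 < measure lebesgue (ball (0::'a::euclidean_space) 1)"
  using content_ball_pos[of 1 "0::'a"] by (simp add: measure_completion)

lemma subset_ball_fmeasurable:
  "S \<subseteq> ball z (r::real) \<Longrightarrow> S \<in> sets lebesgue \<Longrightarrow> S \<in> fmeasurable lebesgue"
  by (rule fmeasurableI2[OF lmeasurable_ball])

text \<open>The isoperimetric inequality combined with the estimate of the gradient. Here \<open>\<mu>\<close> stands for an upper bound
  of \<open>w\<close> on \<open>ball z R\<close>, \<open>D\<close> says how far below \<open>\<mu>\<close> the level \<open>k\<close> may lie, \<open>T\<close> bounds the slope
  \<open>(\<mu> - k) / \<rho>\<close> and is restricted to the range where \<open>G\<close> is comparable on the ball, and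
  \<open>\<beta>\<close> is \<open>gm - 1\<close>. In the bracket the first summand comes from gradients below \<open>a * T\<close>, the second
  from those above.\<close>

definition level_decay ::
  "('a::euclidean_space \<Rightarrow> real) \<Rightarrow> 'a \<Rightarrow> real \<Rightarrow> real \<Rightarrow> real \<Rightarrow> real \<Rightarrow> real \<Rightarrow> real \<Rightarrow> nat \<Rightarrow> real \<Rightarrow> bool" where
  "level_decay w z R \<mu> D T0 T1 C p \<beta> \<longleftrightarrow>
     (\<forall>\<rho> r \<eta> \<sigma> k l T a m. \<rho> \<le> R \<and> 0 < r \<and> 0 < \<eta> \<and> 0 < \<sigma> \<and> \<sigma> < 1 \<and> r + \<eta> \<le> \<rho> - \<sigma> * \<rho> \<and>
        0 \<le> m \<and> k < l \<and> \<mu> - D \<le> k \<and> \<mu> - k \<le> T * \<rho> \<and> T0 \<le> T \<and> T \<le> T1 \<and> 1 \<le> a \<and>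
        (\<forall>x\<in>ball z r. m \<le> measure lebesgue {y \<in> ball x \<eta>. w y \<le> k}) \<longrightarrow>
        (l - k) * m * measure lebesgue {x \<in> ball z r. l \<le> w x} \<le>
          \<eta> * measure lebesgue (ball (0::'a) \<eta>) *
          (a * T * measure lebesgue {x \<in> ball z (r + \<eta>). k < w x \<and> w x < l} +
           C * (1 / \<sigma>) ^ p * T * a powr (- \<beta>) * measure lebesgue (superlevel w k z \<rho>)))"

lemma level_decayD:
  fixes z :: "'a::euclidean_space"
  assumes "level_decay w z R \<mu> D T0 T1 C p \<beta>"
    and "\<rho> \<le> R" "0 < r" "0 < \<eta>" "0 < \<sigma>" "\<sigma> < 1" "r + \<eta> \<le> \<rho> - \<sigma> * \<rho>" "0 \<le> m" "k < l" "\<mu> - D \<le> k"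
      "\<mu> - k \<le> T * \<rho>" "T0 \<le> T" "T \<le> T1" "1 \<le> a"
      "\<And>x. x \<in> ball z r \<Longrightarrow> m \<le> measure lebesgue {y \<in> ball x \<eta>. w y \<le> k}"
  shows "(l - k) * m * measure lebesgue {x \<in> ball z r. l \<le> w x} \<le>
          \<eta> * measure lebesgue (ball (0::'a) \<eta>) *
          (a * T * measure lebesgue {x \<in> ball z (r + \<eta>). k < w x \<and> w x < l} +
           C * (1 / \<sigma>) ^ p * T * a powr (- \<beta>) * measure lebesgue (superlevel w k z \<rho>))"
  using assms unfolding level_decay_def by blast

text \<open>De Giorgi's first lemma. Along radii decreasing from \<open>R\<close> to \<open>R / 2\<close> and levels increasing from
  \<open>\<mu> - d\<close> to \<open>\<mu> - d / 2\<close>, the isoperimetric inequality is applied with radii \<open>\<eta> j\<close> that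
  decrease geometrically. As long as the superlevel set fills at most half of a ball of radius \<open>\<eta> j\<close>, the
  hypothesis on \<open>m\<close> holds with half the volume of that ball, and the resulting factor \<open>\<eta> j\<close> outweighs
  the growth of the constants. So the bound on the measure reproduces itself in every step; it is the
  linear form of the usual superlinear recursion.\<close>

lemma level_decay_imp_bound:
  fixes w :: "'a::euclidean_space \<Rightarrow> real"
  defines "v \<equiv> measure lebesgue (ball (0::'a) 1)"
  assumes LD: "level_decay w z R \<mu> D T0 T1 C p \<beta>"
    and wm: "(\<lambda>x. indicator B x *\<^sub>R w x) \<in> borel_measurable lebesgue" and B: "ball z R \<subseteq> B"
    and R: "0 < R" and d: "0 < d" "d \<le> D" and T: "T0 \<le> 2 * d / R" "2 * d / R \<le> T1" and C: "0 \<le> C"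
    and \<tau>: "\<tau> = 1 / (16 * 8 ^ p * (1 + C) * (2 ^ (p + 1)) ^ DIM('a))"
    and small: "measure lebesgue (superlevel w (\<mu> - d) z R) \<le> v * (\<tau> * R) ^ DIM('a) / 2"
  shows "AE x in lebesgue. x \<in> ball z (R / 2) \<longrightarrow> w x \<le> \<mu> - d / 2"
proof -
  define n where "n = DIM('a)"
  (* The constants deteriorate by the factor 2 ^ (p + 1) per step: 2 ^ p from the power of 1 / sigma, and 2
     from the distance of consecutive levels. The radii eta must decrease just as fast. *)
  define b where "b = (2::real) ^ (p + 1)"
  define K where "K = 16 * 8 ^ p * (1 + C)"
  have n: "n > 0" by (simp add: n_def)
  have b: "b \<ge> 2" by (simp add: b_def)
  have "1 * 1 \<le> 8 ^ p * (1 + C)" using C by (intro mult_mono one_le_power) auto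
  hence K16: "K \<ge> 16" by (simp add: K_def)
  have \<tau>_eq: "\<tau> = 1 / (K * b ^ n)" by (simp add: \<tau> K_def b_def n_def)
  have bn: "1 \<le> b ^ n" using b by (intro one_le_power) simp
  have "8 * 1 \<le> K * b ^ n" using K16 bn by (intro mult_mono) auto
  hence \<tau>8: "0 < \<tau>" "\<tau> \<le> 1 / 8"
    unfolding \<tau>_eq using divide_left_mono[of 8 "K * b ^ n" 1] by simp_all
  have v: "v > 0" unfolding v_def by (rule measure_lebesgue_unit_ball_pos)
  have vol: "measure lebesgue (ball c s) = v * s ^ n" if "0 \<le> s" for c :: 'a and s
    unfolding v_def n_def using that by (rule measure_lebesgue_ball)
  define \<rho> where "\<rho> = (\<lambda>j::nat. R * (1 / 2 + 1 / 2 ^ (j + 1)))"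
  define k where "k = (\<lambda>j::nat. \<mu> - d * (1 / 2 + 1 / 2 ^ (j + 1)))"
  define \<eta> where "\<eta> = (\<lambda>j::nat. \<tau> * R / b ^ j)"
  define Y where "Y = (\<lambda>j. measure lebesgue (superlevel w (k j) z (\<rho> j)))"
  have half: "(1::real) / 2 ^ (j + 1) \<le> 1 / 2" for j :: nat by (simp add: field_simps)
  have \<rho>: "R / 2 \<le> \<rho> j" "\<rho> j \<le> R" for j
    using mult_left_mono[OF half[of j], of R] R by (simp_all add: \<rho>_def distrib_left)
  have \<rho>_Suc: "\<rho> (Suc j) = \<rho> j - R / 2 ^ (j + 2)" for j
    by (simp add: \<rho>_def field_simps)
  have k_Suc: "k (Suc j) = k j + d / 2 ^ (j + 2)" for j
    by (simp add: k_def field_simps)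
  have k_le: "\<mu> - d \<le> k j" "k j \<le> \<mu> - d / 2" for j
    using mult_left_mono[OF half[of j], of d] d by (simp_all add: k_def distrib_left)
  have \<eta>: "0 < \<eta> j" for j using \<tau>8 R b by (simp add: \<eta>_def)
  have meas: "superlevel w c z s \<in> fmeasurable lebesgue" if "s \<le> R" for c s
    using B that by (intro subset_ball_fmeasurable[of _ z s] superlevel_measurable[OF wm]) (auto simp: superlevel_def)
  have Y: "Y j \<le> v * \<eta> j ^ n / 2" for j
  proof (induction j)
    case 0
    show ?case using small by (simp add: Y_def k_def \<rho>_def \<eta>_def n_def)
  next
    case (Suc j)
    let ?X = "measure lebesgue {x \<in> ball z (\<rho> (Suc j)). k (Suc j) \<le> w x}"
    let ?E = "{x \<in> ball z (\<rho> (Suc j) + \<eta> j). k j < w x \<and> w x < k (Suc j)}"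
    (* ?s is small enough to leave half of the gap between consecutive radii for eta. *)
    let ?T = "2 * d / R" and ?s = "1 / 2 ^ (j + 3) :: real"
    have "2 ^ j \<le> b ^ j" using b by (intro power_mono) auto
    hence "\<eta> j \<le> (1/8) * R / 2 ^ j" unfolding \<eta>_def using \<tau>8 R 
      by (intro frac_le mult_right_mono) auto
    hence \<eta>_le: "\<eta> j \<le> R / 2 ^ (j + 3)" by (simp add: power_add)
    have sR: "?s * \<rho> j \<le> R / 2 ^ (j + 3)" using \<rho>[of j] by (simp add: field_simps)
    have gap: "\<rho> (Suc j) + \<eta> j \<le> \<rho> j - ?s * \<rho> j"
    proof -
      have "R / 2 ^ (j + 2) = 2 * (R / 2 ^ (j + 3))" by (simp add: power_add)
      thus ?thesis using \<eta>_le sR unfolding \<rho>_Suc by linarith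
    qed
    have gap': "\<rho> (Suc j) + \<eta> j \<le> \<rho> j"
      using gap \<rho>[of j] R by (smt (verit) divide_nonneg_nonneg mult_nonneg_nonneg zero_le_power)
    have "(k (Suc j) - k j) * (v * \<eta> j ^ n / 2) * ?X \<le> \<eta> j * measure lebesgue (ball (0::'a) (\<eta> j)) *
          (1 * ?T * measure lebesgue ?E + C * (1 / ?s) ^ p * ?T * 1 powr (- \<beta>) * measure lebesgue (superlevel w (k j) z (\<rho> j)))"
    proof (rule level_decayD[OF LD])
      show "0 < \<rho> (Suc j)" using \<rho>(1)[of "Suc j"] R by simp
      show "k j < k (Suc j)" using d by (simp add: k_Suc)
      show "\<mu> - D \<le> k j" using k_le[of j] d by simp
      have "\<mu> - k j \<le> ?T * (R / 2)" using k_le[of j] R by simp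
      also have "\<dots> \<le> ?T * \<rho> j" using \<rho>[of j] R d by (intro mult_left_mono) auto
      finally show "\<mu> - k j \<le> ?T * \<rho> j" .
      have "(1::real) < 2 ^ (j + 3)" by (rule one_less_power) simp_all
      thus "?s < 1" by simp
      fix x assume x: "x \<in> ball z (\<rho> (Suc j))"
      have sub: "ball x (\<eta> j) \<subseteq> ball z (\<rho> j)"
        using x gap' by (subst ball_subset_ball_iff) (auto simp: dist_commute)
      have m1: "{y \<in> ball x (\<eta> j). k j < w y} \<in> sets lebesgue"
        using sub \<rho>[of j] B by (intro level_sets_measurable[OF wm]) (auto simp: subset_iff)
      have "{y \<in> ball x (\<eta> j). w y \<le> k j} = ball x (\<eta> j) - {y \<in> ball x (\<eta> j). k j < w y}" by auto
      moreover have "measure lebesgue (ball x (\<eta> j) - {y \<in> ball x (\<eta> j). k j < w y}) =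
          measure lebesgue (ball x (\<eta> j)) - measure lebesgue {y \<in> ball x (\<eta> j). k j < w y}"
        by (rule measurable_measure_Diff[OF lmeasurable_ball m1]) auto
      ultimately have "measure lebesgue {y \<in> ball x (\<eta> j). w y \<le> k j} = 
          measure lebesgue (ball x (\<eta> j)) - measure lebesgue {y \<in> ball x (\<eta> j). k j < w y}"
        by (simp only:)
      moreover have "measure lebesgue {y \<in> ball x (\<eta> j). k j < w y} \<le> Y j"
        unfolding Y_def using sub \<rho>[of j] m1 
        by (intro measure_mono_fmeasurable meas) (auto simp: superlevel_def)
      ultimately show "v * \<eta> j ^ n / 2 \<le> measure lebesgue {y \<in> ball x (\<eta> j). w y \<le> k j}"
        using Suc.IH vol[of "\<eta> j" x] \<eta>[of j] by simp
    qed (use \<rho>[of j] \<eta>[of j] gap v T in \<open>auto simp: power_add field_simps\<close>)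
    also have "measure lebesgue (ball (0::'a) (\<eta> j)) = v * \<eta> j ^ n"
      using \<eta>[of j] by (simp add: vol)
    also have "(1 * ?T * measure lebesgue ?E + C * (1 / ?s) ^ p * ?T * 1 powr (- \<beta>) * measure lebesgue (superlevel w (k j) z (\<rho> j)))
        \<le> ?T * ((1 + C) * (2 ^ (j + 3)) ^ p * Y j)"
    proof -
      have E: "measure lebesgue ?E \<le> Y j"
        unfolding Y_def using gap' \<rho>[of j] B
        by (intro measure_mono_fmeasurable meas level_sets_measurable[OF wm]) (auto simp: superlevel_def subset_iff)
      have "1 * Y j \<le> (2 ^ (j + 3)) ^ p * Y j"
        by (intro mult_right_mono one_le_power) (auto simp: Y_def)
      with E have "measure lebesgue ?E + C * (2 ^ (j + 3)) ^ p * Y j \<le> (1 + C) * (2 ^ (j + 3)) ^ p * Y j"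
        by (simp add: algebra_simps)
      from mult_left_mono[OF this, of ?T] show ?thesis using d R by (simp add: algebra_simps Y_def)
    qed
    finally have "(k (Suc j) - k j) * (v * \<eta> j ^ n / 2) * ?X \<le> 
        \<eta> j * (v * \<eta> j ^ n) * (?T * ((1 + C) * (2 ^ (j + 3)) ^ p * Y j))"
      using \<eta>[of j] v by (simp add: mult_left_mono)
    hence "(v * \<eta> j ^ n) * ((k (Suc j) - k j) / 2 * ?X) \<le> (v * \<eta> j ^ n) * (\<eta> j * (?T * ((1 + C) * (2 ^ (j + 3)) ^ p * Y j)))"
      by (simp add: mult_ac)
    hence "(k (Suc j) - k j) / 2 * ?X \<le> \<eta> j * (?T * ((1 + C) * (2 ^ (j + 3)) ^ p * Y j))"
      by (rule mult_left_le_imp_le) (use v \<eta>[of j] in simp)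
    also have "\<eta> j * (?T * ((1 + C) * (2 ^ (j + 3)) ^ p * Y j)) = d * (\<tau> * (2 * (1 + C) * 8 ^ p)) * ((2 ^ j) ^ p / b ^ j) * Y j"
      using R by (simp add: \<eta>_def power_add power_mult_distrib)
    also have "(2 ^ j) ^ p / b ^ j = 1 / 2 ^ j"
      by (simp add: b_def power_mult_distrib flip: power_mult) (simp add: mult.commute)
    also have "(k (Suc j) - k j) / 2 * ?X = d * (1 / 2 ^ j) * (?X / 8)" by (simp add: k_Suc power_add)
    finally have "(d * (1 / 2 ^ j)) * (?X / 8) \<le> (d * (1 / 2 ^ j)) * (\<tau> * (2 * (1 + C) * 8 ^ p) * Y j)"
      by (simp add: mult_ac)
    hence "?X / 8 \<le> \<tau> * (2 * (1 + C) * 8 ^ p) * Y j"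
      by (rule mult_left_le_imp_le) (use d in simp)
    hence "?X \<le> \<tau> * K * Y j" by (simp add: K_def algebra_simps)
    also have "\<tau> * K = 1 / b ^ n" using K16 by (simp add: \<tau>_eq)
    also have "1 / b ^ n * Y j \<le> 1 / b ^ n * (v * \<eta> j ^ n / 2)"
      using Suc.IH b by (intro mult_left_mono) auto
    also have "\<dots> = v * \<eta> (Suc j) ^ n / 2" by (simp add: \<eta>_def power_divide power_mult_distrib)
    finally have "?X \<le> v * \<eta> (Suc j) ^ n / 2" .
    moreover have "Y (Suc j) \<le> ?X" unfolding Y_def
    proof (rule measure_mono_fmeasurable)
      show "{x \<in> ball z (\<rho> (Suc j)). k (Suc j) \<le> w x} \<in> fmeasurable lebesgue"
        using \<rho>(2)[of "Suc j"] B by (intro subset_ball_fmeasurable[of _ z R] level_sets_measurable[OF wm]) auto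
      show "superlevel w (k (Suc j)) z (\<rho> (Suc j)) \<in> sets lebesgue"
        using meas[OF \<rho>(2)[of "Suc j"]] by auto
    qed (auto simp: superlevel_def)
    ultimately show ?case by linarith
  qed
  have Z: "superlevel w (\<mu> - d / 2) z (R / 2) \<in> fmeasurable lebesgue" using R by (intro meas) simp
  have "measure lebesgue (superlevel w (\<mu> - d / 2) z (R / 2)) \<le> v * \<eta> j ^ n / 2" for j
  proof -
    have "measure lebesgue (superlevel w (\<mu> - d / 2) z (R / 2)) \<le> Y j"
      unfolding Y_def using Z \<rho>[of j] k_le(2)[of j] 
      by (intro measure_mono_fmeasurable meas) (auto simp: superlevel_def)
    thus ?thesis using Y[of j] by simp
  qed
  moreover have "(\<lambda>j. v * \<eta> j ^ n / 2) \<longlonglongrightarrow> v * (\<tau> * R * 0) ^ n / 2"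
  proof -
    have "(\<lambda>j. (1 / b) ^ j) \<longlonglongrightarrow> 0" using b by (intro LIMSEQ_realpow_zero) auto
    hence "(\<lambda>j. v * (\<tau> * R * (1 / b) ^ j) ^ n / 2) \<longlonglongrightarrow> v * (\<tau> * R * 0) ^ n / 2"
      by (intro tendsto_divide tendsto_mult tendsto_power tendsto_const) simp_all
    thus ?thesis by (simp add: \<eta>_def power_divide)
  qed
  ultimately have "measure lebesgue (superlevel w (\<mu> - d / 2) z (R / 2)) \<le> v * (\<tau> * R * 0) ^ n / 2"
    by (intro LIMSEQ_le_const) auto
  hence "measure lebesgue (superlevel w (\<mu> - d / 2) z (R / 2)) = 0"
    using n by (simp add: zero_power measure_le_0_iff)
  hence "superlevel w (\<mu> - d / 2) z (R / 2) \<in> null_sets lebesgue"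
    using Z by (simp add: null_sets_def fmeasurable_def emeasure_eq_measure2[OF Z])
  from AE_not_in[OF this] show ?thesis by eventually_elim (auto simp: superlevel_def not_less)
qed

text \<open>De Giorgi's second lemma. In all the steps the same half of the ball stays below the level \<open>k s\<close>, and
  the sets \<open>E s\<close> between consecutive levels are disjoint. Adding up the \<open>N\<close> inequalities
  bounds \<open>N\<close> times the measure of the last superlevel set by the volume of one ball, except for the
  part due to large gradients, which is made small by choosing \<open>a\<close> large.\<close>

lemma level_decay_imp_density:
  fixes w :: "'a::euclidean_space \<Rightarrow> real"
  defines "v \<equiv> measure lebesgue (ball (0::'a) 1)" and "n \<equiv> DIM('a)"
  assumes LD: "level_decay w z (8 * r) \<mu> D T0 T1 C p \<beta>"
    and wm: "(\<lambda>x. indicator B x *\<^sub>R w x) \<in> borel_measurable lebesgue" and B: "ball z (8 * r) \<subseteq> B"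
    and r: "0 < r" and \<omega>: "0 < \<omega>" and s0: "1 \<le> s0" "\<omega> / 2 ^ s0 \<le> D" and N: "1 \<le> N"
    and T: "T0 \<le> \<omega> / 2 ^ (s0 + N) / (8 * r)" "\<omega> / (8 * r) \<le> T1" and C: "0 \<le> C" and a: "1 \<le> a"
    and half: "v * r ^ n / 2 \<le> measure lebesgue {x \<in> ball z r. w x \<le> \<mu> - \<omega> / 2}"
  shows "measure lebesgue {x \<in> ball z r. \<mu> - \<omega> / 2 ^ (s0 + N) \<le> w x} \<le>
    16 ^ n * (v * r ^ n) * (a / N + C * 2 ^ p * a powr (- \<beta>))"
proof -
  have v: "v > 0" unfolding v_def by (rule measure_lebesgue_unit_ball_pos)
  have ball_vol: "measure lebesgue (ball c s) = v * s ^ n" if "0 \<le> s" for c :: 'a and s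
    using measure_lebesgue_ball[OF that] by (simp add: v_def n_def)
  define k where "k = (\<lambda>s::nat. \<mu> - \<omega> / 2 ^ s)"
  define X where "X = (\<lambda>s. measure lebesgue {x \<in> ball z r. k s \<le> w x})"
  define E where "E = (\<lambda>s. {x \<in> ball z (3 * r). k s < w x \<and> w x < k (Suc s)})"
  have k_Suc: "k (Suc s) - k s = \<omega> / 2 ^ s / 2" for s by (simp add: k_def field_simps)
  have k_mono: "k s \<le> k t" if "s \<le> t" for s t
  proof -
    have "(2::real) ^ s \<le> 2 ^ t" using that by simp
    hence "\<omega> / 2 ^ t \<le> \<omega> / 2 ^ s" using \<omega> by (intro divide_left_mono) auto
    thus ?thesis by (simp add: k_def)
  qed
  have lev: "{x \<in> ball z t. c \<le> w x} \<in> fmeasurable lebesgue" if "t \<le> 8 * r" for t c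
    using that B r by (intro subset_ball_fmeasurable[of _ z t] level_sets_measurable[OF wm]) auto
  have Emeas: "E s \<in> fmeasurable lebesgue" for s
    unfolding E_def using B r by (intro subset_ball_fmeasurable[of _ z "3 * r"] level_sets_measurable[OF wm]) auto
  have X_anti: "X t \<le> X s" if "s \<le> t" for s t
    unfolding X_def using k_mono[OF that] lev[of r] r by (intro measure_mono_fmeasurable) auto
  have step: "X (Suc s) \<le> 2 ^ n * (a * measure lebesgue (E s) + C * 2 ^ p * a powr (- \<beta>) * (v * (8 * r) ^ n))"
    if s: "s0 \<le> s" "s < s0 + N" for s
  proof -
    let ?T = "\<omega> / 2 ^ s / (8 * r)"
    have "(k (Suc s) - k s) * (v * r ^ n / 2) * measure lebesgue {x \<in> ball z r. k (Suc s) \<le> w x} \<le> 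
      2 * r * measure lebesgue (ball (0::'a) (2 * r)) *
          (a * ?T * measure lebesgue {x \<in> ball z (r + 2 * r). k s < w x \<and> w x < k (Suc s)} + 
           C * (1 / (1/2)) ^ p * ?T * a powr (- \<beta>) * measure lebesgue (superlevel w (k s) z (8 * r)))"
    proof (rule level_decayD[OF LD])
      show "k s < k (Suc s)" using k_Suc[of s] \<omega> by (smt (verit) divide_pos_pos zero_less_power)
      show "\<mu> - D \<le> k s" using k_mono[OF s(1)] s0 by (simp add: k_def)
      show "\<mu> - k s \<le> ?T * (8 * r)" using r by (simp add: k_def)
      have "(2::real) ^ s \<le> 2 ^ (s0 + N)" using s by (intro power_increasing) auto
      hence "\<omega> / 2 ^ (s0 + N) \<le> \<omega> / 2 ^ s" using \<omega> by (intro divide_left_mono) auto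
      thus "T0 \<le> ?T" using T(1) r by (smt (verit) divide_right_mono)
      have "\<omega> / 2 ^ s \<le> \<omega> / 1" using \<omega> by (intro divide_left_mono) auto
      thus "?T \<le> T1" using T(2) r by (smt (verit) divide_right_mono div_by_1)
      fix x assume x: "x \<in> ball z r"
      have "ball z r \<subseteq> ball x (2 * r)"
        using x by (subst ball_subset_ball_iff) (auto simp: dist_commute)
      moreover have "ball x (2 * r) \<subseteq> B"
        using x B r by (intro order_trans[OF _ B]) (subst ball_subset_ball_iff, auto simp: dist_commute)
      moreover have "\<mu> - \<omega> / 2 \<le> k s" using k_mono[of 1 s] s s0 by (simp add: k_def)
      moreover have "{x \<in> ball z r. w x \<le> \<mu> - \<omega> / 2} \<in> sets lebesgue"
        using B r by (intro level_sets_measurable[OF wm]) auto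
      ultimately have "measure lebesgue {x \<in> ball z r. w x \<le> \<mu> - \<omega> / 2} \<le> measure lebesgue {y \<in> ball x (2 * r). w y \<le> k s}"
        by (intro measure_mono_fmeasurable subset_ball_fmeasurable[of _ x "2 * r"] level_sets_measurable[OF wm]) auto
      with half show "v * r ^ n / 2 \<le> measure lebesgue {y \<in> ball x (2 * r). w y \<le> k s}" by linarith
    qed (use r v a in auto)
    also have "\<dots> \<le> 2 * r * (v * (2 * r) ^ n) * (a * ?T * measure lebesgue (E s) + C * 2 ^ p * ?T * a powr (- \<beta>) * (v * (8 * r) ^ n))"
    proof -
      have "measure lebesgue (superlevel w (k s) z (8 * r)) \<le> measure lebesgue (ball z (8 * r))"
        using B by (intro measure_mono_fmeasurable superlevel_measurable[OF wm] lmeasurable_ball) (auto simp: superlevel_def)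
      hence "measure lebesgue (superlevel w (k s) z (8 * r)) \<le> v * (8 * r) ^ n" using r ball_vol by simp
      hence "C * 2 ^ p * ?T * a powr (- \<beta>) * measure lebesgue (superlevel w (k s) z (8 * r)) \<le>
          C * 2 ^ p * ?T * a powr (- \<beta>) * (v * (8 * r) ^ n)"
        using C \<omega> r by (intro mult_left_mono) auto
      hence "2 * r * (v * (2 * r) ^ n) * (a * ?T * measure lebesgue (E s) +
            C * 2 ^ p * ?T * a powr (- \<beta>) * measure lebesgue (superlevel w (k s) z (8 * r))) \<le>
          2 * r * (v * (2 * r) ^ n) * (a * ?T * measure lebesgue (E s) + C * 2 ^ p * ?T * a powr (- \<beta>) * (v * (8 * r) ^ n))"
        using r v by (intro mult_left_mono[OF add_left_mono]) auto
      thus ?thesis using r by (simp add: E_def ball_vol)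
    qed
    also have "\<dots> = (\<omega> / 2 ^ s / 2 * (v * r ^ n / 2)) * 
        (2 ^ n * (a * measure lebesgue (E s) + C * 2 ^ p * a powr (- \<beta>) * (v * (8 * r) ^ n)))"
      using r by (simp add: power_mult_distrib field_simps)
    finally have "(\<omega> / 2 ^ s / 2 * (v * r ^ n / 2)) * X (Suc s) \<le> (\<omega> / 2 ^ s / 2 * (v * r ^ n / 2)) * 
        (2 ^ n * (a * measure lebesgue (E s) + C * 2 ^ p * a powr (- \<beta>) * (v * (8 * r) ^ n)))"
      by (simp add: k_Suc X_def)
    thus ?thesis by (rule mult_left_le_imp_le) (use \<omega> v r in simp)
  qed
  have "N * X (s0 + N) = (\<Sum>s\<in>{s0..<s0 + N}. X (s0 + N))" by simp
  also have "\<dots> \<le> (\<Sum>s\<in>{s0..<s0 + N}. 2 ^ n * (a * measure lebesgue (E s) + C * 2 ^ p * a powr (- \<beta>) * (v * (8 * r) ^ n)))"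
    using step X_anti by (intro sum_mono order_trans[OF X_anti step]) auto
  also have "\<dots> = 2 ^ n * (a * (\<Sum>s\<in>{s0..<s0 + N}. measure lebesgue (E s)) + N * (C * 2 ^ p * a powr (- \<beta>) * (v * (8 * r) ^ n)))"
    by (simp add: sum.distrib sum_distrib_left algebra_simps)
  also have "(\<Sum>s\<in>{s0..<s0 + N}. measure lebesgue (E s)) = measure lebesgue (\<Union>s\<in>{s0..<s0 + N}. E s)"
  proof (rule measure_UNION'[symmetric])
    have "E s \<inter> E t = {}" if "s < t" for s t
      using k_mono[of "Suc s" t] that by (force simp: E_def)
    thus "pairwise (\<lambda>s t. disjnt (E s) (E t)) {s0..<s0 + N}"
      unfolding pairwise_def disjnt_def by (metis inf_commute linorder_neqE_nat)
  qed (use Emeas in auto)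
  also have "\<dots> \<le> measure lebesgue (ball z (8 * r))"
    using Emeas r by (intro measure_mono_fmeasurable lmeasurable_ball sets.finite_UN) (auto simp: E_def)
  also have "\<dots> = v * (8 * r) ^ n" using r ball_vol by simp
  finally have "N * X (s0 + N) \<le> 2 ^ n * (a * (v * (8 * r) ^ n) + N * (C * 2 ^ p * a powr (- \<beta>) * (v * (8 * r) ^ n)))"
    using a by (simp add: mult_left_mono)
  also have "\<dots> = N * ((2 * 8) ^ n * (v * r ^ n) * (a / N + C * 2 ^ p * a powr (- \<beta>)))"
    unfolding power_mult_distrib using N by (simp add: field_simps)
  finally have "X (s0 + N) \<le> (2 * 8) ^ n * (v * r ^ n) * (a / N + C * 2 ^ p * a powr (- \<beta>))"
    by (rule mult_left_le_imp_le) (use N in simp)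
  thus ?thesis by (simp add: X_def k_def)
qed

lemma level_decay_smaller_radius:
  assumes "level_decay w z R \<mu> D T0 T1 C p \<beta>" "R' \<le> R"
  shows "level_decay w z R' \<mu> D T0 T1 C p \<beta>"
  unfolding level_decay_def
  by (intro allI impI, elim conjE, rule level_decayD[OF assms(1)]) (use assms(2) in auto)

text \<open>First \<open>a\<close> and then \<open>N\<close> are chosen so large that the second lemma provides the smallness
  that the first one requires. The number \<open>S\<close> depends only on \<open>C\<close>, \<open>\<beta>\<close>, \<open>p\<close>, \<open>s0\<close> and the
  dimension, and this is why the Hoelder exponent does not depend on \<open>M\<close> and \<open>\<gamma>1\<close>: these occur
  only in \<open>D\<close>, \<open>T0\<close> and \<open>T1\<close>.\<close>

lemma level_decay_imp_sup_reduction: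
  assumes C: "0 \<le> C" and \<beta>: "0 < \<beta>" and s0: "1 \<le> s0"
  obtains S where
    "\<And>w (z::'a::euclidean_space) r \<mu> D T0 T1 \<omega> B. 
      \<lbrakk>level_decay w z (8 * r) \<mu> D T0 T1 C p \<beta>; (\<lambda>x. indicator B x *\<^sub>R w x) \<in> borel_measurable lebesgue;
       ball z (8 * r) \<subseteq> B; 0 < r; 0 < \<omega>; \<omega> / 2 ^ s0 \<le> D; T0 \<le> \<omega> / 2 ^ S / (8 * r); 2 * \<omega> / r \<le> T1;
       measure lebesgue (ball z r) / 2 \<le> measure lebesgue {x \<in> ball z r. w x \<le> \<mu> - \<omega> / 2}\<rbrakk>
      \<Longrightarrow> AE x in lebesgue. x \<in> ball z (r / 2) \<longrightarrow> w x \<le> \<mu> - \<omega> / 2 ^ (S + 1)"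
proof -
  define n where "n = DIM('a)"
  define v where "v = measure lebesgue (ball (0::'a) 1)"
  have v: "v > 0" unfolding v_def by (rule measure_lebesgue_unit_ball_pos)
  define \<tau> where "\<tau> = 1 / (16 * 8 ^ p * (1 + C) * (2 ^ (p + 1)) ^ DIM('a))"
  define \<theta> where "\<theta> = \<tau> ^ n / 2"
  have "0 < \<tau>" using C by (simp add: \<tau>_def)
  hence \<theta>: "0 < \<theta>" by (simp add: \<theta>_def)
  have "((\<lambda>a. 16 ^ n * (C * 2 ^ p * a powr (- \<beta>))) \<longlongrightarrow> 16 ^ n * (C * 2 ^ p * 0)) at_top"
    using \<beta> by (intro tendsto_intros tendsto_neg_powr filterlim_ident) auto
  hence "\<forall>\<^sub>F a in at_top. 16 ^ n * (C * 2 ^ p * a powr (- \<beta>)) < \<theta> / 2"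
    by (rule order_tendstoD) (use \<theta> in simp)
  then obtain a where a: "1 \<le> a" "16 ^ n * (C * 2 ^ p * a powr (- \<beta>)) < \<theta> / 2"
    using eventually_happens[OF eventually_conj[OF eventually_ge_at_top[of 1]]]
    by (metis (no_types, lifting) trivial_limit_at_top_linorder)
  obtain N :: nat where N: "16 ^ n * a / (\<theta> / 2) < N" using reals_Archimedean2 by blast
  have "0 < 16 ^ n * a / (\<theta> / 2)" using a \<theta> by simp
  hence N1: "1 \<le> N" using N by (cases N) auto
  have Na: "16 ^ n * (a / N) < \<theta> / 2" using N N1 \<theta> by (simp add: field_simps)
  show ?thesis
  proof (rule that[of "s0 + N"])
    fix w and z :: 'a and r \<mu> D T0 T1 \<omega> B
    assume LD: "level_decay w z (8 * r) \<mu> D T0 T1 C p \<beta>"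
      and wm: "(\<lambda>x. indicator B x *\<^sub>R w x) \<in> borel_measurable lebesgue"
      and B: "ball z (8 * r) \<subseteq> B" and r: "0 < r" and \<omega>: "0 < \<omega>" "\<omega> / 2 ^ s0 \<le> D" 
      and T: "T0 \<le> \<omega> / 2 ^ (s0 + N) / (8 * r)" "2 * \<omega> / r \<le> T1"
      and half: "measure lebesgue (ball z r) / 2 \<le> measure lebesgue {x \<in> ball z r. w x \<le> \<mu> - \<omega> / 2}"
    define d where "d = \<omega> / 2 ^ (s0 + N)"
    have d: "0 < d" "d \<le> \<omega>" "d \<le> \<omega> / 2 ^ s0"
    proof -
      have "(2::real) ^ s0 \<le> 2 ^ (s0 + N)" "(1::real) \<le> 2 ^ (s0 + N)"
        by (simp add: power_add, rule one_le_power, simp)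
      thus "d \<le> \<omega> / 2 ^ s0" "d \<le> \<omega>" unfolding d_def using \<omega> 
        using divide_left_mono[of "2 ^ s0" "2 ^ (s0 + N)" \<omega>] divide_left_mono[of 1 "2 ^ (s0 + N)" \<omega>] by simp_all
    qed (use \<omega> in \<open>simp add: d_def\<close>)
    have vol: "measure lebesgue (ball z r) = v * r ^ n"
      unfolding v_def n_def by (rule measure_lebesgue_ball) (use r in simp)
    have "\<omega> / (8 * r) \<le> 2 * \<omega> / r" using \<omega> r by (simp add: field_simps)
    hence "measure lebesgue {x \<in> ball z r. \<mu> - d \<le> w x} \<le> 
        16 ^ n * (v * r ^ n) * (a / N + C * 2 ^ p * a powr (- \<beta>))"
      unfolding d_def v_def n_def using half[unfolded vol v_def n_def] r a N1 s0 \<omega> T C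
      by (intro level_decay_imp_density[OF LD wm B]) simp_all
    also have "\<dots> = (v * r ^ n) * (16 ^ n * (a / N) + 16 ^ n * (C * 2 ^ p * a powr (- \<beta>)))"
      by (simp add: algebra_simps)
    also have "\<dots> \<le> (v * r ^ n) * \<theta>"
    proof (rule mult_left_mono)
      show "16 ^ n * (a / N) + 16 ^ n * (C * 2 ^ p * a powr (- \<beta>)) \<le> \<theta>" using a(2) Na by linarith
    qed (use v r in simp)
    finally have "measure lebesgue {x \<in> ball z r. \<mu> - d \<le> w x} \<le> v * (\<tau> * r) ^ n / 2"
      by (simp add: \<theta>_def power_mult_distrib mult_ac)
    moreover have "measure lebesgue (superlevel w (\<mu> - d) z r) \<le> measure lebesgue {x \<in> ball z r. \<mu> - d \<le> w x}"
      using B r by (intro measure_mono_fmeasurable subset_ball_fmeasurable[of _ z r] superlevel_measurable[OF wm]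
          level_sets_measurable[OF wm]) (auto simp: superlevel_def)
    ultimately have small: "measure lebesgue (superlevel w (\<mu> - d) z r) \<le> v * (\<tau> * r) ^ n / 2" by linarith
    have LD': "level_decay w z r \<mu> D T0 T1 C p \<beta>"
      using level_decay_smaller_radius[OF LD] r by simp
    have "AE x in lebesgue. x \<in> ball z (r / 2) \<longrightarrow> w x \<le> \<mu> - d / 2"
    proof (rule level_decay_imp_bound[OF LD' wm _ _ _ _ _ _ _ \<tau>_def])
      show "ball z r \<subseteq> B" using B r by auto
      have "d / (8 * r) \<le> 2 * d / r" using d r by (simp add: field_simps)
      thus "T0 \<le> 2 * d / r" using T(1) unfolding d_def by linarith
      have "2 * d / r \<le> 2 * \<omega> / r" using d r by (intro divide_right_mono) auto
      thus "2 * d / r \<le> T1" using T(2) by linarith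
    qed (use r d \<omega> C small in \<open>auto simp: v_def n_def\<close>)
    thus "AE x in lebesgue. x \<in> ball z (r / 2) \<longrightarrow> w x \<le> \<mu> - \<omega> / 2 ^ (s0 + N + 1)"
      by (simp add: d_def mult.commute)
  qed
qed

section \<open>De Giorgi classes have the level decay property\<close>

text \<open>The isoperimetric inequality takes place in \<open>ball z (r + \<eta>)\<close>, which lies in the inner ball of the
  Caccioppoli inequality.\<close>

lemma caccioppoli_imp_level_decay:
  fixes w :: "'a::euclidean_space \<Rightarrow> real"
  assumes wV: "has_weak_gradient \<Omega> w V" and sub: "cball z R \<subseteq> \<Omega>"
    and cacc: "\<And>\<rho> \<sigma> k. \<lbrakk>0 < \<rho>; \<rho> \<le> R; 0 < \<sigma>; \<sigma> < 1; \<mu> - D \<le> k\<rbrakk> \<Longrightarrow>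
      (\<integral>\<^sup>+x\<in>superlevel w k z (\<rho> - \<sigma> * \<rho>). ennreal (G x (norm (V x))) \<partial>lebesgue)
           \<le> ennreal \<gamma> * (\<integral>\<^sup>+x\<in>superlevel w k z \<rho>. ennreal (G x \<bar>(w x - k) / (\<sigma> * \<rho>)\<bar>) \<partial>lebesgue)
             + ennreal \<gamma>1 * emeasure lebesgue (superlevel w k z \<rho>)"
    and bd: "AE x in lebesgue. x \<in> ball z R \<longrightarrow> w x \<le> \<mu>"
    and G: "\<And>T. T0 \<le> T \<Longrightarrow> T \<le> T1 \<Longrightarrow> \<exists>P>0. \<gamma>1 \<le> P \<and> (AE x in lebesgue. x \<in> ball z R \<longrightarrow> 
      N_function_at (G x) (g x) gm gp \<and> P \<le> C0 * G x T \<and> G x T \<le> C0 * P)"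
    and "1 \<le> gm" "gp \<le> real p" "0 < T0" "0 < C0" "0 < \<gamma>" "0 \<le> \<gamma>1"
  shows "level_decay w z R \<mu> D T0 T1 (C0 * (\<gamma> * C0 + 1)) p (gm - 1)"
  unfolding level_decay_def
proof (intro allI impI, elim conjE)
  fix \<rho> r \<eta> \<sigma> k l T a m :: real
  assume h: "\<rho> \<le> R" "0 < r" "0 < \<eta>" "0 < \<sigma>" "\<sigma> < 1" "r + \<eta> \<le> \<rho> - \<sigma> * \<rho>" "0 \<le> m" "k < l" "\<mu> - D \<le> k" 
      "\<mu> - k \<le> T * \<rho>" "T0 \<le> T" "T \<le> T1" "1 \<le> a"
    and m: "\<forall>x\<in>ball z r. m \<le> measure lebesgue {y \<in> ball x \<eta>. w y \<le> k}"
  define E where "E = {x \<in> ball z (r + \<eta>). k < w x \<and> w x < l}"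
  let ?A = "superlevel w k z \<rho>" and ?X = "{x \<in> ball z r. l \<le> w x}"
  define C where "C = C0 * (\<gamma> * C0 + 1) * (1 / \<sigma>) ^ p * T * a powr (1 - gm)"
  have "0 < (1 - \<sigma>) * \<rho>" using h by (simp add: left_diff_distrib)
  hence \<rho>: "0 < \<rho>" using h by (simp add: zero_less_mult_iff)
  have le: "r + \<eta> \<le> \<rho>" using h \<rho> by (smt (verit) mult_pos_pos)
  have T: "0 < T" using h assms by simp
  have C: "0 \<le> C" using assms T h by (simp add: C_def)
  obtain P where P: "P > 0" "\<gamma>1 \<le> P" "AE x in lebesgue. x \<in> ball z R \<longrightarrow> 
      N_function_at (G x) (g x) gm gp \<and> P \<le> C0 * G x T \<and> G x T \<le> C0 * P"
    using G h by blast
  have w: "(\<lambda>x. indicator (cball z R) x *\<^sub>R w x) \<in> borel_measurable lebesgue"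
   and V: "(\<lambda>x. indicator (cball z R) x *\<^sub>R V x) \<in> borel_measurable lebesgue"
    using wV sub unfolding has_weak_gradient_def 
    by (blast intro: borel_measurable_integrable locally_integrable_on_cball_measurable)+
  have fin: "emeasure lebesgue S = ennreal (measure lebesgue S)" 
    if "S \<subseteq> ball y s" "S \<in> sets lebesgue" for S and y :: 'a and s
    using subset_ball_fmeasurable[OF that] by (rule emeasure_eq_measure2)
  have bR: "ball z t \<subseteq> cball z R" if "t \<le> R" for t using that by auto
  have E: "E \<in> sets lebesgue" unfolding E_def using h le bR by (intro level_sets_measurable[OF w]) auto
  have A: "?A \<in> sets lebesgue" using h bR by (intro superlevel_measurable[OF w]) auto
  have X: "?X \<in> sets lebesgue" using h le bR by (intro level_sets_measurable[OF w]) auto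
  have ball\<rho>: "ball z \<rho> \<subseteq> ball z R" using h by auto
  have "ennreal (l - k) * ennreal m * emeasure lebesgue ?X \<le>
    ennreal \<eta> * emeasure lebesgue (ball (0::'a) \<eta>) * (\<integral>\<^sup>+x\<in>E. norm (V x) \<partial>lebesgue)"
    unfolding E_def
  proof (rule isoperimetric[OF wV])
    show "cball z (r + \<eta>) \<subseteq> \<Omega>" using sub le h by (intro order_trans[OF _ sub]) auto
    fix x assume x: "x \<in> ball z r"
    have "ball x \<eta> \<subseteq> ball z (r + \<eta>)" using x by (subst ball_subset_ball_iff) (auto simp: dist_commute)
    also have "\<dots> \<subseteq> cball z R" using le h by (intro bR) auto
    finally have "{y \<in> ball x \<eta>. w y \<le> k} \<in> sets lebesgue" by (intro level_sets_measurable[OF w]) auto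
    hence "emeasure lebesgue {y \<in> ball x \<eta>. w y \<le> k} = ennreal (measure lebesgue {y \<in> ball x \<eta>. w y \<le> k})"
      by (intro fin[of _ x \<eta>]) auto
    thus "ennreal m \<le> emeasure lebesgue {y \<in> ball x \<eta>. w y \<le> k}"
      using m x by (simp only:) (intro ennreal_leI, blast)
  qed (use h in auto)
  also have "(\<integral>\<^sup>+x\<in>E. norm (V x) \<partial>lebesgue) \<le> 
      ennreal (a * T) * emeasure lebesgue E + ennreal C * emeasure lebesgue ?A"
    unfolding C_def
  proof (rule gradient_L1_estimate[OF w V _ \<rho> _ _ cacc])
    show "AE x in lebesgue. x \<in> ball z \<rho> \<longrightarrow> w x \<le> \<mu>"
      using bd by eventually_elim (use ball\<rho> in auto)
    show "AE x in lebesgue. x \<in> ball z \<rho> \<longrightarrow> N_function_at (G x) (g x) gm gp \<and> P \<le> C0 * G x T \<and> G x T \<le> C0 * P"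
      using P(3) by eventually_elim (use ball\<rho> in auto)
    show "E \<subseteq> superlevel w k z (\<rho> - \<sigma> * \<rho>)" using h by (auto simp: E_def superlevel_def)
  qed (use h assms P E T \<rho> bR in auto)
  also have "emeasure lebesgue E = ennreal (measure lebesgue E)"
    by (rule fin[OF _ E, of z "r + \<eta>"]) (auto simp: E_def)
  also have "emeasure lebesgue ?A = ennreal (measure lebesgue ?A)"
    by (rule fin[OF _ A, of z \<rho>]) (auto simp: superlevel_def)
  also have "emeasure lebesgue ?X = ennreal (measure lebesgue ?X)"
    by (rule fin[OF _ X, of z r]) auto
  also have "emeasure lebesgue (ball (0::'a) \<eta>) = ennreal (measure lebesgue (ball (0::'a) \<eta>))"
    by (rule fin[of _ 0 \<eta>]) auto
  also have "ennreal \<eta> * ennreal (measure lebesgue (ball (0::'a) \<eta>)) * 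
      (ennreal (a * T) * ennreal (measure lebesgue E) + ennreal C * ennreal (measure lebesgue ?A)) = 
      ennreal (\<eta> * measure lebesgue (ball (0::'a) \<eta>) * (a * T * measure lebesgue E + C * measure lebesgue ?A))"
    using h T C by (simp add: ennreal_mult ennreal_plus)
  also have "ennreal (l - k) * ennreal m * ennreal (measure lebesgue ?X) = ennreal ((l - k) * m * measure lebesgue ?X)"
    using h by (simp add: ennreal_mult)
  finally have *: "ennreal ((l - k) * m * measure lebesgue ?X) \<le> 
      ennreal (\<eta> * measure lebesgue (ball (0::'a) \<eta>) * (a * T * measure lebesgue E + C * measure lebesgue ?A))"
    by (simp only: mult_left_mono zero_le)
  have "0 \<le> \<eta> * measure lebesgue (ball (0::'a) \<eta>) * (a * T * measure lebesgue E + C * measure lebesgue ?A)"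
    by (intro mult_nonneg_nonneg add_nonneg_nonneg) (use h T C in auto)
  from * this have "(l - k) * m * measure lebesgue ?X \<le> 
      \<eta> * measure lebesgue (ball (0::'a) \<eta>) * (a * T * measure lebesgue E + C * measure lebesgue ?A)"
    by (simp only: ennreal_le_iff)
  thus "(l - k) * m * measure lebesgue ?X \<le> \<eta> * measure lebesgue (ball (0::'a) \<eta>) *
          (a * T * measure lebesgue {x \<in> ball z (r + \<eta>). k < w x \<and> w x < l} +
           C0 * (\<gamma> * C0 + 1) * (1 / \<sigma>) ^ p * T * a powr (- (gm - 1)) * measure lebesgue ?A)"
    by (simp add: E_def C_def)
qed

lemma AE_imp_ex_in_open:
  fixes S :: "'a::euclidean_space set"
  assumes "AE x in lebesgue. Q x" "open S" "S \<noteq> {}"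
  shows "\<exists>x\<in>S. Q x"
proof (rule ccontr)
  assume "\<not> ?thesis"
  with assms(1) have "AE x in lebesgue. x \<notin> S" by (auto elim!: eventually_mono)
  hence "S \<in> null_sets lebesgue" using assms(2) by (subst AE_iff_null_sets) auto
  thus False using open_not_negligible[OF assms(2,3)] by (simp add: negligible_iff_null_sets)
qed

lemma AE_N_function_at:
  assumes "generalized_N_function G" "odd_right_derivative G g" "growth_bounds G g gm gp"
  shows "AE x in lebesgue. N_function_at (G x) (g x) gm gp"
proof -
  have "AE x in lebesgue. continuous_on UNIV (G x) \<and> strict_mono_on {0..} (G x) \<and> G x 0 = 0 \<and> (\<forall>t>0. G x t > 0)"
    using assms(1) unfolding generalized_N_function_def by (auto elim!: eventually_mono)
  moreover have "AE x in lebesgue. \<forall>t\<ge>0. (G x has_real_derivative g x t) (at_right t)"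
    using assms(2) unfolding odd_right_derivative_def by (auto elim!: eventually_mono)
  ultimately show ?thesis
    by eventually_elim (use assms(3) in \<open>auto simp: N_function_at_def growth_bounds_def growth_ratio_def\<close>)
qed

text \<open>One value \<open>P = G y T\<close> at a generic point \<open>y\<close> of the ball serves for all others. Since \<open>T\<close> is at
  most \<open>(2 R)\<close> to the power \<open>-3\<close>, the drift \<open>T powr (L0 / \<bar>ln (2 * R)\<bar>)\<close> is at most
  \<open>exp (3 * L0)\<close>; the exponent 3 leaves room for slopes of order \<open>M / R\<close> with any \<open>M\<close>.\<close>

lemma comparable_on_ball:
  fixes z :: "'a::euclidean_space"
  assumes G: "generalized_N_function G" "odd_right_derivative G g" "growth_bounds G g gm gp" "normalized_at_one G F"
    and logH: "\<And>t x y. t > 1 \<Longrightarrow> x \<in> ball z R \<Longrightarrow> y \<in> ball z R \<Longrightarrow> 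
      \<bar>growth_ratio G g x t - growth_ratio G g y t\<bar> \<le> L0 / \<bar>ln (2 * R)\<bar>"
    and R: "0 < R" "R < 1 / 2" and "0 < L0" "1 \<le> F" "1 \<le> gm" and T: "1 \<le> T" "T \<le> 1 / (2 * R) ^ 3"
  shows "\<exists>P>0. T / F \<le> P \<and> (AE x in lebesgue. x \<in> ball z R \<longrightarrow> 
    N_function_at (G x) (g x) gm gp \<and> P \<le> F\<^sup>2 * exp L0 ^ 3 * G x T \<and> G x T \<le> F\<^sup>2 * exp L0 ^ 3 * P)"
proof -
  have ae: "AE x in lebesgue. N_function_at (G x) (g x) gm gp \<and> 1 / F \<le> G x 1 \<and> G x 1 \<le> F"
    using AE_N_function_at[OF G(1-3)] G(4) unfolding normalized_at_one_def by eventually_elim auto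
  then obtain y where y: "y \<in> ball z R" "N_function_at (G y) (g y) gm gp" "1 / F \<le> G y 1" "G y 1 \<le> F"
    using AE_imp_ex_in_open[OF ae, of "ball z R"] R by auto
  define c where "c = L0 / \<bar>ln (2 * R)\<bar>"
  have ln: "ln (2 * R) < 0" using R by simp
  have Tc: "T powr c \<le> exp L0 ^ 3"
  proof -
    have ln3: "ln (1 / q ^ 3) = 3 * \<bar>ln q\<bar>" if "0 < q" "ln q < 0" for q :: real
      using that by (simp add: ln_div ln_realpow)
    have "ln T \<le> ln (1 / (2 * R) ^ 3)" using T R by (subst ln_le_cancel_iff) auto
    also have "\<dots> = 3 * \<bar>ln (2 * R)\<bar>" by (rule ln3) (use R ln in auto)
    finally have "c * ln T \<le> c * (3 * \<bar>ln (2 * R)\<bar>)"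
      using \<open>0 < L0\<close> by (intro mult_left_mono) (auto simp: c_def)
    also have "\<dots> = 3 * L0" using ln by (simp add: c_def)
    finally have "exp (c * ln T) \<le> exp (3 * L0)" by simp
    also have "exp (3 * L0) = exp L0 ^ 3" using exp_of_nat_mult[of 3 L0] by simp
    finally show ?thesis using T by (simp add: powr_def)
  qed
  have comp: "G x1 T \<le> F\<^sup>2 * exp L0 ^ 3 * G x2 T" 
    if x1: "x1 \<in> ball z R" "N_function_at (G x1) (g x1) gm gp" "1 / F \<le> G x1 1" "G x1 1 \<le> F"
    and x2: "x2 \<in> ball z R" "N_function_at (G x2) (g x2) gm gp" "1 / F \<le> G x2 1" "G x2 1 \<le> F" for x1 x2
  proof -
    have pos: "0 < G x1 T" "0 < G x2 T" using x1 x2 T by (auto simp: N_function_at_def)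
    have "G x1 T * G x2 1 \<le> G x1 1 * T powr c * G x2 T"
    proof (rule N_function_at_comparison[OF x1(2) x2(2)])
      fix s :: real assume "1 < s"
      thus "s * g x1 s / G x1 s - s * g x2 s / G x2 s \<le> c"
        using logH[of s x1 x2] x1 x2 by (simp add: c_def growth_ratio_def)
    qed (rule T)
    also have "\<dots> \<le> F * exp L0 ^ 3 * G x2 T"
      using x1 pos Tc \<open>1 \<le> F\<close> by (intro mult_mono) (auto simp: N_function_at_def)
    finally have 1: "G x1 T * G x2 1 \<le> F * exp L0 ^ 3 * G x2 T" .
    have "G x1 T * (1 / F) \<le> G x1 T * G x2 1" using x2 pos by (intro mult_left_mono) auto
    hence "G x1 T * (1 / F) * F \<le> F * exp L0 ^ 3 * G x2 T * F" using 1 \<open>1 \<le> F\<close> 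
      by (intro mult_right_mono) auto
    thus ?thesis using \<open>1 \<le> F\<close> by (simp add: power2_eq_square mult_ac)
  qed
  show ?thesis
  proof (intro exI[of _ "G y T"] conjI)
    show "0 < G y T" using y T by (auto simp: N_function_at_def)
    have "T powr 1 * (1 / F) \<le> T powr gm * G y 1"
      using T y \<open>1 \<le> gm\<close> \<open>1 \<le> F\<close> by (intro mult_mono powr_mono) auto
    also have "\<dots> \<le> G y T" using N_function_at_lower_growth[OF y(2), of 1 T] T by simp
    finally show "T / F \<le> G y T" using T by simp
    show "AE x in lebesgue. x \<in> ball z R \<longrightarrow> 
      N_function_at (G x) (g x) gm gp \<and> G y T \<le> F\<^sup>2 * exp L0 ^ 3 * G x T \<and> G x T \<le> F\<^sup>2 * exp L0 ^ 3 * G y T"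
      using ae by eventually_elim (use comp y in blast)
  qed
qed

lemma locally_integrable_on_minus:
  "locally_integrable_on f \<Omega> \<Longrightarrow> locally_integrable_on (\<lambda>x. - f x) \<Omega>"
  unfolding locally_integrable_on_def set_integrable_def by simp

text \<open>The gradient of \<open>- u\<close> is chosen independently of that of \<open>u\<close>, so its existence has to be derived.\<close>

lemma de_giorgi_class_weak_gradient:
  assumes u: "u \<in> de_giorgi_class G \<Omega> M \<gamma> \<gamma>1 \<delta>" and w: "w \<in> {u, \<lambda>x. - u x}"
  shows "has_weak_gradient \<Omega> w (weak_gradient \<Omega> w)"
proof -
  obtain V where V: "has_weak_gradient \<Omega> u V"
    using u by (auto simp: de_giorgi_class_def musielak_orlicz_sobolev_def)
  have "has_weak_gradient \<Omega> (\<lambda>x. - u x) (\<lambda>x. - V x)"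
    using V locally_integrable_on_minus[of u \<Omega>] locally_integrable_on_minus[of V \<Omega>]
    unfolding has_weak_gradient_def by (auto simp: set_lebesgue_integral_def)
  with V w have "\<exists>V. has_weak_gradient \<Omega> w V" by auto
  thus ?thesis unfolding weak_gradient_def by (rule someI_ex)
qed

lemma de_giorgi_class_caccioppoli:
  assumes u: "u \<in> de_giorgi_class G \<Omega> M \<gamma> \<gamma>1 \<delta>" and w: "w \<in> {u, \<lambda>x. - u x}"
    and sub: "cball z \<rho> \<subseteq> \<Omega>" and \<rho>: "0 < \<rho>" and \<sigma>: "0 < \<sigma>" "\<sigma> < 1"
    and bd: "AE x in lebesgue. x \<in> ball z \<rho> \<longrightarrow> w x \<le> \<mu>" and k: "\<mu> - \<delta> * M \<le> k"
  shows "(\<integral>\<^sup>+x\<in>superlevel w k z (\<rho> - \<sigma> * \<rho>). ennreal (G x (norm (weak_gradient \<Omega> w x))) \<partial>lebesgue)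
           \<le> ennreal \<gamma> * (\<integral>\<^sup>+x\<in>superlevel w k z \<rho>. ennreal (G x \<bar>(w x - k) / (\<sigma> * \<rho>)\<bar>) \<partial>lebesgue)
             + ennreal \<gamma>1 * emeasure lebesgue (superlevel w k z \<rho>)"
proof -
  have m: "(\<lambda>x. indicator (cball z \<rho>) x *\<^sub>R w x) \<in> borel_measurable lebesgue"
    using de_giorgi_class_weak_gradient[OF u w] sub unfolding has_weak_gradient_def 
    by (blast intro: borel_measurable_integrable locally_integrable_on_cball_measurable)
  have "(\<lambda>x. indicator (cball z \<rho>) x *\<^sub>R w x) \<in> borel_measurable (lebesgue_on (ball z \<rho>))"
    using m by (rule measurable_restrict_space1)
  moreover have "indicator (cball z \<rho>) x *\<^sub>R w x = w x" if "x \<in> space (lebesgue_on (ball z \<rho>))" for x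
    using that by (auto simp: indicator_def)
  ultimately have wm: "w \<in> borel_measurable (lebesgue_on (ball z \<rho>))"
    using measurable_cong by (metis (no_types, lifting))
  have "ess_max (ball z \<rho>) w \<le> ereal \<mu>"
    unfolding ess_max_def
  proof (rule esssup_I)
    show "(\<lambda>x. ereal (w x)) \<in> borel_measurable (lebesgue_on (ball z \<rho>))" using wm by simp
    show "AE x in lebesgue_on (ball z \<rho>). ereal (w x) \<le> ereal \<mu>"
      using bd by (subst AE_restrict_space_iff) auto
  qed
  hence "ess_max (ball z \<rho>) w - ereal (\<delta> * M) \<le> ereal \<mu> - ereal (\<delta> * M)"
    by (intro ereal_minus_mono) auto
  also have "\<dots> \<le> ereal k" using k by simp
  finally have "ess_max (ball z \<rho>) w - ereal (\<delta> * M) \<le> ereal k" .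
  moreover have "ball z \<rho> \<subseteq> \<Omega>" using sub by auto
  ultimately show ?thesis using u w \<rho> \<sigma> unfolding de_giorgi_class_def by blast
qed

lemma de_giorgi_class_bounded:
  assumes u: "u \<in> de_giorgi_class G \<Omega> M \<gamma> \<gamma>1 \<delta>" and "open \<Omega>"
  shows "AE x in lebesgue. x \<in> \<Omega> \<longrightarrow> \<bar>u x\<bar> \<le> M"
proof -
  have "AE x in lebesgue_on \<Omega>. ereal \<bar>u x\<bar> \<le> esssup (lebesgue_on \<Omega>) (\<lambda>x. ereal \<bar>u x\<bar>)"
    by (rule esssup_AE)
  moreover have "esssup (lebesgue_on \<Omega>) (\<lambda>x. ereal \<bar>u x\<bar>) \<le> ereal M"
    using u by (simp add: de_giorgi_class_def ess_max_def)
  ultimately have "AE x in lebesgue_on \<Omega>. \<bar>u x\<bar> \<le> M"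
    by (auto elim!: eventually_mono dest: order_trans)
  thus ?thesis using assms(2) by (subst (asm) AE_restrict_space_iff) auto
qed

text \<open>The lower bound for \<open>T\<close> makes \<open>P\<close> at least \<open>T / F \<ge> \<gamma>1\<close>, whereby the inhomogeneous term of the
  Caccioppoli inequality is absorbed.\<close>

lemma de_giorgi_class_level_decay:
  fixes G :: "'a::euclidean_space \<Rightarrow> real \<Rightarrow> real"
  assumes u: "u \<in> de_giorgi_class G \<Omega> M \<gamma> \<gamma>1 \<delta>" and w: "w \<in> {u, \<lambda>x. - u x}"
    and G: "generalized_N_function G" "odd_right_derivative G g" "growth_bounds G g gm gp" "normalized_at_one G F"
    and logH: "\<And>t x y. t > 1 \<Longrightarrow> x \<in> ball z R \<Longrightarrow> y \<in> ball z R \<Longrightarrow> 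
      \<bar>growth_ratio G g x t - growth_ratio G g y t\<bar> \<le> L0 / \<bar>ln (2 * R)\<bar>"
    and R: "0 < R" "R < 1 / 2" and "0 < L0" "1 \<le> F" "1 \<le> gm" "gp \<le> real p" "0 < \<gamma>" "0 \<le> \<gamma>1"
    and sub: "cball z R \<subseteq> \<Omega>" and bd: "AE x in lebesgue. x \<in> ball z R \<longrightarrow> w x \<le> \<mu>"
    and C0: "C0 = F\<^sup>2 * exp L0 ^ 3"
  shows "level_decay w z R \<mu> (\<delta> * M) (max 1 (\<gamma>1 * F)) (1 / (2 * R) ^ 3) (C0 * (\<gamma> * C0 + 1)) p (gm - 1)"
proof (rule caccioppoli_imp_level_decay[OF de_giorgi_class_weak_gradient[OF u w] sub _ bd])
  fix \<rho> \<sigma> k :: real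
  assume h: "0 < \<rho>" "\<rho> \<le> R" "0 < \<sigma>" "\<sigma> < 1" "\<mu> - \<delta> * M \<le> k"
  show "(\<integral>\<^sup>+x\<in>superlevel w k z (\<rho> - \<sigma> * \<rho>). ennreal (G x (norm (weak_gradient \<Omega> w x))) \<partial>lebesgue)
           \<le> ennreal \<gamma> * (\<integral>\<^sup>+x\<in>superlevel w k z \<rho>. ennreal (G x \<bar>(w x - k) / (\<sigma> * \<rho>)\<bar>) \<partial>lebesgue)
             + ennreal \<gamma>1 * emeasure lebesgue (superlevel w k z \<rho>)"
  proof (rule de_giorgi_class_caccioppoli[OF u w _ h(1,3,4) _ h(5)])
    show "cball z \<rho> \<subseteq> \<Omega>" using h by (intro order_trans[OF _ sub]) auto
    show "AE x in lebesgue. x \<in> ball z \<rho> \<longrightarrow> w x \<le> \<mu>"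
      using bd by eventually_elim (use h in auto)
  qed
next
  fix T assume T: "max 1 (\<gamma>1 * F) \<le> T" "T \<le> 1 / (2 * R) ^ 3"
  hence "\<gamma>1 \<le> T / F" using \<open>1 \<le> F\<close> by (simp add: field_simps)
  moreover have "1 \<le> T" using T by simp
  from comparable_on_ball[OF G logH R assms(10-12) this T(2)]
  obtain P where "P > 0" "T / F \<le> P" "AE x in lebesgue. x \<in> ball z R \<longrightarrow> 
      N_function_at (G x) (g x) gm gp \<and> P \<le> C0 * G x T \<and> G x T \<le> C0 * P"
    unfolding C0 by blast
  ultimately show "\<exists>P>0. \<gamma>1 \<le> P \<and> (AE x in lebesgue. x \<in> ball z R \<longrightarrow> 
      N_function_at (G x) (g x) gm gp \<and> P \<le> C0 * G x T \<and> G x T \<le> C0 * P)"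
    by (meson order_trans)
qed (use assms in auto)

text \<open>At least half of the ball of radius \<open>R / 8\<close> lies on one side of the mean level \<open>a + \<omega> / 2\<close>. On the
  ball of half that radius, the upper bound improves if this is the lower side, and the lower bound improves
  otherwise (by the same argument for \<open>- u\<close>).\<close>

lemma oscillation_step:
  fixes u :: "'a::euclidean_space \<Rightarrow> real"
  assumes red: "\<And>w (z::'a) r \<mu> D T0 T1 \<omega> B. 
      \<lbrakk>level_decay w z (8 * r) \<mu> D T0 T1 C p \<beta>; (\<lambda>x. indicator B x *\<^sub>R w x) \<in> borel_measurable lebesgue;
       ball z (8 * r) \<subseteq> B; 0 < r; 0 < \<omega>; \<omega> / 2 ^ s0 \<le> D; T0 \<le> \<omega> / 2 ^ S / (8 * r); 2 * \<omega> / r \<le> T1;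
       measure lebesgue (ball z r) / 2 \<le> measure lebesgue {x \<in> ball z r. w x \<le> \<mu> - \<omega> / 2}\<rbrakk>
      \<Longrightarrow> AE x in lebesgue. x \<in> ball z (r / 2) \<longrightarrow> w x \<le> \<mu> - \<omega> / 2 ^ (S + 1)"
    and u: "(\<lambda>x. indicator B x *\<^sub>R u x) \<in> borel_measurable lebesgue" and B: "ball z R \<subseteq> B"
    and LD: "level_decay u z R (a + \<omega>) D T0 T1 C p \<beta>" "level_decay (\<lambda>x. - u x) z R (- a) D T0 T1 C p \<beta>"
    and R: "0 < R" and \<omega>: "0 < \<omega>" "\<omega> / 2 ^ s0 \<le> D" "T0 \<le> \<omega> / 2 ^ S / R" "16 * \<omega> / R \<le> T1"
    and bd: "AE x in lebesgue. x \<in> ball z R \<longrightarrow> a \<le> u x \<and> u x \<le> a + \<omega>"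
  shows "\<exists>a'. AE x in lebesgue. x \<in> ball z (R / 16) \<longrightarrow> a' \<le> u x \<and> u x \<le> a' + (1 - 1 / 2 ^ (S + 1)) * \<omega>"
proof -
  define r where "r = R / 8"
  have r: "8 * r = R" "r / 2 = R / 16" "0 < r" "2 * \<omega> / r = 16 * \<omega> / R" using R by (auto simp: r_def)
  have um: "(\<lambda>x. indicator B x *\<^sub>R - u x) \<in> borel_measurable lebesgue"
    using borel_measurable_uminus[OF u] by simp
  let ?L = "{x \<in> ball z r. u x \<le> a + \<omega> / 2}" and ?U = "{x \<in> ball z r. a + \<omega> / 2 \<le> u x}"
  have rB: "ball z r \<subseteq> B" using r B by (auto simp: r_def)
  have L: "?L \<in> fmeasurable lebesgue" and U: "?U \<in> fmeasurable lebesgue"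
    by (intro subset_ball_fmeasurable[of _ z r] level_sets_measurable[OF u rB]; auto)+
  have "measure lebesgue (ball z r) = measure lebesgue (?L \<union> ?U)" by (rule arg_cong[where f = "measure lebesgue"]) auto
  also have "\<dots> \<le> measure lebesgue ?L + measure lebesgue ?U"
    using L U by (intro measure_Un_le) auto
  finally consider "measure lebesgue (ball z r) / 2 \<le> measure lebesgue ?L" 
    | "measure lebesgue (ball z r) / 2 \<le> measure lebesgue ?U" by linarith
  thus ?thesis
  proof cases
    case 1
    have mid: "a + \<omega> - \<omega> / 2 = a + \<omega> / 2" by simp
    have "AE x in lebesgue. x \<in> ball z (r / 2) \<longrightarrow> u x \<le> a + \<omega> - \<omega> / 2 ^ (S + 1)"
    proof (rule red[OF _ u])
      show "measure lebesgue (ball z r) / 2 \<le> measure lebesgue {x \<in> ball z r. u x \<le> a + \<omega> - \<omega> / 2}"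
        using 1 mid by (simp only:)
    qed (use r LD B \<omega> in auto)
    with bd have "AE x in lebesgue. x \<in> ball z (R / 16) \<longrightarrow> a \<le> u x \<and> u x \<le> a + (1 - 1 / 2 ^ (S + 1)) * \<omega>"
      by eventually_elim (use r R in \<open>auto simp: algebra_simps\<close>)
    thus ?thesis by blast
  next
    case 2
    have "AE x in lebesgue. x \<in> ball z (r / 2) \<longrightarrow> - u x \<le> - a - \<omega> / 2 ^ (S + 1)"
    proof (rule red[OF _ um])
      have "{x \<in> ball z r. - u x \<le> - a - \<omega> / 2} = ?U" by auto
      thus "measure lebesgue (ball z r) / 2 \<le> measure lebesgue {x \<in> ball z r. - u x \<le> - a - \<omega> / 2}"
        using 2 by simp
    qed (use r LD B \<omega> in auto)
    with bd have "AE x in lebesgue. x \<in> ball z (R / 16) \<longrightarrow> a + \<omega> / 2 ^ (S + 1) \<le> u x \<and> 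
        u x \<le> a + \<omega> / 2 ^ (S + 1) + (1 - 1 / 2 ^ (S + 1)) * \<omega>"
      by eventually_elim (use r R in \<open>auto simp: algebra_simps\<close>)
    thus ?thesis by blast
  qed
qed

section \<open>Hoelder continuity\<close>

lemma ex_geometric_scale:
  fixes r R :: real
  assumes "0 < r" "r \<le> R"
  obtains j :: nat where "R / 16 ^ Suc j < r" "r \<le> R / 16 ^ j"
proof -
  have "0 < r / R" using assms by simp
  then obtain n where "(1 / 16) ^ n < r / R" using real_arch_pow_inv[of "r / R" "1 / 16"] by auto
  hence ex: "\<exists>n. R / 16 ^ n < r" using assms by (auto simp: field_simps power_divide)
  define m where "m = (LEAST n. R / 16 ^ n < r)"
  have m: "R / 16 ^ m < r" unfolding m_def using ex by (rule LeastI_ex)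
  then obtain j where j: "m = Suc j" using assms by (cases m) auto
  have "\<not> R / 16 ^ j < r" using not_less_Least[of j] j unfolding m_def by (metis lessI)
  with m j that[of j] show ?thesis by simp
qed

text \<open>Iteration of the previous lemma. The radius \<open>R0\<close> is so small that \<open>T0 * 2 ^ S * R0 \<le> 2 * M\<close>; as
  the radii decrease by the factor 16 and the oscillations only by \<open>q \<ge> 1 / 16\<close>, the slopes never drop below
  the threshold \<open>T0\<close>.\<close>

lemma de_giorgi_class_oscillation:
  fixes u :: "'a::euclidean_space \<Rightarrow> real"
  assumes red: "\<And>w (z::'a) r \<mu> D T0 T1 \<omega> B. 
      \<lbrakk>level_decay w z (8 * r) \<mu> D T0 T1 (C0 * (\<gamma> * C0 + 1)) p (gm - 1); 
       (\<lambda>x. indicator B x *\<^sub>R w x) \<in> borel_measurable lebesgue;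
       ball z (8 * r) \<subseteq> B; 0 < r; 0 < \<omega>; \<omega> / 2 ^ s0 \<le> D; T0 \<le> \<omega> / 2 ^ S / (8 * r); 2 * \<omega> / r \<le> T1;
       measure lebesgue (ball z r) / 2 \<le> measure lebesgue {x \<in> ball z r. w x \<le> \<mu> - \<omega> / 2}\<rbrakk>
      \<Longrightarrow> AE x in lebesgue. x \<in> ball z (r / 2) \<longrightarrow> w x \<le> \<mu> - \<omega> / 2 ^ (S + 1)"
    and u: "u \<in> de_giorgi_class G \<Omega> M \<gamma> \<gamma>1 \<delta>"
    and G: "generalized_N_function G" "odd_right_derivative G g" "growth_bounds G g gm gp" "normalized_at_one G F"
    and logH: "log_Hoelder_ratio \<Omega> G g L0" and \<Omega>: "open \<Omega>" and K: "compact K" "K \<subseteq> \<Omega>"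
    and pos: "0 < M" "0 < L0" "1 \<le> F" "1 \<le> gm" "gp \<le> real p" "0 < \<gamma>" "0 \<le> \<gamma>1"
    and C0: "C0 = F\<^sup>2 * exp L0 ^ 3" and s0: "2 / 2 ^ s0 \<le> \<delta>"
    and q: "1 - 1 / 2 ^ (S + 1) \<le> q" "1 / 16 \<le> q" "q \<le> 1"
  obtains R0 where "0 < R0" 
    "\<And>z j. z \<in> K \<Longrightarrow> \<exists>a. AE x in lebesgue. x \<in> ball z (R0 / 16 ^ j) \<longrightarrow> a \<le> u x \<and> u x \<le> a + 2 * M * q ^ j"
proof -
  obtain e where e: "e > 0" "(\<Union>x\<in>K. ball x e) \<subseteq> \<Omega>"
    by (rule compact_subset_open_imp_ball_epsilon_subset[OF K(1) \<Omega> K(2)])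
  have "\<forall>\<^sub>F R in at_right 0. \<forall>x0\<in>K. \<forall>t>1. \<forall>x\<in>ball x0 R. \<forall>y\<in>ball x0 R.
           \<bar>growth_ratio G g x t - growth_ratio G g y t\<bar> \<le> L0 / \<bar>ln (2 * R)\<bar>"
    using logH K unfolding log_Hoelder_ratio_def by (simp only:)
  then obtain b where "b > 0" and b': "\<And>R. 0 < R \<Longrightarrow> R < b \<Longrightarrow>
      \<forall>x0\<in>K. \<forall>t>1. \<forall>x\<in>ball x0 R. \<forall>y\<in>ball x0 R.
           \<bar>growth_ratio G g x t - growth_ratio G g y t\<bar> \<le> L0 / \<bar>ln (2 * R)\<bar>"
    unfolding eventually_at_right[OF zero_less_one] by metis
  have b: "\<bar>growth_ratio G g x t - growth_ratio G g y t\<bar> \<le> L0 / \<bar>ln (2 * R)\<bar>"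
    if "0 < R" "R < b" "x0 \<in> K" "t > 1" "x \<in> ball x0 R" "y \<in> ball x0 R" for R x0 t x y
    using b'[OF that(1,2)] that(3-6) by blast
  define T0 where "T0 = max 1 (\<gamma>1 * F)"
  have T0: "0 < T0" by (simp add: T0_def)
  (* In this order: balls stay in Omega, the log-Hoelder condition applies, 2 * R0 < 1, the slopes are at
     least T0, and the slopes are at most 1 / (2 * R) ^ 3. *)
  define R0 where "R0 = Min {e / 2, b / 2, 1 / 4, 2 * M / (T0 * 2 ^ S), 1 / (256 * M)}"
  have "0 < R0" unfolding R0_def using e \<open>b > 0\<close> pos T0 by (subst Min_gr_iff) auto
  have "R0 \<le> e / 2" "R0 \<le> b / 2" "R0 \<le> 1 / 4" "R0 \<le> 2 * M / (T0 * 2 ^ S)" "R0 \<le> 1 / (256 * M)"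
    unfolding R0_def by (rule Min_le; simp)+
  note R0 = \<open>0 < R0\<close> this
  have R0T: "T0 * 2 ^ S * R0 \<le> 2 * M" using R0(5) T0 by (simp add: field_simps)
  have R0M: "256 * M * R0 \<le> 1" using R0(6) pos by (simp add: field_simps)
  have bdd: "AE x in lebesgue. x \<in> \<Omega> \<longrightarrow> \<bar>u x\<bar> \<le> M" using de_giorgi_class_bounded[OF u \<Omega>] .
  have "\<exists>a. AE x in lebesgue. x \<in> ball z (R0 / 16 ^ j) \<longrightarrow> a \<le> u x \<and> u x \<le> a + 2 * M * q ^ j" if z: "z \<in> K" for z j
  proof (induction j)
    case 0
    have "ball z R0 \<subseteq> ball z e" using R0 by auto
    hence "ball z R0 \<subseteq> \<Omega>" using e z by blast
    hence "AE x in lebesgue. x \<in> ball z R0 \<longrightarrow> - M \<le> u x \<and> u x \<le> - M + 2 * M"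
      using bdd by (elim eventually_mono) (auto simp: subset_iff abs_le_iff)
    thus ?case by (intro exI[of _ "- M"]) simp
  next
    case (Suc j)
    then obtain a where a: "AE x in lebesgue. x \<in> ball z (R0 / 16 ^ j) \<longrightarrow> a \<le> u x \<and> u x \<le> a + 2 * M * q ^ j" by blast
    define R where "R = R0 / 16 ^ j"
    define \<omega> where "\<omega> = 2 * M * q ^ j"
    have R: "0 < R" "R \<le> R0" using R0 by (auto simp: R_def field_simps)
    have \<omega>: "0 < \<omega>" "\<omega> \<le> 2 * M" using pos q by (auto simp: \<omega>_def intro!: power_le_one mult_left_le)
    have "cball z R \<subseteq> ball z e" using R R0 e by auto
    hence sub: "cball z R \<subseteq> \<Omega>" using e z by blast
    have bd: "AE x in lebesgue. x \<in> ball z R \<longrightarrow> a \<le> u x \<and> u x \<le> a + \<omega>" using a by (simp add: R_def \<omega>_def)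
    have Rb: "R < b" "R < 1 / 2" using R R0 by auto
    note LD = de_giorgi_class_level_decay[OF u _ G b[OF R(1) Rb(1) z] R(1) Rb(2) pos(2-) sub _ C0]
    have um: "(\<lambda>x. indicator (cball z R) x *\<^sub>R u x) \<in> borel_measurable lebesgue"
      using de_giorgi_class_weak_gradient[OF u, of u] sub unfolding has_weak_gradient_def 
      by (blast intro: borel_measurable_integrable locally_integrable_on_cball_measurable)
    have "\<exists>a'. AE x in lebesgue. x \<in> ball z (R / 16) \<longrightarrow> a' \<le> u x \<and> u x \<le> a' + (1 - 1 / 2 ^ (S + 1)) * \<omega>"
    proof (rule oscillation_step[OF red um _ _ _ R(1) \<omega>(1) _ _ _ bd])
      show "ball z R \<subseteq> cball z R" by auto
      show "level_decay u z R (a + \<omega>) (\<delta> * M) T0 (1 / (2 * R) ^ 3) (C0 * (\<gamma> * C0 + 1)) p (gm - 1)"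
        unfolding T0_def
      proof (rule LD)
        show "AE x in lebesgue. x \<in> ball z R \<longrightarrow> u x \<le> a + \<omega>" using bd by eventually_elim auto
      qed simp
      show "level_decay (\<lambda>x. - u x) z R (- a) (\<delta> * M) T0 (1 / (2 * R) ^ 3) (C0 * (\<gamma> * C0 + 1)) p (gm - 1)"
        unfolding T0_def
      proof (rule LD)
        show "AE x in lebesgue. x \<in> ball z R \<longrightarrow> - u x \<le> - a" using bd by eventually_elim auto
      qed simp
      have "\<omega> / 2 ^ s0 \<le> 2 * M / 2 ^ s0" using \<omega> by (intro divide_right_mono) auto
      also have "\<dots> \<le> \<delta> * M" using mult_right_mono[OF s0, of M] pos by simp
      finally show "\<omega> / 2 ^ s0 \<le> \<delta> * M" .
      have "T0 * 2 ^ S * R = T0 * 2 ^ S * R0 * (1 / 16) ^ j" by (simp add: R_def power_divide)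
      also have "\<dots> \<le> 2 * M * q ^ j" using q pos by (intro mult_mono[OF R0T power_mono]) auto
      finally show "T0 \<le> \<omega> / 2 ^ S / R" using R by (simp add: \<omega>_def field_simps)
      have "256 * M * R\<^sup>2 \<le> 256 * M * R0"
      proof (rule mult_left_mono)
        have "R * R \<le> R0 * 1" using R R0 by (intro mult_mono) auto
        thus "R\<^sup>2 \<le> R0" by (simp add: power2_eq_square)
      qed (use pos in simp)
      hence "256 * M * R\<^sup>2 \<le> 1" using R0M by linarith
      hence "16 * (2 * M) / R \<le> 1 / (2 * R) ^ 3" using R by (simp add: field_simps power2_eq_square power3_eq_cube)
      moreover have "16 * \<omega> / R \<le> 16 * (2 * M) / R" using \<omega> R by (intro divide_right_mono) auto
      ultimately show "16 * \<omega> / R \<le> 1 / (2 * R) ^ 3" by linarith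
    qed
    then obtain a' where a': "AE x in lebesgue. x \<in> ball z (R / 16) \<longrightarrow> a' \<le> u x \<and> u x \<le> a' + (1 - 1 / 2 ^ (S + 1)) * \<omega>" by blast
    have "(1 - 1 / 2 ^ (S + 1)) * \<omega> \<le> q * \<omega>" using q \<omega> by (intro mult_right_mono) auto
    also have "\<dots> = 2 * M * q ^ Suc j" by (simp add: \<omega>_def)
    finally have le: "(1 - 1 / 2 ^ (S + 1)) * \<omega> \<le> 2 * M * q ^ Suc j" .
    have "R / 16 = R0 / 16 ^ Suc j" by (simp add: R_def)
    with a' have "AE x in lebesgue. x \<in> ball z (R0 / 16 ^ Suc j) \<longrightarrow> a' \<le> u x \<and> u x \<le> a' + 2 * M * q ^ Suc j"
      by (elim eventually_mono) (use le in force)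
    thus ?case by blast
  qed
  with \<open>0 < R0\<close> that show ?thesis by blast
qed

text \<open>The upper limit of \<open>u\<close> at \<open>x\<close> in the sense of essential bounds: a representative that is defined at
  every point and inherits essential bounds of \<open>u\<close> on open sets.\<close>

definition local_ess_sup :: "('a::euclidean_space \<Rightarrow> real) \<Rightarrow> 'a \<Rightarrow> real" where
  "local_ess_sup u x = Inf {t. \<exists>r>0. AE y in lebesgue. y \<in> ball x r \<longrightarrow> u y \<le> t}"

lemma local_ess_sup_bounds:
  assumes "open U" "x \<in> U" and bd: "AE y in lebesgue. y \<in> U \<longrightarrow> a \<le> u y \<and> u y \<le> b"
  shows "a \<le> local_ess_sup u x" "local_ess_sup u x \<le> b"
proof -
  let ?A = "{t. \<exists>r>0. AE y in lebesgue. y \<in> ball x r \<longrightarrow> u y \<le> t}"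
  obtain r where r: "r > 0" "ball x r \<subseteq> U" using assms by (auto simp: open_contains_ball)
  have "AE y in lebesgue. y \<in> ball x r \<longrightarrow> u y \<le> b" using bd by eventually_elim (use r in auto)
  hence bA: "b \<in> ?A" using r by auto
  have lower: "a \<le> t" if "t \<in> ?A" for t
  proof -
    from that obtain s where s: "s > 0" "AE y in lebesgue. y \<in> ball x s \<longrightarrow> u y \<le> t" by auto
    have "AE y in lebesgue. (y \<in> U \<longrightarrow> a \<le> u y \<and> u y \<le> b) \<and> (y \<in> ball x s \<longrightarrow> u y \<le> t)"
      using bd s(2) by eventually_elim auto
    from AE_imp_ex_in_open[OF this, of "ball x s \<inter> U"] s(1) assms(1,2)
    obtain y where "y \<in> ball x s \<inter> U" "(y \<in> U \<longrightarrow> a \<le> u y \<and> u y \<le> b) \<and> (y \<in> ball x s \<longrightarrow> u y \<le> t)"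
      by (metis Int_iff centre_in_ball empty_iff open_Int open_ball)
    thus ?thesis by auto
  qed
  show "a \<le> local_ess_sup u x" unfolding local_ess_sup_def using bA lower by (intro cInf_greatest) auto
  show "local_ess_sup u x \<le> b" unfolding local_ess_sup_def 
    by (rule cInf_lower[OF bA]) (use lower in \<open>auto intro!: bdd_belowI\<close>)
qed

text \<open>Two points of \<open>K\<close> at distance \<open>d\<close> lie in a ball of radius between \<open>2 * d\<close> and \<open>32 * d\<close> from the
  geometric sequence, unless \<open>2 * d\<close> exceeds \<open>R0\<close>; then the global bound suffices.\<close>

lemma geometric_oscillation_imp_Hoelder:
  fixes u :: "'a::euclidean_space \<Rightarrow> real"
  assumes osc: "\<And>z j. z \<in> K \<Longrightarrow> \<exists>a. AE x in lebesgue. x \<in> ball z (R0 / 16 ^ j) \<longrightarrow> a \<le> u x \<and> u x \<le> a + 2 * M * q ^ j"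
    and "open \<Omega>" "K \<subseteq> \<Omega>" "0 < R0" "0 \<le> M" "0 < \<alpha>" and q: "q = (1 / 16) powr \<alpha>"
    and bdd: "AE x in lebesgue. x \<in> \<Omega> \<longrightarrow> \<bar>u x\<bar> \<le> M"
  shows "local_ess_sup u \<in> Hoelder_on K \<alpha>"
  unfolding Hoelder_on_def
proof (intro CollectI exI ballI)
  fix x y assume x: "x \<in> K" and y: "y \<in> K"
  let ?v = "local_ess_sup u" and ?d = "dist x y"
  have C: "2 * M * (32 / R0) powr \<alpha> * ?d powr \<alpha> = 2 * M * (32 * ?d / R0) powr \<alpha>"
    using assms by (simp add: powr_mult powr_divide)
  show "\<bar>?v x - ?v y\<bar> \<le> 2 * M * (32 / R0) powr \<alpha> * ?d powr \<alpha>"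
  proof (cases "x = y")
    case False
    hence d: "0 < ?d" by simp
    show ?thesis
    proof (cases "2 * ?d \<le> R0")
      case True
      then obtain j where j: "R0 / 16 ^ Suc j < 2 * ?d" "2 * ?d \<le> R0 / 16 ^ j"
        using ex_geometric_scale[of "2 * ?d" R0] d by auto
      obtain a where a: "AE t in lebesgue. t \<in> ball x (R0 / 16 ^ j) \<longrightarrow> a \<le> u t \<and> u t \<le> a + 2 * M * q ^ j"
        using osc[OF x] by blast
      have "x \<in> ball x (R0 / 16 ^ j)" "y \<in> ball x (R0 / 16 ^ j)" using j d \<open>0 < R0\<close> by auto
      hence "\<bar>?v x - ?v y\<bar> \<le> 2 * M * q ^ j"
        using local_ess_sup_bounds[OF open_ball _ a] by (smt (verit))
      also have "q ^ j = (1 / 16 ^ j) powr \<alpha>"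
      proof -
        have "q ^ j = ((1 / 16) powr \<alpha>) powr real j" unfolding q by (subst powr_realpow) auto
        also have "\<dots> = ((1 / 16) powr real j) powr \<alpha>" by (simp add: powr_powr mult.commute)
        also have "(1 / 16 :: real) powr real j = 1 / 16 ^ j" by (subst powr_realpow) (auto simp: power_divide)
        finally show ?thesis .
      qed
      also have "2 * M * \<dots> \<le> 2 * M * (32 * ?d / R0) powr \<alpha>"
        using j(1) assms by (intro mult_left_mono powr_mono2) (auto simp: field_simps)
      finally show ?thesis unfolding C .
    next
      case False
      have "AE t in lebesgue. t \<in> \<Omega> \<longrightarrow> - M \<le> u t \<and> u t \<le> M" using bdd by eventually_elim auto
      from local_ess_sup_bounds[OF \<open>open \<Omega>\<close> _ this] have "\<bar>?v x - ?v y\<bar> \<le> 2 * M * 1"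
        using x y \<open>K \<subseteq> \<Omega>\<close> by (smt (verit) subsetD)
      also have "1 \<le> (32 * ?d / R0) powr \<alpha>" using False assms by (intro ge_one_powr_ge_zero) (auto simp: field_simps)
      hence "2 * M * 1 \<le> 2 * M * (32 * ?d / R0) powr \<alpha>" using assms by (intro mult_left_mono) auto
      finally show ?thesis unfolding C .
    qed
  qed simp
qed

theorem theorem1p2:
  fixes gm gp F L \<gamma> \<delta> :: real
  assumes "CARD('n::finite) \<ge> 2"
    and "1 < gm" and "gm \<le> gp" and "gp < real CARD('n)"
    and "F \<ge> 1"
    and "\<gamma> > 0" and "0 < \<delta>" and "\<delta> \<le> 2"
  shows "\<exists>\<alpha>. 0 < \<alpha> \<and> \<alpha> \<le> 1 \<and>
    (\<forall>(\<Omega> :: (real^'n) set) G g L0 M \<gamma>1.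
       \<Omega> \<noteq> {} \<and> open \<Omega> \<and> connected \<Omega> \<and> bounded \<Omega> \<and>
       generalized_N_function G \<and> odd_right_derivative G g \<and>
       growth_bounds G g gm gp \<and>
       normalized_at_one G F \<and>
       L0 > 1 \<and> L = exp L0 \<and> log_Hoelder_ratio \<Omega> G g L0 \<and>
       M > 0 \<and> \<gamma>1 > 0 \<longrightarrow>
       de_giorgi_class G \<Omega> M \<gamma> \<gamma>1 \<delta> \<subseteq>
         {u. \<exists>v\<in>Hoelder_loc \<Omega> \<alpha>. AE x in lebesgue_on \<Omega>. u x = v x})"
proof -
  define p where "p = nat \<lceil>gp\<rceil>"
  have p: "gp \<le> real p" unfolding p_def by (rule real_nat_ceiling_ge)
  define C0 where "C0 = F\<^sup>2 * exp (ln L) ^ 3"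
  have C0: "0 < C0" using assms(5) by (simp add: C0_def)
  obtain m :: nat where m: "(1 / 2 :: real) ^ m < \<delta> / 2" using real_arch_pow_inv[of "\<delta> / 2" "1 / 2"] assms by auto
  (* 2 * M / 2 ^ s0 <= delta * M: the levels used lie in the range for which the class gives information. *)
  define s0 where "s0 = m + 1"
  have s0: "1 \<le> s0" "2 / 2 ^ s0 \<le> \<delta>" using m assms by (auto simp: s0_def power_divide)
  have C: "0 \<le> C0 * (\<gamma> * C0 + 1)" and gm: "0 < gm - 1" using C0 assms by auto
  obtain S where red: "\<And>w (z::real^'n) r \<mu> D T0 T1 \<omega> B. 
      \<lbrakk>level_decay w z (8 * r) \<mu> D T0 T1 (C0 * (\<gamma> * C0 + 1)) p (gm - 1); 
       (\<lambda>x. indicator B x *\<^sub>R w x) \<in> borel_measurable lebesgue;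
       ball z (8 * r) \<subseteq> B; 0 < r; 0 < \<omega>; \<omega> / 2 ^ s0 \<le> D; T0 \<le> \<omega> / 2 ^ S / (8 * r); 2 * \<omega> / r \<le> T1;
       measure lebesgue (ball z r) / 2 \<le> measure lebesgue {x \<in> ball z r. w x \<le> \<mu> - \<omega> / 2}\<rbrakk>
      \<Longrightarrow> AE x in lebesgue. x \<in> ball z (r / 2) \<longrightarrow> w x \<le> \<mu> - \<omega> / 2 ^ (S + 1)"
    by (rule level_decay_imp_sup_reduction[OF C gm s0(1), where p = p]) (rule that, assumption)
  define \<theta> where "\<theta> = (1::real) - 1 / 2 ^ (S + 1)"
  have "(1::real) < 2 ^ (S + 1)" by (rule one_less_power) auto
  hence \<theta>: "0 < \<theta>" "\<theta> < 1" by (simp_all add: \<theta>_def)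
  (* The exponent for which 16 powr (- alpha) is the reduction factor theta, or 1 if that is larger than 1. *)
  define \<alpha> where "\<alpha> = min 1 (- log 16 \<theta>)"
  have \<alpha>: "0 < \<alpha>" "\<alpha> \<le> 1" using \<theta> by (auto simp: \<alpha>_def)
  define q where "q = (1 / 16 :: real) powr \<alpha>"
  have q: "\<theta> \<le> q" "1 / 16 \<le> q" "q < 1"
  proof -
    have q': "q = 16 powr (- \<alpha>)" by (simp add: q_def powr_divide powr_minus_divide)
    have "\<theta> = 16 powr (log 16 \<theta>)" using \<theta> by simp
    also have "\<dots> \<le> 16 powr (- \<alpha>)" by (intro powr_mono) (auto simp: \<alpha>_def)
    finally show "\<theta> \<le> q" by (simp add: q')
    have "16 powr (- 1) \<le> (16::real) powr (- \<alpha>)" using \<alpha> by (intro powr_mono) auto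
    thus "1 / 16 \<le> q" by (simp add: q' powr_minus_divide)
    have "16 powr (- \<alpha>) < (16::real) powr 0" using \<alpha> by (intro powr_less_mono) auto
    thus "q < 1" by (simp add: q')
  qed
  show ?thesis
  proof (intro exI conjI allI impI subsetI CollectI)
    show "0 < \<alpha>" "\<alpha> \<le> 1" by fact+
    fix \<Omega> :: "(real^'n) set" and G g L0 M \<gamma>1 u
    assume H: "\<Omega> \<noteq> {} \<and> open \<Omega> \<and> connected \<Omega> \<and> bounded \<Omega> \<and>
       generalized_N_function G \<and> odd_right_derivative G g \<and> growth_bounds G g gm gp \<and>
       normalized_at_one G F \<and> L0 > 1 \<and> L = exp L0 \<and> log_Hoelder_ratio \<Omega> G g L0 \<and> M > 0 \<and> \<gamma>1 > 0"
      and u: "u \<in> de_giorgi_class G \<Omega> M \<gamma> \<gamma>1 \<delta>"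
    have \<Omega>: "open \<Omega>" using H by blast
    have C0': "C0 = F\<^sup>2 * exp L0 ^ 3" using H by (simp add: C0_def)
    have bdd: "AE x in lebesgue. x \<in> \<Omega> \<longrightarrow> \<bar>u x\<bar> \<le> M" using de_giorgi_class_bounded[OF u \<Omega>] .
    have osc: "\<exists>R0>0. \<forall>z\<in>K. \<forall>j. \<exists>a. AE x in lebesgue. x \<in> ball z (R0 / 16 ^ j) \<longrightarrow> a \<le> u x \<and> u x \<le> a + 2 * M * q ^ j"
      if "compact K" "K \<subseteq> \<Omega>" for K
    proof -
      have pos: "0 < M" "0 < L0" "1 \<le> F" "1 \<le> gm" "gp \<le> real p" "0 < \<gamma>" "0 \<le> \<gamma>1"
        using H assms p by auto
      have G: "generalized_N_function G" "odd_right_derivative G g" "growth_bounds G g gm gp"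
        "normalized_at_one G F" "log_Hoelder_ratio \<Omega> G g L0" using H by blast+
      show ?thesis
        by (rule de_giorgi_class_oscillation[OF red u G \<Omega> that pos C0' s0(2) q(1,2)[unfolded \<theta>_def] less_imp_le[OF q(3)]])
           (assumption+, blast)
    qed
    let ?v = "local_ess_sup u"
    show "\<exists>v\<in>Hoelder_loc \<Omega> \<alpha>. AE x in lebesgue_on \<Omega>. u x = v x"
    proof
      show "?v \<in> Hoelder_loc \<Omega> \<alpha>"
        unfolding Hoelder_loc_def
      proof (intro CollectI allI impI, elim conjE)
        fix \<Omega>' assume K: "compact (closure \<Omega>')" "closure \<Omega>' \<subseteq> \<Omega>"
        obtain R0 where R0: "R0 > 0" "\<forall>z\<in>closure \<Omega>'. \<forall>j. \<exists>a. AE x in lebesgue. x \<in> ball z (R0 / 16 ^ j) \<longrightarrow> a \<le> u x \<and> u x \<le> a + 2 * M * q ^ j"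
          using osc[OF K] by blast
        show "?v \<in> Hoelder_on (closure \<Omega>') \<alpha>"
          by (rule geometric_oscillation_imp_Hoelder[OF _ \<Omega> K(2) R0(1) _ \<alpha>(1) q_def bdd]) (use R0(2) H in auto)
      qed
      (* Near every point, u and its representative lie almost everywhere in a common interval of small
         length. *)
      have "AE x in lebesgue. x \<in> \<Omega> \<longrightarrow> \<bar>u x - ?v x\<bar> \<le> 1 / real (Suc n)" for n
      proof (rule AE_on_set_if_locally)
        fix z assume z: "z \<in> \<Omega>"
        obtain R0 where R0: "R0 > 0" "\<And>j. \<exists>a. AE x in lebesgue. x \<in> ball z (R0 / 16 ^ j) \<longrightarrow> a \<le> u x \<and> u x \<le> a + 2 * M * q ^ j"
          using osc[of "{z}"] z by auto
        have "0 < 1 / real (Suc n) / (2 * M)" using H by simp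
        then obtain j where "q ^ j < 1 / real (Suc n) / (2 * M)" using real_arch_pow_inv q(3) by blast
        moreover have "0 < 2 * M" using H by simp
        ultimately have j: "2 * M * q ^ j < 1 / real (Suc n)"
          by (simp only: pos_less_divide_eq mult.commute)
        obtain a where a: "AE x in lebesgue. x \<in> ball z (R0 / 16 ^ j) \<longrightarrow> a \<le> u x \<and> u x \<le> a + 2 * M * q ^ j" using R0(2) by blast
        have "AE x in lebesgue. x \<in> ball z (R0 / 16 ^ j) \<longrightarrow> \<bar>u x - ?v x\<bar> \<le> 1 / real (Suc n)"
          using a
        proof eventually_elim
          case (elim x)
          show ?case
          proof
            assume x: "x \<in> ball z (R0 / 16 ^ j)"
            show "\<bar>u x - ?v x\<bar> \<le> 1 / real (Suc n)"
              using elim x local_ess_sup_bounds[OF open_ball x a] j by linarith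
          qed
        qed
        thus "\<exists>U. open U \<and> z \<in> U \<and> (AE x in lebesgue. x \<in> U \<longrightarrow> \<bar>u x - ?v x\<bar> \<le> 1 / real (Suc n))"
          using R0(1) by (intro exI[of _ "ball z (R0 / 16 ^ j)"]) auto
      qed
      hence "AE x in lebesgue. \<forall>n. x \<in> \<Omega> \<longrightarrow> \<bar>u x - ?v x\<bar> \<le> 1 / real (Suc n)"
        by (subst AE_all_countable) auto
      hence "AE x in lebesgue. x \<in> \<Omega> \<longrightarrow> u x = ?v x"
      proof eventually_elim
        case (elim x)
        show ?case
        proof
          assume x: "x \<in> \<Omega>"
          show "u x = ?v x"
          proof (rule ccontr)
            assume "u x \<noteq> ?v x"
            then obtain n where "inverse (real (Suc n)) < \<bar>u x - ?v x\<bar>" using reals_Archimedean[of "\<bar>u x - ?v x\<bar>"] by auto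
            thus False using elim x by (auto simp: inverse_eq_divide not_le[symmetric])
          qed
        qed
      qed
      thus "AE x in lebesgue_on \<Omega>. u x = ?v x" using \<Omega> by (subst AE_restrict_space_iff) auto
    qed
  qed
qed

end
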